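(* Let $1\le i\le n-3$, $0\le k\le n-i-3$, and let $\tau$ be the face of the cone $\sigma$ of $X_{2,n}$ with $$D_\tau=[(1,2),(i,i+1)]\cup[(i+k+2,i+k+3),(n-1,n)]$$ (a "$J$-block" of $k+1$ consecutive $\sigma_{m,1}$'s). Then: (1) The tangent cone $TC_{P_\tau}X_\sigma$ is identified with (is isomorphic to) $Z_{2,k+4}\times K^m$, where $m=\mathrm{codim}_\sigma\tau=2(n-k)-6$; in particular, $TC_{P_\tau}X_\sigma$ is a toric variety. (2) $\mathrm{mult}_{P_\tau}X_{2,n}=Cat_{k+2}=\dfrac{1}{k+3}\dbinom{2k+4}{k+2}$.
   Context: $K$ is an algebraically closed field of arbitrary characteristic. $I_{2,n}=\{(i_1,i_2)\in\mathbb{Z}^2: 1\le i_1<i_2\le n\}$ with the componentwise order, a finite distributive lattice (join and meet are componentwise max and min). For a finite distributive lattice $\mathcal{L}$, the Hibi toric variety $X(\mathcal{L})\subset\mathbb{A}^{\#\mathcal{L}}$ is the affine variety whose vanishing ideal in $K[X_\alpha,\alpha\in\mathcal{L}]$ is generated by the binomials $X_\alpha X_\beta-X_{\alpha\vee\beta}X_{\alpha\wedge\beta}$. Write $X_{2,n}=X(I_{2,n})$, and for $r\ge3$ let $Z_{2,r}=X(\widetilde{I_{2,r}})$, where $\widetilde{I_{2,r}}=I_{2,r}\setminus\{(1,2),(r-1,r)\}$. Let $J=J(\mathcal{L})$ be the poset of join-irreducible elements of $\mathcal{L}$ ($z$ such that $z=x\vee y$ implies $z=x$ or $z=y$; the minimal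 element is included), and for $\alpha\in\mathcal{L}$ put $I_\alpha=\{z\in J: z\le\alpha\}$. Let $M$ be the free abelian group with basis $\{f_z\}_{z\in J}$, $N$ its dual with dual basis $\{e_z\}_{z\in J}$, and $f_{I_\alpha}=\sum_{z\in I_\alpha}f_z$. Let $\sigma\subset N_{\mathbb{R}}$ be the cone generated by the $e_z$ with $z$ maximal in $J$ and the $e_{y'}-e_y$ with $y$ covering $y'$ in $J$. The semigroup $\sigma^\vee\cap M$ is generated by the $f_{I_\alpha}$, and $X(\mathcal{L})=X_\sigma=\mathrm{Spec}\,K[\sigma^\vee\cap M]$, the coordinate $X_\alpha$ corresponding to $f_{I_\alpha}$. For a face $\tau$ of $\sigma$, $P_\tau\in X_\sigma$ is the point whose $\alpha$-th coordinate is $1$ if $f_{I_\alpha}\in\tau^\perp$ and $0$ otherwise, and $D_\tau=\{\alpha\in\mathcal{L}: P_\tau(\alpha)\ne0\}$. A sublattice $\mathcal{L}'\subset\mathcal{L}$ is embedded if $\alpha\vee\beta,\alpha\wedge\beta\in\mathcal{L}'$ implies $\alpha,\beta\in\mathcal{L}'$; $\tau\mapsto D_\tau$ is a bijection between faces of $\sigma$ and embedded sublattices of $\mathcal{L}$. Here this is applied with $\mathcal{L}=I_{2,n}$; intervals $[\cdot,\cdot]$ in $D_\tau$ are taken in $I_{2,n}$. $\mathrm{codim}_\sigma\tau=\dim\sigma-\dim\tau$. The tangent cone at a closed point $P$ is $TC_PX=\mathrm{Spec}\,\mathrm{gr}(\mathcal{O}_{X,P},\mathfrak{m}_P)$, and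 $\mathrm{mult}_PX$ is the degree of the graded ring $\mathrm{gr}(\mathcal{O}_{X,P},\mathfrak{m}_P)$ (for a graded ring of dimension $r+1$, its degree $e$ is defined by the leading coefficient $e/r!$ of the Hilbert polynomial). *)

theory Defs
  imports
    "HOL-Analysis.Analysis"
    "HOL-Library.Product_Order"
    "HOL-Analysis.Finite_Function_Topology"
    "HOL-Algebra.QuotRing"
    "HOL-Algebra.Ideal_Product"
    "HOL-Algebra.Embedded_Algebras"
    "HOL-Algebra.Module"
begin

section \<open>Algebras over a field\<close>

text \<open>
  A \<open>K\<close>-algebra is an element of the record type \<^type>\<open>module\<close> (a ring together with
  a scalar multiplication), where the field \<open>K\<close> is a type of class \<^class>\<open>field\<close>. An affine
  \<open>K\<close>-scheme \<open>Spec A\<close> is represented by its \<open>K\<close>-algebra \<open>A\<close>, so that isomorphism of affine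
  \<open>K\<close>-schemes is isomorphism of \<open>K\<close>-algebras.
\<close>

definition alg_iso :: "('k, 'a) module \<Rightarrow> ('k, 'b) module \<Rightarrow> ('a \<Rightarrow> 'b) set"
  where "alg_iso A B =
    {h \<in> ring_iso A B. \<forall>c. \<forall>x\<in>carrier A. h (c \<odot>\<^bsub>A\<^esub> x) = c \<odot>\<^bsub>B\<^esub> h x}"

definition alg_isomorphic :: "('k, 'a) module \<Rightarrow> ('k, 'b) module \<Rightarrow> bool"  (infix "\<cong>\<^sub>K" 50)
  where "A \<cong>\<^sub>K B \<longleftrightarrow> alg_iso A B \<noteq> {}"

text \<open>The algebra \<open>K[S]\<close> of an (additively written) submonoid \<open>S\<close> of a commutative monoid;
  \<^term>\<open>Poly_Mapping.single s 1\<close> is the basis element with exponent \<open>s\<close>.\<close>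

definition monoid_alg :: "'m::comm_monoid_add set \<Rightarrow> ('k::field, 'm \<Rightarrow>\<^sub>0 'k) module"
  where "monoid_alg S =
    \<lparr>carrier = {p. Poly_Mapping.keys p \<subseteq> S}, mult = (*), one = 1, ring.zero = 0, add = (+),
     smult = (\<lambda>c p. Poly_Mapping.single 0 c * p)\<rparr>"

definition poly_alg :: "'v set \<Rightarrow> ('k::field, ('v \<Rightarrow>\<^sub>0 nat) \<Rightarrow>\<^sub>0 'k) module"
  where "poly_alg V = monoid_alg {m. Poly_Mapping.keys m \<subseteq> V}"

definition poly_var :: "'v \<Rightarrow> ('v \<Rightarrow>\<^sub>0 nat) \<Rightarrow>\<^sub>0 'k::field"
  where "poly_var v = Poly_Mapping.single (Poly_Mapping.single v 1) 1"

definition poly_eval :: "('v \<Rightarrow> 'k::field) \<Rightarrow> (('v \<Rightarrow>\<^sub>0 nat) \<Rightarrow>\<^sub>0 'k) \<Rightarrow> 'k"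
  where "poly_eval x p =
    (\<Sum>m\<in>Poly_Mapping.keys p. Poly_Mapping.lookup p m *
       (\<Prod>v\<in>Poly_Mapping.keys m. x v ^ Poly_Mapping.lookup m v))"

definition quot_alg :: "('k, 'a) module \<Rightarrow> 'a set \<Rightarrow> ('k, 'a set) module"
  where "quot_alg A I =
    \<lparr>carrier = carrier (A Quot I), mult = mult (A Quot I), one = one (A Quot I),
     ring.zero = ring.zero (A Quot I), add = add (A Quot I),
     smult = (\<lambda>c X. \<Union>x\<in>X. I +>\<^bsub>A\<^esub> (c \<odot>\<^bsub>A\<^esub> x))\<rparr>"

text \<open>Localization of a commutative algebra at a multiplicatively closed subset \<open>S\<close>, which need
  not consist of non-zero-divisors.\<close>

definition frac_rel :: "('k, 'a) module \<Rightarrow> 'a set \<Rightarrow> (('a \<times> 'a) \<times> ('a \<times> 'a)) set"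
  where "frac_rel A S =
    {((a, s), (b, t)). a \<in> carrier A \<and> s \<in> S \<and> b \<in> carrier A \<and> t \<in> S \<and>
       (\<exists>u\<in>S. u \<otimes>\<^bsub>A\<^esub> (t \<otimes>\<^bsub>A\<^esub> a) = u \<otimes>\<^bsub>A\<^esub> (s \<otimes>\<^bsub>A\<^esub> b))}"

definition frac :: "('k, 'a) module \<Rightarrow> 'a set \<Rightarrow> 'a \<Rightarrow> 'a \<Rightarrow> ('a \<times> 'a) set"
  where "frac A S a s = frac_rel A S `` {(a, s)}"

definition localization :: "('k, 'a) module \<Rightarrow> 'a set \<Rightarrow> ('k, ('a \<times> 'a) set) module"
  where "localization A S =
    \<lparr>carrier = (carrier A \<times> S) // frac_rel A S,
     mult = (\<lambda>X Y. \<Union>(a, s)\<in>X. \<Union>(b, t)\<in>Y. frac A S (a \<otimes>\<^bsub>A\<^esub> b) (s \<otimes>\<^bsub>A\<^esub> t)),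
     one = frac A S \<one>\<^bsub>A\<^esub> \<one>\<^bsub>A\<^esub>,
     ring.zero = frac A S \<zero>\<^bsub>A\<^esub> \<one>\<^bsub>A\<^esub>,
     add = (\<lambda>X Y. \<Union>(a, s)\<in>X. \<Union>(b, t)\<in>Y.
              frac A S (t \<otimes>\<^bsub>A\<^esub> a \<oplus>\<^bsub>A\<^esub> s \<otimes>\<^bsub>A\<^esub> b) (s \<otimes>\<^bsub>A\<^esub> t)),
     smult = (\<lambda>c X. \<Union>(a, s)\<in>X. frac A S (c \<odot>\<^bsub>A\<^esub> a) s)\<rparr>"


section \<open>The associated graded algebra and its degree\<close>

fun ideal_pow :: "('k, 'a) module \<Rightarrow> 'a set \<Rightarrow> nat \<Rightarrow> 'a set"
  where
    "ideal_pow A I 0 = carrier A"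
  | "ideal_pow A I (Suc q) = ideal_prod A (ideal_pow A I q) I"

text \<open>
  \<open>gr(A, I)\<close> is the direct sum of the \<open>I\<^sup>q / I\<^sup>q\<^sup>+\<^sup>1\<close>: an element is a finitely supported family
  \<open>f\<close> of cosets \<open>f q = I\<^sup>q\<^sup>+\<^sup>1 + x\<close> with \<open>x \<in> I\<^sup>q\<close>. The product of the classes of \<open>x \<in> I\<^sup>i\<close> and
  \<open>y \<in> I\<^sup>j\<close> is the class of \<open>x y\<close> modulo \<open>I\<^sup>i\<^sup>+\<^sup>j\<^sup>+\<^sup>1\<close>, which is what \<^const>\<open>rcoset_mult\<close> for the
  ideal \<open>I\<^sup>i\<^sup>+\<^sup>j\<^sup>+\<^sup>1\<close> computes.
\<close>

definition assoc_graded :: "('k, 'a) module \<Rightarrow> 'a set \<Rightarrow> ('k, nat \<Rightarrow> 'a set) module"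
  where "assoc_graded A I =
    \<lparr>carrier = {f. (\<forall>q. \<exists>x\<in>ideal_pow A I q. f q = ideal_pow A I (Suc q) +>\<^bsub>A\<^esub> x) \<and>
                   finite {q. f q \<noteq> ideal_pow A I (Suc q)}},
     mult = (\<lambda>f g q. finsum (A Quot ideal_pow A I (Suc q))
               (\<lambda>i. rcoset_mult A (ideal_pow A I (Suc q)) (f i) (g (q - i))) {..q}),
     one = (\<lambda>q. if q = 0 then ideal_pow A I (Suc 0) +>\<^bsub>A\<^esub> \<one>\<^bsub>A\<^esub> else ideal_pow A I (Suc q)),
     ring.zero = (\<lambda>q. ideal_pow A I (Suc q)),
     add = (\<lambda>f g q. f q <+>\<^bsub>A\<^esub> g q),
     smult = (\<lambda>c f q. \<Union>x\<in>f q. ideal_pow A I (Suc q) +>\<^bsub>A\<^esub> (c \<odot>\<^bsub>A\<^esub> x))\<rparr>"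

definition graded_piece :: "('k, 'a) module \<Rightarrow> 'a set \<Rightarrow> nat \<Rightarrow> (nat \<Rightarrow> 'a set) set"
  where "graded_piece A I q =
    {f \<in> carrier (assoc_graded A I). \<forall>i. i \<noteq> q \<longrightarrow> f i = ideal_pow A I (Suc i)}"

definition krull_dim :: "('a, 'b) ring_scheme \<Rightarrow> enat"
  where "krull_dim R =
    Sup {enat l | l. \<exists>p :: nat \<Rightarrow> 'a set.
           (\<forall>i\<le>l. primeideal (p i) R) \<and> (\<forall>i<l. p i \<subset> p (Suc i))}"

text \<open>\<open>G\<close> is a graded \<open>K\<close>-algebra with homogeneous components \<open>c 0, c 1, \<dots>\<close>; the dimension
  of \<open>c q\<close> is taken over the image of \<open>K\<close> in \<open>G\<close>.\<close>

definition hilbert_fun :: "('k, 'a) module \<Rightarrow> (nat \<Rightarrow> 'a set) \<Rightarrow> nat \<Rightarrow> nat"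
  where "hilbert_fun G c q = ring.dim G (range (\<lambda>x. x \<odot>\<^bsub>G\<^esub> \<one>\<^bsub>G\<^esub>)) (c q)"

definition hilbert_poly :: "('k, 'a) module \<Rightarrow> (nat \<Rightarrow> 'a set) \<Rightarrow> rat Polynomial.poly"
  where "hilbert_poly G c =
    (THE p. \<forall>\<^sub>F q in sequentially. of_nat (hilbert_fun G c q) = Polynomial.poly p (of_nat q))"

text \<open>If \<open>G\<close> has dimension \<open>r + 1\<close> then its degree is \<open>e\<close>, where \<open>e / r!\<close> is the leading
  coefficient of the Hilbert polynomial.\<close>

definition graded_degree :: "('k, 'a) module \<Rightarrow> (nat \<Rightarrow> 'a set) \<Rightarrow> rat"
  where "graded_degree G c =
    fact (the_enat (krull_dim G) - 1) * Polynomial.lead_coeff (hilbert_poly G c)"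


section \<open>Affine varieties, tangent cones and multiplicities\<close>

text \<open>The affine space with coordinates indexed by \<open>V\<close> consists of the extensional functions
  on \<open>V\<close>; a variety in it is a set of points.\<close>

definition affine_space :: "'v set \<Rightarrow> ('v \<Rightarrow> 'k) set"
  where "affine_space V = V \<rightarrow>\<^sub>E UNIV"

definition zero_locus :: "'v set \<Rightarrow> (('v \<Rightarrow>\<^sub>0 nat) \<Rightarrow>\<^sub>0 'k::field) set \<Rightarrow> ('v \<Rightarrow> 'k) set"
  where "zero_locus V F = {x \<in> affine_space V. \<forall>f\<in>F. poly_eval x f = 0}"

definition vanishing_ideal :: "'v set \<Rightarrow> ('v \<Rightarrow> 'k::field) set \<Rightarrow> (('v \<Rightarrow>\<^sub>0 nat) \<Rightarrow>\<^sub>0 'k) set"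
  where "vanishing_ideal V X = {f \<in> carrier (poly_alg V). \<forall>x\<in>X. poly_eval x f = 0}"

definition coord_alg ::
    "'v set \<Rightarrow> ('v \<Rightarrow> 'k::field) set \<Rightarrow> ('k, (('v \<Rightarrow>\<^sub>0 nat) \<Rightarrow>\<^sub>0 'k) set) module"
  where "coord_alg V X = quot_alg (poly_alg V) (vanishing_ideal V X)"

definition point_ideal ::
    "'v set \<Rightarrow> ('v \<Rightarrow> 'k::field) set \<Rightarrow> ('v \<Rightarrow> 'k) \<Rightarrow> (('v \<Rightarrow>\<^sub>0 nat) \<Rightarrow>\<^sub>0 'k) set set"
  where "point_ideal V X P =
    {vanishing_ideal V X +>\<^bsub>poly_alg V\<^esub> f | f. f \<in> carrier (poly_alg V) \<and> poly_eval P f = 0}"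

definition local_alg ::
    "'v set \<Rightarrow> ('v \<Rightarrow> 'k::field) set \<Rightarrow> ('v \<Rightarrow> 'k) \<Rightarrow>
       ('k, ((('v \<Rightarrow>\<^sub>0 nat) \<Rightarrow>\<^sub>0 'k) set \<times> (('v \<Rightarrow>\<^sub>0 nat) \<Rightarrow>\<^sub>0 'k) set) set) module"
  where "local_alg V X P =
    localization (coord_alg V X) (carrier (coord_alg V X) - point_ideal V X P)"

definition local_max_ideal ::
    "'v set \<Rightarrow> ('v \<Rightarrow> 'k::field) set \<Rightarrow> ('v \<Rightarrow> 'k) \<Rightarrow>
       ((('v \<Rightarrow>\<^sub>0 nat) \<Rightarrow>\<^sub>0 'k) set \<times> (('v \<Rightarrow>\<^sub>0 nat) \<Rightarrow>\<^sub>0 'k) set) set set"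
  where "local_max_ideal V X P =
    {frac (coord_alg V X) (carrier (coord_alg V X) - point_ideal V X P) a s | a s.
       a \<in> point_ideal V X P \<and> s \<in> carrier (coord_alg V X) - point_ideal V X P}"

definition tangent_cone ::
    "'v set \<Rightarrow> ('v \<Rightarrow> 'k::field) set \<Rightarrow> ('v \<Rightarrow> 'k) \<Rightarrow>
       ('k, nat \<Rightarrow> ((('v \<Rightarrow>\<^sub>0 nat) \<Rightarrow>\<^sub>0 'k) set \<times> (('v \<Rightarrow>\<^sub>0 nat) \<Rightarrow>\<^sub>0 'k) set) set set) module"
  where "tangent_cone V X P = assoc_graded (local_alg V X P) (local_max_ideal V X P)"

definition mult_at :: "'v set \<Rightarrow> ('v \<Rightarrow> 'k::field) set \<Rightarrow> ('v \<Rightarrow> 'k) \<Rightarrow> rat"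
  where "mult_at V X P =
    graded_degree (tangent_cone V X P)
      (graded_piece (local_alg V X P) (local_max_ideal V X P))"

definition product_variety ::
    "'v set \<Rightarrow> 'w set \<Rightarrow> ('v \<Rightarrow> 'k) set \<Rightarrow> ('w \<Rightarrow> 'k) set \<Rightarrow> ('v + 'w \<Rightarrow> 'k) set"
  where "product_variety V W X Y =
    {z \<in> affine_space (Sum_Type.Plus V W). (\<lambda>v\<in>V. z (Inl v)) \<in> X \<and> (\<lambda>w\<in>W. z (Inr w)) \<in> Y}"


section \<open>Cones and affine toric varieties\<close>

text \<open>
  For a finite set \<open>J\<close>, the dual lattices \<open>M\<close> and \<open>N\<close> with bases \<open>f\<^sub>z\<close> and \<open>e\<^sub>z\<close> for \<open>z \<in> J\<close>
  are both the \<open>'z \<Rightarrow>\<^sub>0 int\<close> supported on \<open>J\<close>, and \<open>M\<^sub>\<real>\<close> and \<open>N\<^sub>\<real>\<close> the \<open>'z \<Rightarrow>\<^sub>0 real\<close> supported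
  on \<open>J\<close>; each basis vector is \<^term>\<open>Poly_Mapping.single z 1\<close>.
\<close>

definition pairing :: "('z \<Rightarrow>\<^sub>0 real) \<Rightarrow> ('z \<Rightarrow>\<^sub>0 real) \<Rightarrow> real"
  where "pairing u v =
    (\<Sum>z\<in>Poly_Mapping.keys v. Poly_Mapping.lookup u z * Poly_Mapping.lookup v z)"

definition lattice_vec :: "('z \<Rightarrow>\<^sub>0 int) \<Rightarrow> ('z \<Rightarrow>\<^sub>0 real)"
  where "lattice_vec m = Poly_Mapping.map real_of_int m"

definition dual_cone :: "'z set \<Rightarrow> ('z \<Rightarrow>\<^sub>0 real) set \<Rightarrow> ('z \<Rightarrow>\<^sub>0 real) set"
  where "dual_cone J \<sigma> = {u. Poly_Mapping.keys u \<subseteq> J \<and> (\<forall>v\<in>\<sigma>. 0 \<le> pairing u v)}"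

definition cone_face :: "'z set \<Rightarrow> ('z \<Rightarrow>\<^sub>0 real) set \<Rightarrow> ('z \<Rightarrow>\<^sub>0 real) set \<Rightarrow> bool"
  where "cone_face J \<sigma> \<tau> \<longleftrightarrow> (\<exists>u\<in>dual_cone J \<sigma>. \<tau> = {v \<in> \<sigma>. pairing u v = 0})"

definition cone_codim :: "('z \<Rightarrow>\<^sub>0 real) set \<Rightarrow> ('z \<Rightarrow>\<^sub>0 real) set \<Rightarrow> nat"
  where "cone_codim \<sigma> \<tau> = dim \<sigma> - dim \<tau>"

definition rational_cone :: "'z set \<Rightarrow> ('z \<Rightarrow>\<^sub>0 real) set \<Rightarrow> bool"
  where "rational_cone J \<sigma> \<longleftrightarrow>
    (\<exists>G. finite G \<and> (\<forall>g\<in>G. Poly_Mapping.keys g \<subseteq> J) \<and> \<sigma> = convex_cone hull (lattice_vec ` G))"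

definition strongly_convex :: "('z \<Rightarrow>\<^sub>0 real) set \<Rightarrow> bool"
  where "strongly_convex \<sigma> \<longleftrightarrow> (\<forall>v\<in>\<sigma>. - v \<in> \<sigma> \<longrightarrow> v = 0)"

definition toric_alg :: "'z set \<Rightarrow> ('z \<Rightarrow>\<^sub>0 real) set \<Rightarrow> ('k::field, ('z \<Rightarrow>\<^sub>0 int) \<Rightarrow>\<^sub>0 'k) module"
  where "toric_alg J \<sigma> = monoid_alg {m. lattice_vec m \<in> dual_cone J \<sigma>}"

definition is_affine_toric :: "('k::field, 'a) module \<Rightarrow> bool"
  where "is_affine_toric A \<longleftrightarrow>
    (\<exists>(d::nat) \<sigma>. rational_cone {..<d} \<sigma> \<and> strongly_convex \<sigma> \<and> A \<cong>\<^sub>K toric_alg {..<d} \<sigma>)"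


section \<open>Hibi toric varieties\<close>

text \<open>The finite distributive lattices in question are the finite sublattices \<open>L\<close> of a type.\<close>

definition hibi_binomials :: "'a::distrib_lattice set \<Rightarrow> (('a \<Rightarrow>\<^sub>0 nat) \<Rightarrow>\<^sub>0 'k::field) set"
  where "hibi_binomials L =
    {poly_var \<alpha> * poly_var \<beta> - poly_var (sup \<alpha> \<beta>) * poly_var (inf \<alpha> \<beta>) | \<alpha> \<beta>. \<alpha> \<in> L \<and> \<beta> \<in> L}"

definition hibi_variety :: "'a::distrib_lattice set \<Rightarrow> ('a \<Rightarrow> 'k::field) set"
  where "hibi_variety L = zero_locus L (hibi_binomials L)"

definition join_irreducibles :: "'a::distrib_lattice set \<Rightarrow> 'a set"
  where "join_irreducibles L = {z \<in> L. \<forall>x\<in>L. \<forall>y\<in>L. z = sup x y \<longrightarrow> z = x \<or> z = y}"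

definition covers_in :: "'a::order set \<Rightarrow> 'a \<Rightarrow> 'a \<Rightarrow> bool"
  where "covers_in J y y' \<longleftrightarrow> y \<in> J \<and> y' \<in> J \<and> y' < y \<and> \<not> (\<exists>z\<in>J. y' < z \<and> z < y)"

definition hibi_cone :: "'a::distrib_lattice set \<Rightarrow> ('a \<Rightarrow>\<^sub>0 real) set"
  where "hibi_cone L = (let J = join_irreducibles L in
    convex_cone hull
      ({Poly_Mapping.single z 1 | z. z \<in> J \<and> \<not> (\<exists>w\<in>J. z < w)} \<union>
       {Poly_Mapping.single y' 1 - Poly_Mapping.single y 1 | y y'. covers_in J y y'}))"

definition f_ideal :: "'a::distrib_lattice set \<Rightarrow> 'a \<Rightarrow> ('a \<Rightarrow>\<^sub>0 int)"
  where "f_ideal L \<alpha> = (\<Sum>z\<in>{z \<in> join_irreducibles L. z \<le> \<alpha>}. Poly_Mapping.single z 1)"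

definition face_point :: "'a::distrib_lattice set \<Rightarrow> ('a \<Rightarrow>\<^sub>0 real) set \<Rightarrow> 'a \<Rightarrow> 'k::field"
  where "face_point L \<tau> =
    (\<lambda>\<alpha>\<in>L. if \<forall>v\<in>\<tau>. pairing (lattice_vec (f_ideal L \<alpha>)) v = 0 then 1 else 0)"


section \<open>The lattices of the Grassmannian of lines\<close>

definition I2 :: "nat \<Rightarrow> (nat \<times> nat) set"
  where "I2 n = {(a, b). 1 \<le> a \<and> a < b \<and> b \<le> n}"

definition I2_trunc :: "nat \<Rightarrow> (nat \<times> nat) set"
  where "I2_trunc r = I2 r - {(1, 2), (r - 1, r)}"

definition catalan :: "nat \<Rightarrow> rat"
  where "catalan j = 1 / of_nat (j + 1) * of_nat ((2 * j) choose j)"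

end

theory Submission
  imports Defs
begin

text \<open>
  A Hibi variety of a planar lattice is the closure of the torus of points \<open>x\<^sub>a\<^sub>b = u\<^sub>a v\<^sub>b\<close>. Near
  \<open>P\<^sub>\<tau>\<close> the coordinates \<open>x\<^sub>a\<^sub>b\<close> with \<open>(a, b)\<close> in one of the two blocks are units. Dividing by
  them, \<open>X\<^sub>2\<^sub>,\<^sub>n\<close> becomes at \<open>P\<^sub>\<tau>\<close> the product of \<open>Z\<^sub>2\<^sub>,\<^sub>k\<^sub>+\<^sub>4\<close> with an affine space whose coordinates
  are the deviations of the units from 1. The coordinate ring of this product is a semigroup algebra
  \<open>K[S]\<close> generated in degree 1, and \<open>P\<^sub>\<tau>\<close> corresponds to its vertex, so \<open>K[S]\<close> is also the associated
  graded ring: the symbol of a germ is its lowest homogeneous component. The Hilbert polynomial counts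
  multichains in the lattice, hence its leading coefficient counts maximal chains of the truncated
  lattice; these are ballot paths, and their number is a Catalan number. The Krull dimension of
  \<open>K[S]\<close> is bounded above because elements separating the members of a chain of primes have
  independent monomials, whose number is at most the value of the Hilbert function, and below by an
  explicit chain of monomial primes.
\<close>

text \<open>A polynomial is sent to the power series whose q-th coefficient is its component of
  weight q. A function that does not vanish at the vertex then has a nonzero scalar as constant
  coefficient, hence is a unit, so the whole local ring embeds in a power series ring, where the
  powers of the maximal ideal are given by the order. The chart does not identify X with Z x K^m,
  because the units 1 + s_t are not invertible in K[S]; only the localizations agree. Therefore each
  generator of K[S] has to be exhibited as a quotient of polynomials at P. As X is given as a set of
  points, its vanishing ideal must be computed: torus points over an infinite field show that it
  lies in the kernel of the substitution x_ab = u_a v_b, and an exchange argument gives the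
  converse. The number m counts units: i - 1 and i from the u and v of the lower block, n - i - k -
  2 and n - i - k - 3 from those of the upper block, after u_1 and v_n are normalised. The sum is
  2(n - k) - 6, the codimension of the face.\<close>

unbundle no vec_syntax

section \<open>Monoid algebras\<close>

abbreviation (input) keys :: "('a \<Rightarrow>\<^sub>0 'b::zero) \<Rightarrow> 'a set"
  where "keys \<equiv> Poly_Mapping.keys"

abbreviation (input) lookup :: "('a \<Rightarrow>\<^sub>0 'b::zero) \<Rightarrow> 'a \<Rightarrow> 'b"
  where "lookup \<equiv> Poly_Mapping.lookup"

abbreviation (input) single :: "'a \<Rightarrow> 'b \<Rightarrow> 'a \<Rightarrow>\<^sub>0 'b::zero"
  where "single \<equiv> Poly_Mapping.single"

lemma poly_mapping_sum_single: "(p :: 'a \<Rightarrow>\<^sub>0 'b::comm_monoid_add) = (\<Sum>m\<in>keys p. single m (lookup p m))"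
proof (rule poly_mapping_eqI)
  fix k
  have "lookup (\<Sum>m\<in>keys p. single m (lookup p m)) k = (\<Sum>m\<in>keys p. if m = k then lookup p m else 0)"
    by (simp add: lookup_sum lookup_single when_def)
  also have "\<dots> = lookup p k" by (simp add: in_keys_iff)
  finally show "lookup p k = lookup (\<Sum>m\<in>keys p. single m (lookup p m)) k" by simp
qed

lemma poly_mapping_induct [case_names zero add]:
  fixes p :: "'a \<Rightarrow>\<^sub>0 'b::comm_monoid_add"
  assumes "P 0" "\<And>m c p. P p \<Longrightarrow> P (single m c + p)"
  shows "P p"
proof -
  have "P (\<Sum>m\<in>A. single m (lookup p m))" if "finite A" for A
    using that by induction (use assms in auto)
  from this[of "keys p"] show ?thesis by (simp flip: poly_mapping_sum_single)
qed

text \<open>The universal property of a monoid algebra: scalars go through \<kappa>, monomials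
  through \<psi>. Evaluation at a point, monomial substitutions and the splitting into homogeneous
  components are all instances.\<close>

definition mlift :: "('k::zero \<Rightarrow> 'r) \<Rightarrow> ('m \<Rightarrow> 'r) \<Rightarrow> ('m \<Rightarrow>\<^sub>0 'k) \<Rightarrow> 'r::comm_ring_1"
  where "mlift \<kappa> \<psi> p = (\<Sum>m\<in>keys p. \<kappa> (lookup p m) * \<psi> m)"

locale scalar_hom =
  fixes \<kappa> :: "'k::field \<Rightarrow> 'r::comm_ring_1"
  assumes hom_zero: "\<kappa> 0 = 0" and hom_one: "\<kappa> 1 = 1"
    and hom_add: "\<kappa> (a + b) = \<kappa> a + \<kappa> b" and hom_mult: "\<kappa> (a * b) = \<kappa> a * \<kappa> b"
begin

lemma hom_minus: "\<kappa> (- a) = - \<kappa> a"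
  by (metis add_eq_0_iff hom_add hom_zero right_minus)

lemma mlift_zero [simp]: "mlift \<kappa> \<psi> 0 = 0"
  by (simp add: mlift_def)

lemma mlift_single: "mlift \<kappa> \<psi> (single m c) = \<kappa> c * \<psi> m"
  by (simp add: mlift_def hom_zero)

lemma mlift_add: "mlift \<kappa> \<psi> (p + q) = mlift \<kappa> \<psi> p + mlift \<kappa> \<psi> q"
  unfolding mlift_def by (rule setsum_keys_plus_distrib) (auto simp: hom_zero hom_add algebra_simps)

lemma mlift_uminus: "mlift \<kappa> \<psi> (- p) = - mlift \<kappa> \<psi> p"
  by (metis add_eq_0_iff mlift_add mlift_zero right_minus)

lemma mlift_diff: "mlift \<kappa> \<psi> (p - q) = mlift \<kappa> \<psi> p - mlift \<kappa> \<psi> q"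
  by (metis (no_types, lifting) mlift_add mlift_uminus uminus_add_conv_diff add.commute)

lemma mlift_sum: "mlift \<kappa> \<psi> (\<Sum>i\<in>A. f i) = (\<Sum>i\<in>A. mlift \<kappa> \<psi> (f i))"
  by (induction A rule: infinite_finite_induct) (auto simp: mlift_add)

lemma mlift_one: "\<psi> 0 = 1 \<Longrightarrow> mlift \<kappa> \<psi> 1 = 1"
  by (metis hom_one mlift_single mult_1 single_one)

lemma mlift_mult:
  assumes "\<And>m n. \<psi> (m + n) = \<psi> m * \<psi> n"
  shows "mlift \<kappa> \<psi> (p * q) = mlift \<kappa> \<psi> p * mlift \<kappa> \<psi> q"
proof (induction p rule: poly_mapping_induct)
  case (add m c p)
  have "mlift \<kappa> \<psi> (single m c * q) = mlift \<kappa> \<psi> (single m c) * mlift \<kappa> \<psi> q"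
  proof (induction q rule: poly_mapping_induct)
    case (add n d q)
    then show ?case
      by (simp add: mlift_add mlift_single mult_single hom_mult assms algebra_simps)
  qed simp
  then show ?case by (simp add: mlift_add add distrib_right)
qed simp

end

lemma scalar_hom_id: "scalar_hom (\<lambda>c. c)"
  by unfold_locales auto

lemma scalar_hom_single: "scalar_hom (\<lambda>c::'k::field. single (0::'m::comm_monoid_add) c)"
  by unfold_locales (auto simp: single_add mult_single)

lemma keys_mlift_single:
  "keys (mlift (single 0) (\<lambda>m. single (\<pi> m) 1) p :: 'm::comm_monoid_add \<Rightarrow>\<^sub>0 'k::field) \<subseteq> \<pi> ` keys p"
proof -
  have "keys (mlift (single 0) (\<lambda>m. single (\<pi> m) 1) p :: 'm \<Rightarrow>\<^sub>0 'k)
      \<subseteq> (\<Union>m\<in>keys p. keys (single 0 (lookup p m) * single (\<pi> m) 1))"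
    unfolding mlift_def by (rule keys_sum)
  also have "\<dots> \<subseteq> \<pi> ` keys p"
    by (auto simp: mult_single)
  finally show ?thesis .
qed

lemma lookup_mlift_single:
  "lookup (mlift (single 0) (\<lambda>m. single (\<pi> m) 1) p :: 'm::comm_monoid_add \<Rightarrow>\<^sub>0 'k::field) e
    = (\<Sum>m\<in>{m\<in>keys p. \<pi> m = e}. lookup p m)"
proof -
  have "lookup (mlift (single 0) (\<lambda>m. single (\<pi> m) 1) p) e
      = (\<Sum>m\<in>keys p. lookup (single 0 (lookup p m) * single (\<pi> m) 1) e)"
    unfolding mlift_def by (simp add: lookup_sum)
  also have "\<dots> = (\<Sum>m\<in>keys p. if \<pi> m = e then lookup p m else 0)"
    by (simp add: mult_single lookup_single when_def)
  finally show ?thesis by (simp add: sum.inter_filter)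
qed

definition monom_eval :: "('v \<Rightarrow> 'k::field) \<Rightarrow> ('v \<Rightarrow>\<^sub>0 nat) \<Rightarrow> 'k"
  where "monom_eval x m = (\<Prod>v\<in>keys m. x v ^ lookup m v)"

lemma prod_keys_superset:
  assumes "finite A" "keys m \<subseteq> A"
  shows "(\<Prod>v\<in>keys m. x v ^ lookup m v) = (\<Prod>v\<in>A. (x v :: 'r::comm_ring_1) ^ lookup m v)"
  by (rule prod.mono_neutral_left) (use assms in \<open>auto simp: in_keys_iff\<close>)

lemma prod_keys_add:
  "(\<Prod>v\<in>keys (m + n). x v ^ lookup (m + n) v)
    = (\<Prod>v\<in>keys m. x v ^ lookup m v) * (\<Prod>v\<in>keys n. (x v :: 'r::comm_ring_1) ^ lookup n v)"
proof -
  let ?A = "keys m \<union> keys n"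
  have "keys (m + n) \<subseteq> ?A" by (rule Poly_Mapping.keys_add)
  then show ?thesis
    by (subst (1 2 3) prod_keys_superset[of ?A]) (simp_all add: lookup_add power_add prod.distrib)
qed

lemma poly_eval_eq_mlift: "poly_eval x = mlift (\<lambda>c. c) (\<lambda>m. \<Prod>v\<in>keys m. x v ^ lookup m v)"
  by (rule ext) (simp add: poly_eval_def mlift_def)

lemma poly_eval_simps:
  fixes x :: "'v \<Rightarrow> 'k::field"
  shows "poly_eval x (p + q) = poly_eval x p + poly_eval x q"
    and "poly_eval x (p - q) = poly_eval x p - poly_eval x q"
    and "poly_eval x (- p) = - poly_eval x p"
    and "poly_eval x (p * q) = poly_eval x p * poly_eval x q"
    and "poly_eval x 1 = 1" and "poly_eval x 0 = 0"
    and "poly_eval x (single m c) = c * (\<Prod>v\<in>keys m. x v ^ lookup m v)"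
    and "poly_eval x (poly_var v) = x v"
proof -
  interpret scalar_hom "\<lambda>c::'k. c" by (rule scalar_hom_id)
  show "poly_eval x (p + q) = poly_eval x p + poly_eval x q"
    unfolding poly_eval_eq_mlift by (rule mlift_add)
  show "poly_eval x (p - q) = poly_eval x p - poly_eval x q"
    unfolding poly_eval_eq_mlift by (rule mlift_diff)
  show "poly_eval x (- p) = - poly_eval x p"
    unfolding poly_eval_eq_mlift by (rule mlift_uminus)
  show "poly_eval x (p * q) = poly_eval x p * poly_eval x q"
    unfolding poly_eval_eq_mlift by (rule mlift_mult) (rule prod_keys_add)
  show "poly_eval x 1 = 1"
    unfolding poly_eval_eq_mlift by (rule mlift_one) simp
  show "poly_eval x 0 = 0"
    unfolding poly_eval_eq_mlift by (rule mlift_zero)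
  show single: "poly_eval x (single m c) = c * (\<Prod>v\<in>keys m. x v ^ lookup m v)" for m c
    using mlift_single[of "\<lambda>m. \<Prod>v\<in>keys m. x v ^ lookup m v" m c] by (simp add: poly_eval_eq_mlift)
  show "poly_eval x (poly_var v) = x v"
    unfolding poly_var_def single by simp
qed

text \<open>Every ring below is recognised through an injective homomorphism into a ring that lives on
  a type.\<close>

lemma cring_of_inj_hom:
  fixes R :: "('a, 'x) ring_scheme" and h :: "'a \<Rightarrow> 'b::comm_ring_1"
  assumes inj: "inj_on h (carrier R)"
    and mult: "\<And>x y. x \<in> carrier R \<Longrightarrow> y \<in> carrier R \<Longrightarrow> x \<otimes>\<^bsub>R\<^esub> y \<in> carrier R"
      "\<And>x y. x \<in> carrier R \<Longrightarrow> y \<in> carrier R \<Longrightarrow> h (x \<otimes>\<^bsub>R\<^esub> y) = h x * h y"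
    and add: "\<And>x y. x \<in> carrier R \<Longrightarrow> y \<in> carrier R \<Longrightarrow> x \<oplus>\<^bsub>R\<^esub> y \<in> carrier R"
      "\<And>x y. x \<in> carrier R \<Longrightarrow> y \<in> carrier R \<Longrightarrow> h (x \<oplus>\<^bsub>R\<^esub> y) = h x + h y"
    and zero: "\<zero>\<^bsub>R\<^esub> \<in> carrier R" "h \<zero>\<^bsub>R\<^esub> = 0"
    and one: "\<one>\<^bsub>R\<^esub> \<in> carrier R" "h \<one>\<^bsub>R\<^esub> = 1"
    and uminus: "\<And>x. x \<in> carrier R \<Longrightarrow> \<exists>y\<in>carrier R. h y = - h x"
  shows "cring R"
proof (rule cringI)
  note [simp] = mult add zero one
  show "abelian_group R"
  proof (rule abelian_groupI)
    fix x assume x: "x \<in> carrier R"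
    then obtain y where "y \<in> carrier R" "h y = - h x" using uminus by blast
    then show "\<exists>y\<in>carrier R. y \<oplus>\<^bsub>R\<^esub> x = \<zero>\<^bsub>R\<^esub>"
      using x by (intro bexI[of _ y] inj_onD[OF inj]) auto
  qed (auto intro!: inj_onD[OF inj])
  show "comm_monoid R"
    by (rule comm_monoidI) (auto intro!: inj_onD[OF inj])
qed (auto simp: mult add intro!: inj_onD[OF inj] simp: distrib_right)

locale alg_embedding =
  fixes A :: "('k::field, 'a) module" and h :: "'a \<Rightarrow> 'b::comm_ring_1" and \<kappa> :: "'k \<Rightarrow> 'b"
  assumes inj_h: "inj_on h (carrier A)"
    and mult_closed: "x \<in> carrier A \<Longrightarrow> y \<in> carrier A \<Longrightarrow> x \<otimes>\<^bsub>A\<^esub> y \<in> carrier A"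
    and h_mult: "x \<in> carrier A \<Longrightarrow> y \<in> carrier A \<Longrightarrow> h (x \<otimes>\<^bsub>A\<^esub> y) = h x * h y"
    and add_closed: "x \<in> carrier A \<Longrightarrow> y \<in> carrier A \<Longrightarrow> x \<oplus>\<^bsub>A\<^esub> y \<in> carrier A"
    and h_add: "x \<in> carrier A \<Longrightarrow> y \<in> carrier A \<Longrightarrow> h (x \<oplus>\<^bsub>A\<^esub> y) = h x + h y"
    and zero_in: "\<zero>\<^bsub>A\<^esub> \<in> carrier A" and h_zero: "h \<zero>\<^bsub>A\<^esub> = 0"
    and one_in: "\<one>\<^bsub>A\<^esub> \<in> carrier A" and h_one: "h \<one>\<^bsub>A\<^esub> = 1"
    and smult_in: "x \<in> carrier A \<Longrightarrow> c \<odot>\<^bsub>A\<^esub> x \<in> carrier A"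
    and h_smult: "x \<in> carrier A \<Longrightarrow> h (c \<odot>\<^bsub>A\<^esub> x) = \<kappa> c * h x"
    and scalar: "scalar_hom \<kappa>"
begin

lemmas closed = mult_closed add_closed zero_in one_in smult_in
lemmas h_simps = h_mult h_add h_zero h_one h_smult

lemma uminus_in: "x \<in> carrier A \<Longrightarrow> \<exists>y\<in>carrier A. h y = - h x"
proof -
  interpret scalar_hom \<kappa> by (rule scalar)
  assume "x \<in> carrier A"
  then show ?thesis
    by (intro bexI[of _ "(-1) \<odot>\<^bsub>A\<^esub> x"]) (auto simp: h_simps closed hom_minus hom_one)
qed

lemma is_cring: "cring A"
  by (rule cring_of_inj_hom[of h]) (auto simp: inj_h closed h_simps uminus_in)

lemma h_eq_iff: "x \<in> carrier A \<Longrightarrow> y \<in> carrier A \<Longrightarrow> h x = h y \<longleftrightarrow> x = y"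
  using inj_h by (auto dest: inj_onD)

lemma h_a_inv: "x \<in> carrier A \<Longrightarrow> h (\<ominus>\<^bsub>A\<^esub> x) = - h x"
proof -
  interpret cring A by (rule is_cring)
  assume x: "x \<in> carrier A"
  then have "h (\<ominus>\<^bsub>A\<^esub> x \<oplus>\<^bsub>A\<^esub> x) = 0" by (simp add: l_neg h_zero)
  with x show ?thesis by (simp add: h_add eq_neg_iff_add_eq_0)
qed

lemma h_a_minus: "x \<in> carrier A \<Longrightarrow> y \<in> carrier A \<Longrightarrow> h (x \<ominus>\<^bsub>A\<^esub> y) = h x - h y"
proof -
  interpret cring A by (rule is_cring)
  assume "x \<in> carrier A" "y \<in> carrier A"
  then show ?thesis by (simp add: a_minus_def h_add h_a_inv)
qed

text \<open>Cosets are expressed by values of \<open>h\<close>, so that in a quotient they become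
  fibres: of a homomorphism for a coordinate algebra, of a leading coefficient for a power of an
  ideal modulo the next.\<close>

lemma coset_eq:
  assumes "I \<subseteq> carrier A" and "x \<in> carrier A"
  shows "I +>\<^bsub>A\<^esub> x = {y \<in> carrier A. \<exists>i\<in>I. h y = h i + h x}"
proof (intro equalityI subsetI)
  fix y assume "y \<in> I +>\<^bsub>A\<^esub> x"
  then obtain i where i: "i \<in> I" "y = i \<oplus>\<^bsub>A\<^esub> x" by (auto simp: a_r_coset_def')
  then show "y \<in> {y \<in> carrier A. \<exists>i\<in>I. h y = h i + h x}"
    using assms by (auto simp: closed h_add subset_iff intro!: bexI[OF _ i(1)])
next
  fix y assume "y \<in> {y \<in> carrier A. \<exists>i\<in>I. h y = h i + h x}"
  then obtain i where i: "y \<in> carrier A" "i \<in> I" "h y = h i + h x" by blast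
  then have "h y = h (i \<oplus>\<^bsub>A\<^esub> x)" using assms by (simp add: h_add subset_iff)
  then have "y = i \<oplus>\<^bsub>A\<^esub> x" using assms i by (subst (asm) h_eq_iff) (auto simp: closed)
  then show "y \<in> I +>\<^bsub>A\<^esub> x" using i by (auto simp: a_r_coset_def')
qed

end

section \<open>Monoid algebras as algebra records\<close>

lemma monoid_alg_sel [simp]:
  "carrier (monoid_alg S) = {p. keys p \<subseteq> S}" "mult (monoid_alg S) = (*)"
  "one (monoid_alg S) = 1" "ring.zero (monoid_alg S) = 0" "add (monoid_alg S) = (+)"
  "smult (monoid_alg S) = (\<lambda>c p. single 0 c * p)"
  by (simp_all add: monoid_alg_def)

definition is_submonoid :: "'m::comm_monoid_add set \<Rightarrow> bool"
  where "is_submonoid S \<longleftrightarrow> 0 \<in> S \<and> (\<forall>x\<in>S. \<forall>y\<in>S. x + y \<in> S)"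

lemma alg_embedding_monoid_alg:
  assumes "is_submonoid S"
  shows "alg_embedding (monoid_alg S :: ('k::field, 'm::comm_monoid_add \<Rightarrow>\<^sub>0 'k) module) (\<lambda>p. p) (single 0)"
proof -
  have mult: "keys (x * y) \<subseteq> S" if "keys x \<subseteq> S" "keys y \<subseteq> S" for x y :: "'m \<Rightarrow>\<^sub>0 'k"
  proof
    fix e assume "e \<in> keys (x * y)"
    then obtain a b where "e = a + b" "a \<in> keys x" "b \<in> keys y"
      using keys_mult[of x y] by blast
    then show "e \<in> S" using that assms by (auto simp: is_submonoid_def)
  qed
  have add: "keys (x + y) \<subseteq> S" if "keys x \<subseteq> S" "keys y \<subseteq> S" for x y :: "'m \<Rightarrow>\<^sub>0 'k"
    using that Poly_Mapping.keys_add[of x y] by blast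
  have const: "keys (single 0 c :: 'm \<Rightarrow>\<^sub>0 'k) \<subseteq> S" for c
    using assms by (simp add: is_submonoid_def)
  have smult: "keys (single 0 c * x) \<subseteq> S" if "keys x \<subseteq> S" for c and x :: "'m \<Rightarrow>\<^sub>0 'k"
    using mult const that by blast
  have zero: "0 \<in> S" using assms by (simp add: is_submonoid_def)
  show ?thesis
    by (rule alg_embedding.intro)
      (use scalar_hom_single in \<open>simp_all add: add mult smult zero\<close>)
qed

lemma submonoid_keys: "is_submonoid {m :: 'v \<Rightarrow>\<^sub>0 nat. keys m \<subseteq> V}"
  unfolding is_submonoid_def using Poly_Mapping.keys_add[where ?'b=nat and ?'a='v] by (simp, blast)

lemmas alg_embedding_poly_alg = alg_embedding_monoid_alg[OF submonoid_keys, folded poly_alg_def]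

section \<open>Independence of characters\<close>

text \<open>Artin's argument. Replacing x by \<open>op x y\<close> and subtracting
  \<open>\<psi> a y\<close> times the original relation removes the character a; the remaining
  coefficients \<open>c e * (\<psi> e y - \<psi> a y)\<close> vanish by induction, and a y that
  separates e from a gives \<open>c e = 0\<close>.\<close>

lemma characters_independent:
  fixes \<psi> :: "'e \<Rightarrow> 'g \<Rightarrow> 'k::field"
  assumes "finite E"
    and mult: "\<And>e x y. e \<in> E \<Longrightarrow> x \<in> G \<Longrightarrow> y \<in> G \<Longrightarrow> \<psi> e (op x y) = \<psi> e x * \<psi> e y"
    and closed: "\<And>x y. x \<in> G \<Longrightarrow> y \<in> G \<Longrightarrow> op x y \<in> G"
    and nz: "\<And>e. e \<in> E \<Longrightarrow> \<exists>x\<in>G. \<psi> e x \<noteq> 0"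
    and dist: "\<And>e e'. e \<in> E \<Longrightarrow> e' \<in> E \<Longrightarrow> e \<noteq> e' \<Longrightarrow> \<exists>x\<in>G. \<psi> e x \<noteq> \<psi> e' x"
    and sum: "\<And>x. x \<in> G \<Longrightarrow> (\<Sum>e\<in>E. c e * \<psi> e x) = 0"
  shows "\<forall>e\<in>E. c e = 0"
  using assms(1) mult nz dist sum
proof (induction E arbitrary: c)
  case (insert a E)
  have *: "\<forall>e\<in>E. c e * (\<psi> e y - \<psi> a y) = 0" if y: "y \<in> G" for y
  proof (rule insert.IH)
    fix x assume x: "x \<in> G"
    have "(\<Sum>e\<in>insert a E. c e * \<psi> e (op x y)) - \<psi> a y * (\<Sum>e\<in>insert a E. c e * \<psi> e x) = 0"
      using insert.prems(4) x y closed by simp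
    also have "(\<Sum>e\<in>insert a E. c e * \<psi> e (op x y)) = (\<Sum>e\<in>insert a E. c e * \<psi> e x * \<psi> e y)"
      using insert.prems(1) x y by (intro sum.cong) auto
    finally show "(\<Sum>e\<in>E. c e * (\<psi> e y - \<psi> a y) * \<psi> e x) = 0"
      using insert.hyps
      by (simp add: algebra_simps sum_distrib_left sum_subtractf)
  qed (use insert.prems in auto)
  have E: "c e = 0" if "e \<in> E" for e
    using * that insert.prems(3)[of e a] insert.hyps by auto
  then have "c a * \<psi> a x = 0" if "x \<in> G" for x
    using insert.prems(4)[OF that] insert.hyps by simp
  with insert.prems(2)[of a] E show ?case by auto
qed simp

text \<open>Euclid's trick for polynomials: over a finite field, 1 plus the product of all X - a has
  positive degree but takes only the value 1.\<close>

lemma alg_closed_infinite: "infinite (UNIV :: 'k::alg_closed_field set)"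
proof
  assume fin: "finite (UNIV :: 'k set)"
  let ?p = "(\<Prod>a\<in>UNIV. [:- a, 1:]) + 1 :: 'k poly"
  have "degree (\<Prod>a\<in>UNIV. [:- a, 1:] :: 'k poly) = card (UNIV :: 'k set)"
    by (subst degree_prod_eq_sum_degree) auto
  moreover have "card (UNIV :: 'k set) > 0" using fin by (simp add: card_gt_0_iff)
  ultimately have "degree ?p > 0"
    by (metis degree_add_eq_left degree_1)
  then obtain x where "poly ?p x = 0" using alg_closed_imp_poly_has_root by blast
  moreover have "poly (\<Prod>a\<in>UNIV. [:- a, 1:]) x = 0"
    using fin by (auto simp: poly_prod)
  ultimately show False by simp
qed

text \<open>The difference of the two monomials has finitely many roots. The point found separates
  monomials on the torus.\<close>

lemma power_distinct:
  assumes "i \<noteq> j"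
  obtains x :: "'k::alg_closed_field" where "x \<noteq> 0" "x ^ i \<noteq> x ^ j"
proof -
  let ?p = "Polynomial.monom 1 i - Polynomial.monom 1 j :: 'k poly"
  have "?p \<noteq> 0" using assms by (simp add: monom_eq_iff')
  then have "finite {x. poly ?p x = 0}" by (rule poly_roots_finite)
  then have "finite (insert 0 {x. poly ?p x = 0})" by simp
  then obtain x where "x \<notin> insert 0 {x. poly ?p x = 0}"
    using alg_closed_infinite ex_new_if_finite by blast
  then show ?thesis using that by (auto simp: poly_monom)
qed

text \<open>A pair \<open>(M, N)\<close> of multisets stands for the monomial \<open>\<Prod>a\<in>M. u a * \<Prod>b\<in>N. v b\<close> in two
  families of variables \<open>u\<close> and \<open>v\<close>.\<close>

type_synonym bimon = "nat multiset \<times> nat multiset"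

definition bival :: "(nat \<Rightarrow> 'k::field) \<Rightarrow> (nat \<Rightarrow> 'k) \<Rightarrow> bimon \<Rightarrow> 'k"
  where "bival u v e = prod_mset (image_mset u (fst e)) * prod_mset (image_mset v (snd e))"

lemma bival_add: "bival u v (e + e') = bival u v e * bival u v e'"
  by (simp add: bival_def algebra_simps)

lemma bival_zero [simp]: "bival u v 0 = 1"
  by (simp add: bival_def)

definition bieval :: "(nat \<Rightarrow> 'k::field) \<Rightarrow> (nat \<Rightarrow> 'k) \<Rightarrow> (bimon \<Rightarrow>\<^sub>0 'k) \<Rightarrow> 'k"
  where "bieval u v = mlift (\<lambda>c. c) (bival u v)"

lemma bieval_simps:
  fixes u v :: "nat \<Rightarrow> 'k::field"
  shows "bieval u v (p + q) = bieval u v p + bieval u v q"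
  "bieval u v (p - q) = bieval u v p - bieval u v q"
  "bieval u v (p * q) = bieval u v p * bieval u v q"
  "bieval u v 1 = 1" "bieval u v 0 = 0"
  "bieval u v (single e c) = c * bival u v e"
proof -
  interpret scalar_hom "\<lambda>c::'k. c" by (rule scalar_hom_id)
  show "bieval u v (p + q) = bieval u v p + bieval u v q"
    "bieval u v (p - q) = bieval u v p - bieval u v q"
    "bieval u v (p * q) = bieval u v p * bieval u v q"
    "bieval u v 1 = 1" "bieval u v 0 = 0"
    "bieval u v (single e c) = c * bival u v e"
    unfolding bieval_def
    by (rule mlift_add mlift_diff mlift_one mlift_zero mlift_single mlift_mult bival_add bival_zero)+
qed

lemma prod_mset_replicate_if:
  "prod_mset (image_mset (\<lambda>a. if a = b then x else 1) M) = (x::'k::field) ^ count M b"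
  by (induction M) auto

text \<open>Distinct monomials are distinct characters of the torus of nowhere vanishing u and v.
  Identities may thus be tested on this torus, where one can divide by coordinates, as the local
  coordinates at P require.\<close>

lemma bieval_zero_iff:
  fixes p :: "bimon \<Rightarrow>\<^sub>0 'k::alg_closed_field"
  assumes "\<And>u v. (\<And>a. u a \<noteq> 0) \<Longrightarrow> (\<And>a. v a \<noteq> 0) \<Longrightarrow> bieval u v p = 0"
  shows "p = 0"
proof -
  let ?G = "{(u, v). (\<forall>a::nat. u a \<noteq> (0::'k)) \<and> (\<forall>a::nat. v a \<noteq> (0::'k))}"
  let ?\<psi> = "\<lambda>e (u, v). bival u v e"
  let ?m = "\<lambda>(u, v) (u', v'). (\<lambda>a. u a * u' a, \<lambda>a. v a * v' a)"
  have "\<forall>e\<in>keys p. lookup p e = 0"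
  proof (rule characters_independent[where G="?G" and \<psi>="?\<psi>"])
    fix e x y assume "x \<in> ?G" "y \<in> ?G"
    then show "?\<psi> e (?m x y) = ?\<psi> e x * ?\<psi> e y"
      by (auto simp: bival_def prod_mset.distrib)
  next
    fix e
    have "?\<psi> e (\<lambda>_. 1, \<lambda>_. 1) \<noteq> 0" by (simp add: bival_def)
    then show "\<exists>x\<in>?G. ?\<psi> e x \<noteq> 0" by (intro bexI[of _ "(\<lambda>_. 1, \<lambda>_. 1)"]) auto
  next
    fix e e' :: bimon assume "e \<noteq> e'"
    then consider b where "count (fst e) b \<noteq> count (fst e') b"
      | b where "count (snd e) b \<noteq> count (snd e') b"
      by (metis multiset_eqI prod_eqI)
    then show "\<exists>x\<in>?G. ?\<psi> e x \<noteq> ?\<psi> e' x"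
    proof cases
      case (1 b)
      then obtain x :: 'k where "x \<noteq> 0" "x ^ count (fst e) b \<noteq> x ^ count (fst e') b"
        by (rule power_distinct)
      then show ?thesis
        by (intro bexI[of _ "(\<lambda>a. if a = b then x else 1, \<lambda>_. 1)"])
          (auto simp: bival_def prod_mset_replicate_if)
    next
      case (2 b)
      then obtain x :: 'k where "x \<noteq> 0" "x ^ count (snd e) b \<noteq> x ^ count (snd e') b"
        by (rule power_distinct)
      then show ?thesis
        by (intro bexI[of _ "(\<lambda>_. 1, \<lambda>a. if a = b then x else 1)"])
          (auto simp: bival_def prod_mset_replicate_if)
    qed
  next
    fix x assume "x \<in> ?G"
    then show "(\<Sum>e\<in>keys p. lookup p e * ?\<psi> e x) = 0"
      using assms by (auto simp: bieval_def mlift_def)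
  qed auto
  then show ?thesis
    by (auto simp: in_keys_iff intro!: poly_mapping_eqI)
qed

section \<open>Coordinate algebras and localizations\<close>

text \<open>Operations on fractions are unions over representatives; they collapse as soon as the
  result does not depend on the representative.\<close>

lemma UN_pair_eq_const:
  assumes "p \<in> X" and "\<And>a s. (a, s) \<in> X \<Longrightarrow> F a s = C"
  shows "(\<Union>(a, s)\<in>X. F a s) = C"
proof -
  have "(\<Union>(a, s)\<in>X. F a s) = (\<Union>q\<in>X. C)"
    using assms(2) by (intro SUP_cong refl) (auto split: prod.splits)
  then show ?thesis using assms(1) by auto
qed

text \<open>Once the vanishing ideal is known to be the kernel of \<phi>, cosets are fibres of
  \<phi> and the coordinate algebra becomes its image. The locale is used twice: with the monomial
  substitution itself, and with the power series of homogeneous components.\<close>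

locale coord_hom =
  fixes V :: "'v set" and X :: "('v \<Rightarrow> 'k::field) set"
    and \<phi> :: "(('v \<Rightarrow>\<^sub>0 nat) \<Rightarrow>\<^sub>0 'k) \<Rightarrow> 'b::comm_ring_1" and \<kappa> :: "'k \<Rightarrow> 'b"
  assumes \<phi>_add: "\<phi> (f + g) = \<phi> f + \<phi> g" and \<phi>_mult: "\<phi> (f * g) = \<phi> f * \<phi> g"
    and \<phi>_const: "\<phi> (single 0 c) = \<kappa> c" and scalar: "scalar_hom \<kappa>"
    and ker: "f \<in> carrier (poly_alg V) \<Longrightarrow> f \<in> vanishing_ideal V X \<longleftrightarrow> \<phi> f = 0"
begin

abbreviation "A \<equiv> (poly_alg V :: ('k, ('v \<Rightarrow>\<^sub>0 nat) \<Rightarrow>\<^sub>0 'k) module)"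
abbreviation "I \<equiv> vanishing_ideal V X"

sublocale A: alg_embedding A "\<lambda>f. f" "single 0"
  by (rule alg_embedding_poly_alg)

lemma A_sel [simp]: "mult A = (*)" "add A = (+)" "one A = 1" "ring.zero A = 0"
  "smult A = (\<lambda>c p. single 0 c * p)"
  by (simp_all add: poly_alg_def)

lemma A_closed [simp]:
  "f \<in> carrier A \<Longrightarrow> g \<in> carrier A \<Longrightarrow> f + g \<in> carrier A"
  "f \<in> carrier A \<Longrightarrow> g \<in> carrier A \<Longrightarrow> f * g \<in> carrier A"
  "f \<in> carrier A \<Longrightarrow> single 0 c * f \<in> carrier A"
  "1 \<in> carrier A" "0 \<in> carrier A"
  using A.mult_closed[of f g] A.add_closed[of f g] A.smult_in[of f c] A.one_in A.zero_in by simp_all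

lemma \<phi>_zero: "\<phi> 0 = 0" and \<phi>_one: "\<phi> 1 = 1"
  using \<phi>_const[of 0] \<phi>_const[of 1] scalar by (simp_all add: scalar_hom_def)

lemma \<phi>_uminus: "\<phi> (- f) = - \<phi> f"
  by (metis \<phi>_add \<phi>_zero add_eq_0_iff right_minus)

lemma \<phi>_diff: "\<phi> (f - g) = \<phi> f - \<phi> g"
  by (metis \<phi>_add \<phi>_uminus add_uminus_conv_diff)

lemma A_uminus: "f \<in> carrier A \<Longrightarrow> - f \<in> carrier A"
  by (simp add: poly_alg_def)

lemma A_diff: "f \<in> carrier A \<Longrightarrow> g \<in> carrier A \<Longrightarrow> f - g \<in> carrier A"
  using A_closed(1)[OF _ A_uminus, of f g] by simp

lemma coset: "f \<in> carrier A \<Longrightarrow> I +>\<^bsub>A\<^esub> f = {g \<in> carrier A. \<phi> g = \<phi> f}"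
proof -
  assume f: "f \<in> carrier A"
  have "I +>\<^bsub>A\<^esub> f = {g \<in> carrier A. \<exists>i\<in>I. g = i + f}"
    by (rule A.coset_eq) (use f in \<open>auto simp: vanishing_ideal_def\<close>)
  also have "\<dots> = {g \<in> carrier A. g - f \<in> I}"
    by force
  also have "\<dots> = {g \<in> carrier A. \<phi> g = \<phi> f}"
    using f by (auto simp: ker A_diff \<phi>_diff)
  finally show ?thesis .
qed

definition cval :: "(('v \<Rightarrow>\<^sub>0 nat) \<Rightarrow>\<^sub>0 'k) set \<Rightarrow> 'b"
  where "cval Y = \<phi> (SOME f. f \<in> Y)"

lemma cval_coset: "f \<in> carrier A \<Longrightarrow> cval (I +>\<^bsub>A\<^esub> f) = \<phi> f"
proof -
  assume f: "f \<in> carrier A"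
  then have "f \<in> I +>\<^bsub>A\<^esub> f" by (simp add: coset)
  then have "(SOME g. g \<in> I +>\<^bsub>A\<^esub> f) \<in> I +>\<^bsub>A\<^esub> f" by (rule someI)
  then show ?thesis using f by (simp add: coset cval_def)
qed

lemma carrier_coord: "carrier (coord_alg V X) = {I +>\<^bsub>A\<^esub> f | f. f \<in> carrier A}"
  by (auto simp: coord_alg_def quot_alg_def FactRing_def A_RCOSETS_def')

lemma coset_in: "f \<in> carrier A \<Longrightarrow> I +>\<^bsub>A\<^esub> f \<in> carrier (coord_alg V X)"
  unfolding carrier_coord by blast

lemma coord_mult: "f \<in> carrier A \<Longrightarrow> g \<in> carrier A \<Longrightarrow>
    (I +>\<^bsub>A\<^esub> f) \<otimes>\<^bsub>coord_alg V X\<^esub> (I +>\<^bsub>A\<^esub> g) = I +>\<^bsub>A\<^esub> (f * g)"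
  by (auto simp: coord_alg_def quot_alg_def FactRing_def rcoset_mult_def coset \<phi>_mult)

lemma coord_add: "f \<in> carrier A \<Longrightarrow> g \<in> carrier A \<Longrightarrow>
    (I +>\<^bsub>A\<^esub> f) \<oplus>\<^bsub>coord_alg V X\<^esub> (I +>\<^bsub>A\<^esub> g) = I +>\<^bsub>A\<^esub> (f + g)"
proof -
  assume f: "f \<in> carrier A" and g: "g \<in> carrier A"
  have "\<exists>a. (a \<in> carrier A \<and> \<phi> a = \<phi> f) \<and> (\<exists>b. (b \<in> carrier A \<and> \<phi> b = \<phi> g) \<and> x = a + b)"
    if "x \<in> carrier A" "\<phi> x = \<phi> f + \<phi> g" for x
    using that g by (intro exI[of _ "x - g"] conjI exI[of _ g]) (auto simp: A_diff \<phi>_diff)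
  then show ?thesis
    using f g by (auto simp: coord_alg_def quot_alg_def FactRing_def set_add_def' coset \<phi>_add)
qed

lemma coord_smult: "f \<in> carrier A \<Longrightarrow>
    c \<odot>\<^bsub>coord_alg V X\<^esub> (I +>\<^bsub>A\<^esub> f) = I +>\<^bsub>A\<^esub> (single 0 c * f)"
  by (auto simp: coord_alg_def quot_alg_def coset \<phi>_mult)

lemma coord_one: "\<one>\<^bsub>coord_alg V X\<^esub> = I +>\<^bsub>A\<^esub> 1"
  by (simp add: coord_alg_def quot_alg_def FactRing_def)

lemma coord_zero: "\<zero>\<^bsub>coord_alg V X\<^esub> = I +>\<^bsub>A\<^esub> 0"
proof -
  have "I = {g \<in> carrier A. \<phi> g = 0}"
    using ker by (auto simp: vanishing_ideal_def)
  also have "\<dots> = I +>\<^bsub>A\<^esub> 0" by (simp add: coset \<phi>_zero)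
  finally show ?thesis by (simp add: coord_alg_def quot_alg_def FactRing_def)
qed

lemma alg_embedding_coord: "alg_embedding (coord_alg V X) cval \<kappa>"
proof (rule alg_embedding.intro)
  show "inj_on cval (carrier (coord_alg V X))"
    by (auto simp: inj_on_def carrier_coord cval_coset) (auto simp: coset)
  show "scalar_hom \<kappa>" by (rule scalar)
next
  fix Y Z assume "Y \<in> carrier (coord_alg V X)" "Z \<in> carrier (coord_alg V X)"
  then obtain f g where *: "f \<in> carrier A" "Y = I +>\<^bsub>A\<^esub> f" "g \<in> carrier A" "Z = I +>\<^bsub>A\<^esub> g"
    by (auto simp: carrier_coord)
  then show "Y \<otimes>\<^bsub>coord_alg V X\<^esub> Z \<in> carrier (coord_alg V X)"
    "Y \<oplus>\<^bsub>coord_alg V X\<^esub> Z \<in> carrier (coord_alg V X)"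
    by (simp_all add: coord_mult coord_add coset_in)
  show "cval (Y \<otimes>\<^bsub>coord_alg V X\<^esub> Z) = cval Y * cval Z"
    "cval (Y \<oplus>\<^bsub>coord_alg V X\<^esub> Z) = cval Y + cval Z"
    using * by (simp_all add: coord_mult coord_add cval_coset \<phi>_mult \<phi>_add)
next
  fix Y c assume "Y \<in> carrier (coord_alg V X)"
  then obtain f where *: "f \<in> carrier A" "Y = I +>\<^bsub>A\<^esub> f"
    by (auto simp: carrier_coord)
  then show "c \<odot>\<^bsub>coord_alg V X\<^esub> Y \<in> carrier (coord_alg V X)"
    "cval (c \<odot>\<^bsub>coord_alg V X\<^esub> Y) = \<kappa> c * cval Y"
    by (simp_all add: coord_smult coset_in cval_coset \<phi>_mult \<phi>_const)
qed (simp_all add: coord_one coord_zero coset_in cval_coset \<phi>_one \<phi>_zero)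

text \<open>A fibre of \<phi> is already a coset, so the map from the image to the coordinate
  algebra can be written down without choosing preimages.\<close>

lemma coord_iso:
  assumes "\<phi> ` carrier A = carrier B" and "alg_embedding B (\<lambda>x. x) \<kappa>"
  shows "(\<lambda>b. {g \<in> carrier A. \<phi> g = b}) \<in> alg_iso B (coord_alg V X)"
proof -
  interpret B: alg_embedding B "\<lambda>x. x" \<kappa> by fact
  let ?F = "\<lambda>b. {g \<in> carrier A. \<phi> g = b}"
  have F: "?F (\<phi> f) = I +>\<^bsub>A\<^esub> f" if "f \<in> carrier A" for f
    using that by (simp add: coset)
  have ex: "\<exists>f\<in>carrier A. b = \<phi> f" if "b \<in> carrier B" for b
    using that assms(1) by blast
  have "?F \<in> ring_hom B (coord_alg V X)"
  proof (rule ring_hom_memI)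
    fix b assume "b \<in> carrier B"
    then obtain f where "f \<in> carrier A" "b = \<phi> f" using ex by blast
    then show "?F b \<in> carrier (coord_alg V X)" using F carrier_coord by blast
  next
    fix b c assume "b \<in> carrier B" "c \<in> carrier B"
    moreover then obtain f g where "f \<in> carrier A" "g \<in> carrier A" "b = \<phi> f" "c = \<phi> g"
      using ex by meson
    ultimately show "?F (b \<otimes>\<^bsub>B\<^esub> c) = ?F b \<otimes>\<^bsub>coord_alg V X\<^esub> ?F c"
      "?F (b \<oplus>\<^bsub>B\<^esub> c) = ?F b \<oplus>\<^bsub>coord_alg V X\<^esub> ?F c"
      by (simp_all add: B.h_simps F coord_mult coord_add flip: \<phi>_mult \<phi>_add)
  next
    show "?F \<one>\<^bsub>B\<^esub> = \<one>\<^bsub>coord_alg V X\<^esub>"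
      using F[of 1] B.h_one by (simp add: coord_one \<phi>_one)
  qed
  moreover have "bij_betw ?F (carrier B) (carrier (coord_alg V X))"
  proof (rule bij_betwI')
    fix b c assume "b \<in> carrier B" "c \<in> carrier B"
    then show "(?F b = ?F c) = (b = c)"
      using ex by blast
  next
    fix b assume "b \<in> carrier B"
    then obtain f where "f \<in> carrier A" "b = \<phi> f" using ex by blast
    then show "?F b \<in> carrier (coord_alg V X)" using F carrier_coord by blast
  next
    fix Y assume "Y \<in> carrier (coord_alg V X)"
    then obtain f where "f \<in> carrier A" "Y = I +>\<^bsub>A\<^esub> f" by (auto simp: carrier_coord)
    then show "\<exists>b\<in>carrier B. Y = ?F b" using assms(1) F by (intro bexI[of _ "\<phi> f"]) auto
  qed
  moreover have "?F (c \<odot>\<^bsub>B\<^esub> b) = c \<odot>\<^bsub>coord_alg V X\<^esub> ?F b" if b: "b \<in> carrier B" for b c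
  proof -
    obtain f where f: "f \<in> carrier A" "b = \<phi> f" using ex b by blast
    have "c \<odot>\<^bsub>B\<^esub> b = \<phi> (single 0 c * f)"
      using B.h_smult[OF b] f by (simp add: \<phi>_mult \<phi>_const)
    then show ?thesis using f F by (simp add: coord_smult)
  qed
  ultimately show ?thesis unfolding alg_iso_def ring_iso_def by blast
qed

end

text \<open>Since \<open>h\<close> is injective and each \<open>h s\<close> is invertible, the
  fraction a/s is determined by the value \<open>h a * \<iota> s\<close>, and the localization
  embeds in the target of \<open>h\<close>.\<close>

locale localization_embedding = alg_embedding A h \<kappa>
  for A :: "('k::field, 'a) module" and h :: "'a \<Rightarrow> 'b::comm_ring_1" and \<kappa> :: "'k \<Rightarrow> 'b" +
  fixes S :: "'a set" and \<iota> :: "'a \<Rightarrow> 'b"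
  assumes S_sub: "S \<subseteq> carrier A" and S_one: "\<one>\<^bsub>A\<^esub> \<in> S"
    and S_mult: "s \<in> S \<Longrightarrow> t \<in> S \<Longrightarrow> s \<otimes>\<^bsub>A\<^esub> t \<in> S"
    and \<iota>: "s \<in> S \<Longrightarrow> h s * \<iota> s = 1"
begin

lemma S_carrier: "s \<in> S \<Longrightarrow> s \<in> carrier A"
  using S_sub by blast

lemma unit_cancel: "s \<in> S \<Longrightarrow> h s * x = h s * y \<longleftrightarrow> x = y"
  by (metis \<iota> mult.assoc mult.commute mult_1)

lemma \<iota>_mult: "s \<in> S \<Longrightarrow> t \<in> S \<Longrightarrow> \<iota> (s \<otimes>\<^bsub>A\<^esub> t) = \<iota> s * \<iota> t"
proof -
  assume s: "s \<in> S" and t: "t \<in> S"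
  have "h s * \<iota> s * (h t * \<iota> t) = 1" using s t \<iota> by simp
  then have "h (s \<otimes>\<^bsub>A\<^esub> t) * (\<iota> s * \<iota> t) = 1"
    using s t by (simp add: h_mult S_carrier ac_simps)
  then show ?thesis using \<iota>[OF S_mult[OF s t]] unit_cancel[OF S_mult[OF s t]] by metis
qed

lemma \<iota>_one: "\<iota> \<one>\<^bsub>A\<^esub> = 1"
  using \<iota>[OF S_one] by (simp add: h_one)

lemma val_eq_iff: "s \<in> S \<Longrightarrow> t \<in> S \<Longrightarrow> x * \<iota> s = y * \<iota> t \<longleftrightarrow> h t * x = h s * y"
proof -
  assume s: "s \<in> S" and t: "t \<in> S"
  have "x * \<iota> s = y * \<iota> t \<longleftrightarrow> h s * (h t * (x * \<iota> s)) = h s * (h t * (y * \<iota> t))"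
    using s t by (simp add: unit_cancel)
  also have "h s * (h t * (x * \<iota> s)) = h t * x * (h s * \<iota> s)" by (simp add: ac_simps)
  also have "h s * (h t * (y * \<iota> t)) = h s * y * (h t * \<iota> t)" by (simp add: ac_simps)
  finally show ?thesis using s t by (simp add: \<iota>)
qed

text \<open>The factor u in \<open>frac_rel\<close> has an invertible value, so it cancels: the
  class of a fraction is a fibre of the value map.\<close>

lemma frac: "a \<in> carrier A \<Longrightarrow> s \<in> S \<Longrightarrow>
    frac A S a s = {(b, t). b \<in> carrier A \<and> t \<in> S \<and> h b * \<iota> t = h a * \<iota> s}"
proof -
  assume a: "a \<in> carrier A" and s: "s \<in> S"
  have "(\<exists>u\<in>S. u \<otimes>\<^bsub>A\<^esub> (t \<otimes>\<^bsub>A\<^esub> a) = u \<otimes>\<^bsub>A\<^esub> (s \<otimes>\<^bsub>A\<^esub> b)) \<longleftrightarrow> h b * \<iota> t = h a * \<iota> s"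
    if b: "b \<in> carrier A" and t: "t \<in> S" for b t
  proof -
    have "u \<otimes>\<^bsub>A\<^esub> (t \<otimes>\<^bsub>A\<^esub> a) = u \<otimes>\<^bsub>A\<^esub> (s \<otimes>\<^bsub>A\<^esub> b) \<longleftrightarrow> h b * \<iota> t = h a * \<iota> s" if u: "u \<in> S" for u
    proof -
      have "u \<otimes>\<^bsub>A\<^esub> (t \<otimes>\<^bsub>A\<^esub> a) = u \<otimes>\<^bsub>A\<^esub> (s \<otimes>\<^bsub>A\<^esub> b)
          \<longleftrightarrow> h (u \<otimes>\<^bsub>A\<^esub> (t \<otimes>\<^bsub>A\<^esub> a)) = h (u \<otimes>\<^bsub>A\<^esub> (s \<otimes>\<^bsub>A\<^esub> b))"
        using a s b t u by (subst h_eq_iff) (auto simp: closed S_carrier)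
      also have "\<dots> \<longleftrightarrow> h t * h a = h s * h b"
        using a s b t u by (simp add: h_mult closed S_carrier unit_cancel)
      finally show ?thesis using val_eq_iff[OF s t, of "h a" "h b"] by auto
    qed
    then show ?thesis using S_one by blast
  qed
  then show ?thesis using a s by (auto simp: frac_def frac_rel_def)
qed

definition lval :: "('a \<times> 'a) set \<Rightarrow> 'b"
  where "lval X = (\<lambda>(a, s). h a * \<iota> s) (SOME p. p \<in> X)"

lemma lval_frac: "a \<in> carrier A \<Longrightarrow> s \<in> S \<Longrightarrow> lval (frac A S a s) = h a * \<iota> s"
proof -
  assume as: "a \<in> carrier A" "s \<in> S"
  then have "(a, s) \<in> frac A S a s" by (simp add: frac)
  then have "(SOME p. p \<in> frac A S a s) \<in> frac A S a s" by (rule someI)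
  then show ?thesis using as by (auto simp: frac lval_def)
qed

abbreviation "L \<equiv> localization A S"

lemma carrier_L: "carrier L = {frac A S a s | a s. a \<in> carrier A \<and> s \<in> S}"
  by (auto simp: localization_def quotient_def frac_def)

lemma L_mult: "a \<in> carrier A \<Longrightarrow> s \<in> S \<Longrightarrow> b \<in> carrier A \<Longrightarrow> t \<in> S \<Longrightarrow>
    frac A S a s \<otimes>\<^bsub>L\<^esub> frac A S b t = frac A S (a \<otimes>\<^bsub>A\<^esub> b) (s \<otimes>\<^bsub>A\<^esub> t)"
proof -
  assume as: "a \<in> carrier A" "s \<in> S" and bt: "b \<in> carrier A" "t \<in> S"
  have "frac A S (a' \<otimes>\<^bsub>A\<^esub> b') (s' \<otimes>\<^bsub>A\<^esub> t') = frac A S (a \<otimes>\<^bsub>A\<^esub> b) (s \<otimes>\<^bsub>A\<^esub> t)"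
    if "(a', s') \<in> frac A S a s" "(b', t') \<in> frac A S b t" for a' s' b' t'
  proof -
    have p: "a' \<in> carrier A" "s' \<in> S" "b' \<in> carrier A" "t' \<in> S"
      and e: "h a' * \<iota> s' = h a * \<iota> s" "h b' * \<iota> t' = h b * \<iota> t"
      using that as bt by (auto simp: frac)
    have "h a' * h b' * (\<iota> s' * \<iota> t') = (h a' * \<iota> s') * (h b' * \<iota> t')" by (simp add: ac_simps)
    also have "\<dots> = h a * h b * (\<iota> s * \<iota> t)" unfolding e by (simp add: ac_simps)
    finally show ?thesis using p as bt by (simp add: frac closed S_mult h_mult \<iota>_mult)
  qed
  moreover have "(a, s) \<in> frac A S a s" "(b, t) \<in> frac A S b t" using as bt by (simp_all add: frac)
  ultimately have "(\<Union>(a, s)\<in>frac A S a s. \<Union>(b, t)\<in>frac A S b t. frac A S (a \<otimes>\<^bsub>A\<^esub> b) (s \<otimes>\<^bsub>A\<^esub> t))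
      = frac A S (a \<otimes>\<^bsub>A\<^esub> b) (s \<otimes>\<^bsub>A\<^esub> t)"
    by (intro UN_pair_eq_const)
  then show ?thesis by (simp add: localization_def)
qed

text \<open>The value formula is proved together with the addition because it is what makes the sum
  of two classes independent of representatives.\<close>

lemma L_add: "a \<in> carrier A \<Longrightarrow> s \<in> S \<Longrightarrow> b \<in> carrier A \<Longrightarrow> t \<in> S \<Longrightarrow>
    frac A S a s \<oplus>\<^bsub>L\<^esub> frac A S b t = frac A S (t \<otimes>\<^bsub>A\<^esub> a \<oplus>\<^bsub>A\<^esub> s \<otimes>\<^bsub>A\<^esub> b) (s \<otimes>\<^bsub>A\<^esub> t)"
  and val_add: "a \<in> carrier A \<Longrightarrow> s \<in> S \<Longrightarrow> b \<in> carrier A \<Longrightarrow> t \<in> S \<Longrightarrow>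
    h (t \<otimes>\<^bsub>A\<^esub> a \<oplus>\<^bsub>A\<^esub> s \<otimes>\<^bsub>A\<^esub> b) * \<iota> (s \<otimes>\<^bsub>A\<^esub> t) = h a * \<iota> s + h b * \<iota> t"
proof -
  have val: "h (t \<otimes>\<^bsub>A\<^esub> a \<oplus>\<^bsub>A\<^esub> s \<otimes>\<^bsub>A\<^esub> b) * \<iota> (s \<otimes>\<^bsub>A\<^esub> t) = h a * \<iota> s + h b * \<iota> t"
    if "a \<in> carrier A" "s \<in> S" "b \<in> carrier A" "t \<in> S" for a b s t
  proof -
    have "h (t \<otimes>\<^bsub>A\<^esub> a \<oplus>\<^bsub>A\<^esub> s \<otimes>\<^bsub>A\<^esub> b) * \<iota> (s \<otimes>\<^bsub>A\<^esub> t)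
        = h a * \<iota> s * (h t * \<iota> t) + h b * \<iota> t * (h s * \<iota> s)"
      using that by (simp add: h_mult h_add closed S_carrier \<iota>_mult algebra_simps)
    then show ?thesis using that by (simp add: \<iota>)
  qed
  show "a \<in> carrier A \<Longrightarrow> s \<in> S \<Longrightarrow> b \<in> carrier A \<Longrightarrow> t \<in> S \<Longrightarrow>
    h (t \<otimes>\<^bsub>A\<^esub> a \<oplus>\<^bsub>A\<^esub> s \<otimes>\<^bsub>A\<^esub> b) * \<iota> (s \<otimes>\<^bsub>A\<^esub> t) = h a * \<iota> s + h b * \<iota> t"
    by (rule val)
  assume as: "a \<in> carrier A" "s \<in> S" and bt: "b \<in> carrier A" "t \<in> S"
  have "frac A S (t' \<otimes>\<^bsub>A\<^esub> a' \<oplus>\<^bsub>A\<^esub> s' \<otimes>\<^bsub>A\<^esub> b') (s' \<otimes>\<^bsub>A\<^esub> t')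
      = frac A S (t \<otimes>\<^bsub>A\<^esub> a \<oplus>\<^bsub>A\<^esub> s \<otimes>\<^bsub>A\<^esub> b) (s \<otimes>\<^bsub>A\<^esub> t)"
    if "(a', s') \<in> frac A S a s" "(b', t') \<in> frac A S b t" for a' s' b' t'
  proof -
    have p: "a' \<in> carrier A" "s' \<in> S" "b' \<in> carrier A" "t' \<in> S"
      and e: "h a' * \<iota> s' = h a * \<iota> s" "h b' * \<iota> t' = h b * \<iota> t"
      using that as bt by (auto simp: frac)
    show ?thesis using p as bt
      by (subst (1 2) frac) (simp_all add: val e closed S_mult S_carrier)
  qed
  moreover have "(a, s) \<in> frac A S a s" "(b, t) \<in> frac A S b t" using as bt by (simp_all add: frac)
  ultimately have "(\<Union>(a, s)\<in>frac A S a s. \<Union>(b, t)\<in>frac A S b t.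
        frac A S (t \<otimes>\<^bsub>A\<^esub> a \<oplus>\<^bsub>A\<^esub> s \<otimes>\<^bsub>A\<^esub> b) (s \<otimes>\<^bsub>A\<^esub> t))
      = frac A S (t \<otimes>\<^bsub>A\<^esub> a \<oplus>\<^bsub>A\<^esub> s \<otimes>\<^bsub>A\<^esub> b) (s \<otimes>\<^bsub>A\<^esub> t)"
    by (intro UN_pair_eq_const)
  then show "frac A S a s \<oplus>\<^bsub>L\<^esub> frac A S b t
      = frac A S (t \<otimes>\<^bsub>A\<^esub> a \<oplus>\<^bsub>A\<^esub> s \<otimes>\<^bsub>A\<^esub> b) (s \<otimes>\<^bsub>A\<^esub> t)"
    by (simp add: localization_def)
qed

lemma L_smult: "a \<in> carrier A \<Longrightarrow> s \<in> S \<Longrightarrow> c \<odot>\<^bsub>L\<^esub> frac A S a s = frac A S (c \<odot>\<^bsub>A\<^esub> a) s"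
proof -
  assume as: "a \<in> carrier A" "s \<in> S"
  have "frac A S (c \<odot>\<^bsub>A\<^esub> a') s' = frac A S (c \<odot>\<^bsub>A\<^esub> a) s" if "(a', s') \<in> frac A S a s" for a' s'
    using that as by (auto simp: frac closed h_smult mult.assoc)
  moreover have "(a, s) \<in> frac A S a s" using as by (simp add: frac)
  ultimately have "(\<Union>(a, s)\<in>frac A S a s. frac A S (c \<odot>\<^bsub>A\<^esub> a) s) = frac A S (c \<odot>\<^bsub>A\<^esub> a) s"
    by (intro UN_pair_eq_const)
  then show ?thesis by (simp add: localization_def)
qed

lemma L_one: "\<one>\<^bsub>L\<^esub> = frac A S \<one>\<^bsub>A\<^esub> \<one>\<^bsub>A\<^esub>" and L_zero: "\<zero>\<^bsub>L\<^esub> = frac A S \<zero>\<^bsub>A\<^esub> \<one>\<^bsub>A\<^esub>"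
  by (simp_all add: localization_def)

lemma frac_in: "a \<in> carrier A \<Longrightarrow> s \<in> S \<Longrightarrow> frac A S a s \<in> carrier L"
  by (auto simp: carrier_L)

lemma alg_embedding_localization: "alg_embedding L lval \<kappa>"
proof (rule alg_embedding.intro)
  show "inj_on lval (carrier L)"
    by (auto simp: inj_on_def carrier_L lval_frac) (auto simp: frac)
  show "scalar_hom \<kappa>" by (rule scalar)
  fix x y assume "x \<in> carrier L" "y \<in> carrier L"
  then obtain a s b t where *: "a \<in> carrier A" "s \<in> S" "x = frac A S a s"
      "b \<in> carrier A" "t \<in> S" "y = frac A S b t"
    by (auto simp: carrier_L)
  then show "x \<otimes>\<^bsub>L\<^esub> y \<in> carrier L" "x \<oplus>\<^bsub>L\<^esub> y \<in> carrier L"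
    by (simp_all add: L_mult L_add frac_in closed S_mult S_carrier)
  show "lval (x \<otimes>\<^bsub>L\<^esub> y) = lval x * lval y"
    using * by (simp add: L_mult lval_frac closed S_mult h_mult \<iota>_mult ac_simps)
  show "lval (x \<oplus>\<^bsub>L\<^esub> y) = lval x + lval y"
    using * by (simp add: L_add lval_frac val_add closed S_mult S_carrier)
next
  fix x c assume "x \<in> carrier L"
  then obtain a s where *: "a \<in> carrier A" "s \<in> S" "x = frac A S a s"
    by (auto simp: carrier_L)
  then show "c \<odot>\<^bsub>L\<^esub> x \<in> carrier L" "lval (c \<odot>\<^bsub>L\<^esub> x) = \<kappa> c * lval x"
    by (simp_all add: L_smult lval_frac closed h_smult frac_in ac_simps)
qed (simp_all add: L_one L_zero frac_in lval_frac closed S_one h_zero h_one \<iota>_one)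

end

unbundle fps_syntax

section \<open>Homogeneous components\<close>

text \<open>A power series instead of a family of components: products of graded elements become
  products of series, and inverses exist as soon as the constant coefficient is invertible.\<close>

definition hseries :: "('m \<Rightarrow> nat) \<Rightarrow> ('m::comm_monoid_add \<Rightarrow>\<^sub>0 'k::field) \<Rightarrow> ('m \<Rightarrow>\<^sub>0 'k) fps"
  where "hseries wt = mlift (\<lambda>c. fps_const (single 0 c)) (\<lambda>e. fps_const (single e 1) * fps_X ^ wt e)"

lemma scalar_hom_fps_const: "scalar_hom (\<lambda>c::'k::field. fps_const (single (0::'m::comm_monoid_add) c))"
  by unfold_locales (simp_all add: single_add mult_single)

lemma lookup_hseries: "lookup (hseries wt p $ q) e = (if wt e = q then lookup p e else 0)"
proof -
  have "hseries wt p $ q = (\<Sum>e\<in>keys p. if wt e = q then single e (lookup p e) else 0)"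
    unfolding hseries_def mlift_def fps_sum_nth
    by (rule sum.cong) (auto simp: mult_single fps_X_power_nth)
  then have "lookup (hseries wt p $ q) e
      = (\<Sum>e'\<in>keys p. lookup (if wt e' = q then single e' (lookup p e') else 0) e)"
    by (simp add: lookup_sum)
  also have "\<dots> = (\<Sum>e'\<in>keys p. if e' = e then (if wt e = q then lookup p e else 0) else 0)"
    by (rule sum.cong) (auto simp: lookup_single when_def)
  finally show ?thesis by (simp add: in_keys_iff)
qed

lemma keys_hseries: "keys (hseries wt p $ q) = {e \<in> keys p. wt e = q}"
  by (auto simp: in_keys_iff lookup_hseries split: if_splits)

lemma hseries_add:
  fixes p q :: "'m::comm_monoid_add \<Rightarrow>\<^sub>0 'k::field"
  shows "hseries wt (p + q) = hseries wt p + hseries wt q"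
    and hseries_const: "wt (0::'m) = 0 \<Longrightarrow> hseries wt (single 0 (c::'k)) = fps_const (single 0 c)"
    and hseries_zero: "hseries wt (0 :: 'm \<Rightarrow>\<^sub>0 'k) = 0"
proof -
  interpret scalar_hom "\<lambda>c::'k. fps_const (single (0::'m) c)" by (rule scalar_hom_fps_const)
  show "hseries wt (p + q) = hseries wt p + hseries wt q"
    unfolding hseries_def by (rule mlift_add)
  show "hseries wt (0 :: 'm \<Rightarrow>\<^sub>0 'k) = 0"
    unfolding hseries_def by (rule mlift_zero)
  show "hseries wt (single 0 c) = fps_const (single 0 c)" if "wt (0::'m) = 0" for c :: 'k
    unfolding hseries_def mlift_single using that by (simp add: mult_single)
qed

lemma hseries_mult:
  assumes "\<And>x y. wt (x + y) = wt x + wt y"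
  shows "hseries wt (p * q) = hseries wt p * hseries wt (q :: 'm::comm_monoid_add \<Rightarrow>\<^sub>0 'k::field)"
proof -
  interpret scalar_hom "\<lambda>c::'k. fps_const (single (0::'m) c)" by (rule scalar_hom_fps_const)
  have *: "fps_const (single (x + y) 1) = fps_const (single x 1) * fps_const (single y (1::'k))" for x y :: 'm
    by (simp add: mult_single)
  show ?thesis
    unfolding hseries_def by (rule mlift_mult) (simp add: assms power_add * ac_simps del: fps_const_mult)
qed

lemma inj_hseries: "hseries wt p = hseries wt q \<Longrightarrow> p = q"
  by (rule poly_mapping_eqI) (metis lookup_hseries)

lemma hseries_eq_zero_iff: "hseries wt p = 0 \<longleftrightarrow> p = 0"
  using inj_hseries[of wt p 0] by (auto simp: hseries_zero)

text \<open>The image consists of the finite sums of components, each supported in the right weight;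
  this matches the finitely supported families in \<open>assoc_graded\<close>.\<close>

lemma hseries_image:
  "hseries wt ` {p :: 'm::comm_monoid_add \<Rightarrow>\<^sub>0 'k::field. keys p \<subseteq> S}
    = {F. (\<forall>q. keys (F $ q) \<subseteq> {e\<in>S. wt e = q}) \<and> finite {q. F $ q \<noteq> 0}}" (is "_ = ?R")
proof (intro equalityI subsetI)
  fix F assume "F \<in> hseries wt ` {p :: 'm \<Rightarrow>\<^sub>0 'k. keys p \<subseteq> S}"
  then obtain p where p: "F = hseries wt p" "keys p \<subseteq> S" by blast
  have "{q. F $ q \<noteq> 0} \<subseteq> wt ` keys p"
  proof
    fix q assume "q \<in> {q. F $ q \<noteq> 0}"
    then have "keys (F $ q) \<noteq> {}" by simp
    then show "q \<in> wt ` keys p" unfolding p keys_hseries by auto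
  qed
  then have "finite {q. F $ q \<noteq> 0}" by (rule finite_subset) simp
  then show "F \<in> ?R" using p by (auto simp: keys_hseries)
next
  fix F assume F: "F \<in> ?R"
  define p where "p = (\<Sum>q\<in>{q. F $ q \<noteq> 0}. F $ q)"
  have wt: "lookup (F $ q) e = 0" if "wt e \<noteq> q" for q e
  proof -
    have "e \<notin> keys (F $ q)" using F that by blast
    then show ?thesis by (simp add: in_keys_iff)
  qed
  have lookup: "lookup p e = lookup (F $ wt e) e" for e
  proof -
    have "lookup p e = (\<Sum>q\<in>{q. F $ q \<noteq> 0}. lookup (F $ q) e)" by (simp add: p_def lookup_sum)
    also have "\<dots> = (\<Sum>q\<in>{q. F $ q \<noteq> 0}. if q = wt e then lookup (F $ wt e) e else 0)"
      by (rule sum.cong) (auto simp: wt)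
    also have "\<dots> = lookup (F $ wt e) e" using F by simp
    finally show ?thesis .
  qed
  have "F = hseries wt p"
    by (rule fps_ext, rule poly_mapping_eqI) (auto simp: lookup_hseries lookup wt)
  moreover have "keys p \<subseteq> S"
  proof
    fix e assume "e \<in> keys p"
    then have "e \<in> keys (F $ wt e)" by (simp add: in_keys_iff lookup)
    then show "e \<in> S" using F by blast
  qed
  ultimately show "F \<in> hseries wt ` {p. keys p \<subseteq> S}" by blast
qed

section \<open>Associated graded algebras\<close>

declare ideal_pow.simps(2) [simp del]

text \<open>If \<open>I^q\<close> is the set of elements of order at least q, then the q-th
  coefficient identifies \<open>I^q / I^(q+1)\<close> with its set of values \<open>H q\<close>. The
  associated graded algebra is therefore the ring of series with coefficients in the
  \<open>H q\<close>, only finitely many of them nonzero.\<close>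

locale graded_embedding = alg_embedding R E "\<lambda>c. fps_const (\<kappa> c)"
  for R :: "('k::field, 'a) module" and E :: "'a \<Rightarrow> 'b::comm_ring_1 fps" and \<kappa> :: "'k \<Rightarrow> 'b" +
  fixes I :: "'a set" and H :: "nat \<Rightarrow> 'b set"
  assumes I_ideal: "\<And>q. ideal (ideal_pow R I q) R"
    and pow: "\<And>q. ideal_pow R I q = {x \<in> carrier R. \<forall>j<q. E x $ j = 0}"
    and homog: "\<And>q. (\<lambda>x. E x $ q) ` ideal_pow R I q = H q"
begin

abbreviation "G \<equiv> assoc_graded R I"

sublocale R: cring R by (rule is_cring)

definition series :: "'b fps set"
  where "series = {F. (\<forall>q. F $ q \<in> H q) \<and> finite {q. F $ q \<noteq> 0}}"

text \<open>The coset modulo \<open>I^(q+1)\<close> is written as a fibre of the q-th coefficient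
  inside \<open>I^q\<close>, so no representative is chosen.\<close>

definition sym :: "'b fps \<Rightarrow> nat \<Rightarrow> 'a set"
  where "sym F q = {x \<in> ideal_pow R I q. E x $ q = F $ q}"

lemma coset: "x \<in> ideal_pow R I q \<Longrightarrow>
    ideal_pow R I (Suc q) +>\<^bsub>R\<^esub> x = {y \<in> ideal_pow R I q. E y $ q = E x $ q}"
proof -
  assume x: "x \<in> ideal_pow R I q"
  have "ideal_pow R I (Suc q) +>\<^bsub>R\<^esub> x = {y \<in> carrier R. \<exists>i\<in>ideal_pow R I (Suc q). E y = E i + E x}"
    by (rule coset_eq) (use x pow in blast)+
  also have "\<dots> = {y \<in> ideal_pow R I q. E y $ q = E x $ q}" (is "?A = ?B")
  proof (intro equalityI subsetI)
    fix y assume "y \<in> ?A"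
    then show "y \<in> ?B" using x by (auto simp: pow)
  next
    fix y assume y: "y \<in> ?B"
    then have "y \<ominus>\<^bsub>R\<^esub> x \<in> ideal_pow R I (Suc q)"
      using x by (auto simp: pow h_a_minus less_Suc_eq)
    moreover have "E y = E (y \<ominus>\<^bsub>R\<^esub> x) + E x"
      using x y by (simp add: pow h_a_minus)
    ultimately show "y \<in> ?A" using y by (auto simp: pow)
  qed
  finally show ?thesis .
qed

lemma sym_coset:
  assumes "x \<in> ideal_pow R I q" "E x $ q = F $ q"
  shows "sym F q = ideal_pow R I (Suc q) +>\<^bsub>R\<^esub> x"
  using assms by (simp add: coset sym_def)

lemma sym_rep: "F \<in> series \<Longrightarrow> \<exists>x. x \<in> ideal_pow R I q \<and> E x $ q = F $ q"
proof -
  assume "F \<in> series"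
  then have "F $ q \<in> (\<lambda>x. E x $ q) ` ideal_pow R I q" by (simp add: series_def homog)
  then obtain x where "F $ q = E x $ q" "x \<in> ideal_pow R I q" by (rule imageE)
  then show ?thesis by (intro exI[of _ x]) simp
qed

lemma pow_carrier: "x \<in> ideal_pow R I q \<Longrightarrow> x \<in> carrier R"
  by (simp add: pow)

lemma pow_eq_coset: "ideal_pow R I (Suc q) = {x \<in> ideal_pow R I q. E x $ q = 0}"
  by (auto simp: pow less_Suc_eq)

lemma sym_trivial_iff: "F \<in> series \<Longrightarrow> sym F q = ideal_pow R I (Suc q) \<longleftrightarrow> F $ q = 0"
proof
  assume F: "F \<in> series" and eq: "sym F q = ideal_pow R I (Suc q)"
  obtain x where x: "x \<in> ideal_pow R I q" "E x $ q = F $ q" using sym_rep[OF F] by blast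
  then have "x \<in> sym F q" by (simp add: sym_def)
  then have "x \<in> ideal_pow R I (Suc q)" using eq by simp
  then show "F $ q = 0" using x(2) by (simp add: pow_eq_coset)
qed (simp add: sym_def pow_eq_coset)

lemma sym_in: "F \<in> series \<Longrightarrow> sym F \<in> carrier G"
proof -
  assume F: "F \<in> series"
  have "\<exists>x\<in>ideal_pow R I q. sym F q = ideal_pow R I (Suc q) +>\<^bsub>R\<^esub> x" for q
    using sym_rep[OF F, of q] sym_coset by blast
  moreover have "finite {q. sym F q \<noteq> ideal_pow R I (Suc q)}"
    using F sym_trivial_iff[OF F] by (simp add: series_def)
  ultimately show ?thesis by (simp add: assoc_graded_def)
qed

lemma sym_surj:
  assumes "f \<in> carrier G"
  obtains F where "F \<in> series" "f = sym F"
proof -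
  have "\<forall>q. \<exists>x\<in>ideal_pow R I q. f q = ideal_pow R I (Suc q) +>\<^bsub>R\<^esub> x"
    and fin: "finite {q. f q \<noteq> ideal_pow R I (Suc q)}"
    using assms by (auto simp: assoc_graded_def)
  then obtain x where x: "\<And>q. x q \<in> ideal_pow R I q" "\<And>q. f q = ideal_pow R I (Suc q) +>\<^bsub>R\<^esub> x q"
    by metis
  define F where "F = Abs_fps (\<lambda>q. E (x q) $ q)"
  have sym: "f = sym F"
    using x by (auto simp: sym_coset[OF x(1)] F_def)
  have "finite {q. F $ q \<noteq> 0}"
  proof (rule finite_subset[OF _ fin], rule subsetI, rule ccontr)
    fix q assume "q \<in> {q. F $ q \<noteq> 0}" "q \<notin> {q. f q \<noteq> ideal_pow R I (Suc q)}"
    moreover have "x q \<in> f q" using x(1)[of q] x(2)[of q] by (simp add: coset)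
    ultimately show False by (simp add: pow_eq_coset F_def)
  qed
  moreover have "F $ q \<in> H q" for q
    unfolding homog[of q, symmetric] F_def using x(1) by simp
  ultimately have "F \<in> series" by (simp add: series_def)
  then show ?thesis using sym that by blast
qed

lemma sym_inj: "F \<in> series \<Longrightarrow> F' \<in> series \<Longrightarrow> sym F = sym F' \<Longrightarrow> F = F'"
proof (rule fps_ext)
  fix q assume F: "F \<in> series" "sym F = sym F'"
  obtain x where "x \<in> ideal_pow R I q" "E x $ q = F $ q" using sym_rep[OF F(1)] by blast
  then have x: "x \<in> sym F q" by (simp add: sym_def)
  then have "x \<in> sym F' q" using F(2) by simp
  with x show "F $ q = F' $ q" by (simp add: sym_def)
qed

lemma sym_one: "sym 1 = \<one>\<^bsub>G\<^esub>"
proof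
  fix q show "sym 1 q = \<one>\<^bsub>G\<^esub> q"
    using sym_coset[of "\<one>\<^bsub>R\<^esub>" 0 1]
    by (auto simp: assoc_graded_def h_one one_in) (auto simp: sym_def pow_eq_coset)
qed

lemma sym_zero: "sym 0 = \<zero>\<^bsub>G\<^esub>"
  by (rule ext) (simp add: assoc_graded_def sym_def pow_eq_coset)

lemma sym_add: "F \<in> series \<Longrightarrow> F' \<in> series \<Longrightarrow> sym (F + F') = sym F \<oplus>\<^bsub>G\<^esub> sym F'"
proof
  fix q assume F: "F \<in> series" "F' \<in> series"
  obtain x where x: "x \<in> ideal_pow R I q" "E x $ q = F $ q" using sym_rep[OF F(1)] by blast
  obtain y where y: "y \<in> ideal_pow R I q" "E y $ q = F' $ q" using sym_rep[OF F(2)] by blast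
  have "sym F q <+>\<^bsub>R\<^esub> sym F' q = ideal_pow R I (Suc q) +>\<^bsub>R\<^esub> (x \<oplus>\<^bsub>R\<^esub> y)"
    unfolding sym_coset[where F=F, OF x] sym_coset[where F=F', OF y]
    by (rule ideal.a_rcos_sum[OF I_ideal]) (rule pow_carrier x(1) y(1))+
  also have "\<dots> = sym (F + F') q"
  proof (rule sym_coset[symmetric])
    show "x \<oplus>\<^bsub>R\<^esub> y \<in> ideal_pow R I q" "E (x \<oplus>\<^bsub>R\<^esub> y) $ q = (F + F') $ q"
      using x y by (simp_all add: pow h_add add_closed)
  qed
  finally show "sym (F + F') q = (sym F \<oplus>\<^bsub>G\<^esub> sym F') q"
    by (simp add: assoc_graded_def)
qed

lemma sym_smult: "F \<in> series \<Longrightarrow> sym (fps_const (\<kappa> c) * F) = c \<odot>\<^bsub>G\<^esub> sym F"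
proof
  fix q assume F: "F \<in> series"
  have *: "ideal_pow R I (Suc q) +>\<^bsub>R\<^esub> (c \<odot>\<^bsub>R\<^esub> x) = sym (fps_const (\<kappa> c) * F) q" if "x \<in> sym F q" for x
    using that by (intro sym_coset[symmetric]) (auto simp: sym_def pow h_smult closed)
  have "sym F q \<noteq> {}" using sym_rep[OF F, of q] by (auto simp: sym_def)
  then have "(\<Union>x\<in>sym F q. ideal_pow R I (Suc q) +>\<^bsub>R\<^esub> (c \<odot>\<^bsub>R\<^esub> x)) = sym (fps_const (\<kappa> c) * F) q"
    using * by auto
  then show "sym (fps_const (\<kappa> c) * F) q = (c \<odot>\<^bsub>G\<^esub> sym F) q"
    by (simp add: assoc_graded_def)
qed

text \<open>In the convolution for index i + j every term but one has a factor below the order of x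
  or of y.\<close>

lemma pow_mult:
  assumes "x \<in> ideal_pow R I i" "y \<in> ideal_pow R I j"
  shows "x \<otimes>\<^bsub>R\<^esub> y \<in> ideal_pow R I (i + j)" "E (x \<otimes>\<^bsub>R\<^esub> y) $ (i + j) = E x $ i * E y $ j"
proof -
  have x: "E x $ l = 0" if "l < i" for l using that assms by (simp add: pow)
  have y: "E y $ l = 0" if "l < j" for l using that assms by (simp add: pow)
  have c: "x \<in> carrier R" "y \<in> carrier R" using assms by (simp_all add: pow)
  have 0: "E x $ l * E y $ (n - l) = 0" if "n < i + j \<or> (n = i + j \<and> l \<noteq> i)" "l \<le> n" for l n
    using x[of l] y[of "n - l"] that by (cases "l < i") auto
  show "x \<otimes>\<^bsub>R\<^esub> y \<in> ideal_pow R I (i + j)"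
    using c 0 by (auto simp: pow h_mult closed fps_mult_nth intro!: sum.neutral)
  have "E (x \<otimes>\<^bsub>R\<^esub> y) $ (i + j) = (\<Sum>l = 0..i + j. E x $ l * E y $ (i + j - l))"
    using c by (simp add: h_mult fps_mult_nth)
  also have "\<dots> = (\<Sum>l = 0..i + j. if l = i then E x $ i * E y $ j else 0)"
    by (rule sum.cong) (use 0 in auto)
  finally show "E (x \<otimes>\<^bsub>R\<^esub> y) $ (i + j) = E x $ i * E y $ j" by simp
qed

lemma h_finsum: "finite B \<Longrightarrow> w \<in> B \<rightarrow> carrier R \<Longrightarrow> E (finsum R w B) = (\<Sum>i\<in>B. E (w i))"
proof (induction B rule: finite_induct)
  case (insert b B)
  then have "w \<in> B \<rightarrow> carrier R" "w b \<in> carrier R" by auto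
  then show ?case using insert by (simp add: R.finsum_insert h_add R.finsum_closed)
qed (simp add: h_zero)

lemma sym_mult: "F \<in> series \<Longrightarrow> F' \<in> series \<Longrightarrow> sym (F * F') = sym F \<otimes>\<^bsub>G\<^esub> sym F'"
proof
  fix q assume F: "F \<in> series" "F' \<in> series"
  let ?J = "ideal_pow R I (Suc q)"
  obtain x where x: "\<And>i. x i \<in> ideal_pow R I i" "\<And>i. E (x i) $ i = F $ i" using sym_rep[OF F(1)] by metis
  obtain y where y: "\<And>i. y i \<in> ideal_pow R I i" "\<And>i. E (y i) $ i = F' $ i" using sym_rep[OF F(2)] by metis
  define w where "w i = x i \<otimes>\<^bsub>R\<^esub> y (q - i)" for i
  have w: "w i \<in> ideal_pow R I q" "E (w i) $ q = F $ i * F' $ (q - i)" if "i \<le> q" for i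
    using pow_mult[OF x(1)[of i] y(1)[of "q - i"]] that x y by (simp_all add: w_def)
  \<comment> \<open>The sum defining the product lives in the quotient; the projection turns it into
    the coset of a sum taken in \<open>R\<close>, where coefficients can be compared.\<close>
  interpret proj: ring_hom_cring R "R Quot ?J" "(+>\<^bsub>R\<^esub>) ?J"
    by (rule ideal.rcos_ring_hom_cring[OF I_ideal is_cring])
  have coset_mult: "rcoset_mult R ?J (sym F i) (sym F' (q - i)) = ?J +>\<^bsub>R\<^esub> w i" if i: "i \<le> q" for i
  proof -
    have *: "?J +>\<^bsub>R\<^esub> (a \<otimes>\<^bsub>R\<^esub> b) = ?J +>\<^bsub>R\<^esub> w i" if "a \<in> sym F i" "b \<in> sym F' (q - i)" for a b
    proof -
      have "a \<otimes>\<^bsub>R\<^esub> b \<in> ideal_pow R I q" "E (a \<otimes>\<^bsub>R\<^esub> b) $ q = F $ i * F' $ (q - i)"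
        using pow_mult[of a i b "q - i"] that i by (auto simp: sym_def)
      then show ?thesis using w[OF i] by (simp add: coset)
    qed
    have "x i \<in> sym F i" "y (q - i) \<in> sym F' (q - i)" using x y by (simp_all add: sym_def)
    then show ?thesis using * unfolding rcoset_mult_def by blast
  qed
  have wc: "w \<in> {..q} \<rightarrow> carrier R" using w pow_carrier by blast
  have "(sym F \<otimes>\<^bsub>G\<^esub> sym F') q = finsum (R Quot ?J) (\<lambda>i. rcoset_mult R ?J (sym F i) (sym F' (q - i))) {..q}"
    by (simp add: assoc_graded_def)
  also have "\<dots> = finsum (R Quot ?J) ((+>\<^bsub>R\<^esub>) ?J \<circ> w) {..q}"
    using wc by (intro proj.S.add.finprod_cong') (auto simp: coset_mult intro!: proj.hom_closed)
  also have "\<dots> = ?J +>\<^bsub>R\<^esub> finsum R w {..q}"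
    using proj.hom_finsum[OF wc] by (simp add: comp_def)
  also have "\<dots> = sym (F * F') q"
  proof (rule sym_coset[symmetric])
    have E: "E (finsum R w {..q}) = (\<Sum>i\<le>q. E (w i))" using wc by (simp add: h_finsum)
    show "finsum R w {..q} \<in> ideal_pow R I q"
    proof -
      have "E (w i) $ j = 0" if "i \<le> q" "j < q" for i j
        using w(1)[OF that(1)] that(2) by (simp add: pow)
      then have "E (finsum R w {..q}) $ j = 0" if "j < q" for j
        using that by (simp add: E fps_sum_nth)
      then show ?thesis using R.finsum_closed[OF wc] by (simp add: pow)
    qed
    show "E (finsum R w {..q}) $ q = (F * F') $ q"
      unfolding E fps_sum_nth fps_mult_nth by (rule sum.cong) (auto simp: w(2))
  qed
  finally show "sym (F * F') q = (sym F \<otimes>\<^bsub>G\<^esub> sym F') q" by simp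
qed

lemma graded_piece_eq: "graded_piece R I q = sym ` {F \<in> series. \<forall>i. i \<noteq> q \<longrightarrow> F $ i = 0}"
proof (intro equalityI subsetI)
  fix f assume "f \<in> graded_piece R I q"
  then have f: "f \<in> carrier G" "\<forall>i. i \<noteq> q \<longrightarrow> f i = ideal_pow R I (Suc i)"
    by (auto simp: graded_piece_def)
  obtain F where F: "F \<in> series" "f = sym F" using sym_surj[OF f(1)] by blast
  then have "\<forall>i. i \<noteq> q \<longrightarrow> F $ i = 0" using f(2) sym_trivial_iff by blast
  then show "f \<in> sym ` {F \<in> series. \<forall>i. i \<noteq> q \<longrightarrow> F $ i = 0}" using F by blast
next
  fix f assume "f \<in> sym ` {F \<in> series. \<forall>i. i \<noteq> q \<longrightarrow> F $ i = 0}"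
  then obtain F where "F \<in> series" "f = sym F" "\<forall>i. i \<noteq> q \<longrightarrow> F $ i = 0" by blast
  then show "f \<in> graded_piece R I q"
    using sym_in sym_trivial_iff unfolding graded_piece_def by blast
qed

end

section \<open>Tangent cones of locally homogeneous varieties\<close>

text \<open>The hypotheses say that \<open>\<phi>\<close> identifies the coordinate algebra with a subalgebra of the
  standard graded monoid algebra \<open>K[S]\<close> in such a way that the point \<open>P\<close> becomes the vertex, and that
  the two algebras have the same localization there (\<open>lift\<close>).\<close>

locale tangent_model =
  fixes V :: "'v set" and X :: "('v \<Rightarrow> 'k::field) set" and P :: "'v \<Rightarrow> 'k"
    and S :: "'m::comm_monoid_add set" and wt :: "'m \<Rightarrow> nat"
    and \<phi> :: "(('v \<Rightarrow>\<^sub>0 nat) \<Rightarrow>\<^sub>0 'k) \<Rightarrow> 'm \<Rightarrow>\<^sub>0 'k"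
  assumes S: "is_submonoid S" and wt_add: "wt (x + y) = wt x + wt y"
    and wt_pos: "e \<in> S \<Longrightarrow> wt e = 0 \<Longrightarrow> e = 0"
    and S_gen: "e \<in> S \<Longrightarrow> wt e = Suc q \<Longrightarrow> \<exists>g\<in>S. \<exists>e'\<in>S. e = e' + g \<and> wt g = 1"
    and add: "\<phi> (f + f') = \<phi> f + \<phi> f'" and mult: "\<phi> (f * f') = \<phi> f * \<phi> f'"
    and const: "\<phi> (single 0 c) = single 0 c"
    and closed: "f \<in> carrier (poly_alg V) \<Longrightarrow> keys (\<phi> f) \<subseteq> S"
    and ker: "f \<in> carrier (poly_alg V) \<Longrightarrow> f \<in> vanishing_ideal V X \<longleftrightarrow> \<phi> f = 0"
    and lookup_0: "f \<in> carrier (poly_alg V) \<Longrightarrow> lookup (\<phi> f) 0 = poly_eval P f"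
    and lift: "g \<in> S \<Longrightarrow> wt g = 1 \<Longrightarrow> \<exists>a\<in>carrier (poly_alg V). \<exists>t\<in>carrier (poly_alg V).
      poly_eval P a = 0 \<and> poly_eval P t \<noteq> 0 \<and> \<phi> a = \<phi> t * single g 1"
begin

lemma wt_0: "wt 0 = 0"
  using wt_add[of 0 0] by simp

lemma hs_const: "hseries wt (single 0 c) = fps_const (single 0 (c::'k))"
  by (rule hseries_const) (rule wt_0)

lemma hs_one: "hseries wt (1 :: 'm \<Rightarrow>\<^sub>0 'k) = 1"
  using hs_const[of 1] by simp

lemma hs_mult: "hseries wt (p * q) = hseries wt p * hseries wt q"
  by (rule hseries_mult) (rule wt_add)

sublocale Q: coord_hom V X "\<lambda>f. hseries wt (\<phi> f)" "\<lambda>c. fps_const (single 0 c)"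
proof (rule coord_hom.intro)
  show "scalar_hom (\<lambda>c. fps_const (single 0 c))" by (rule scalar_hom_fps_const)
  show "f \<in> carrier (poly_alg V) \<Longrightarrow> (f \<in> vanishing_ideal V X) = (hseries wt (\<phi> f) = 0)" for f
    using ker by (simp add: hseries_eq_zero_iff)
qed (simp_all add: add mult const hseries_add hs_mult hs_const)

abbreviation "M \<equiv> point_ideal V X P"
abbreviation "T \<equiv> carrier (coord_alg V X) - M"

sublocale QE: alg_embedding "coord_alg V X" Q.cval "\<lambda>c. fps_const (single 0 c)"
  by (rule Q.alg_embedding_coord)

abbreviation "cs f \<equiv> Q.I +>\<^bsub>Q.A\<^esub> f"

text \<open>Only 0 has weight 0, so the constant coefficient is a scalar, and by
  \<open>lookup_0\<close> it is the value at P. Not vanishing at P therefore means being invertible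
  as a power series.\<close>

lemma hs_nth_0: "f \<in> carrier Q.A \<Longrightarrow> hseries wt (\<phi> f) $ 0 = single 0 (poly_eval P f)"
proof (rule poly_mapping_eqI)
  fix e assume f: "f \<in> carrier Q.A"
  show "lookup (hseries wt (\<phi> f) $ 0) e = lookup (single 0 (poly_eval P f)) e"
  proof (cases "e = 0")
    case True
    then show ?thesis using f by (simp add: lookup_hseries wt_0 lookup_0)
  next
    case False
    then have "wt e = 0 \<Longrightarrow> e \<notin> keys (\<phi> f)"
      using closed[OF f] wt_pos by blast
    with False show ?thesis by (simp add: lookup_hseries lookup_single in_keys_iff)
  qed
qed

lemma cs_in_M_iff: "f \<in> carrier Q.A \<Longrightarrow> cs f \<in> M \<longleftrightarrow> poly_eval P f = 0"
proof
  assume f: "f \<in> carrier Q.A" and "cs f \<in> M"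
  then obtain g where g: "g \<in> carrier Q.A" "cs f = cs g" "poly_eval P g = 0"
    by (auto simp: point_ideal_def)
  have "hseries wt (\<phi> f) = hseries wt (\<phi> g)"
    using Q.cval_coset[OF f] Q.cval_coset[OF g(1)] g(2) by simp
  then have "single 0 (poly_eval P f) = single (0::'m) (poly_eval P g)"
    using hs_nth_0[OF f] hs_nth_0[OF g(1)] by simp
  then show "poly_eval P f = 0" using g(3) by (metis lookup_single_eq)
qed (auto simp: point_ideal_def)

lemma T_eq: "T = {cs f | f. f \<in> carrier Q.A \<and> poly_eval P f \<noteq> 0}"
  by (auto simp: Q.carrier_coord cs_in_M_iff)

lemma M_eq: "M = {cs f | f. f \<in> carrier Q.A \<and> poly_eval P f = 0}"
  by (auto simp: point_ideal_def)

text \<open>On \<open>T\<close> the constant coefficient of the series is a nonzero scalar, so its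
  inverse is the scalar formed from the coefficient at 0.\<close>

definition \<iota> :: "(('v \<Rightarrow>\<^sub>0 nat) \<Rightarrow>\<^sub>0 'k) set \<Rightarrow> ('m \<Rightarrow>\<^sub>0 'k) fps"
  where "\<iota> s = fps_right_inverse (Q.cval s) (single 0 (inverse (lookup (Q.cval s $ 0) 0)))"

sublocale L: localization_embedding "coord_alg V X" Q.cval "\<lambda>c. fps_const (single 0 c)" T \<iota>
proof
  show "T \<subseteq> carrier (coord_alg V X)" by blast
  show "\<one>\<^bsub>coord_alg V X\<^esub> \<in> T"
    unfolding T_eq Q.coord_one using Q.A_closed(4) poly_eval_simps(5)[of P] by force
  fix s assume "s \<in> T"
  then obtain f where f: "f \<in> carrier Q.A" "poly_eval P f \<noteq> 0" "s = cs f" by (auto simp: T_eq)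
  have c: "Q.cval s $ 0 = single 0 (poly_eval P f)"
    using f hs_nth_0 by (simp add: Q.cval_coset)
  show "Q.cval s * \<iota> s = 1"
    unfolding \<iota>_def by (rule fps_right_inverse) (use f(2) in \<open>simp add: c mult_single\<close>)
  fix t assume "t \<in> T"
  then obtain g where g: "g \<in> carrier Q.A" "poly_eval P g \<noteq> 0" "t = cs g" by (auto simp: T_eq)
  have "s \<otimes>\<^bsub>coord_alg V X\<^esub> t = cs (f * g)" using f g by (simp add: Q.coord_mult)
  then show "s \<otimes>\<^bsub>coord_alg V X\<^esub> t \<in> T"
    using f g unfolding T_eq by (auto simp: poly_eval_simps intro!: exI[of _ "f * g"])
qed

abbreviation "R \<equiv> local_alg V X P"
abbreviation "E \<equiv> L.lval"

lemma R_eq: "R = L.L"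
  by (simp add: local_alg_def)

sublocale RE: alg_embedding R E "\<lambda>c. fps_const (single 0 c)"
  unfolding R_eq by (rule L.alg_embedding_localization)

lemma R_cases:
  assumes "x \<in> carrier R"
  obtains f t where "f \<in> carrier Q.A" "t \<in> carrier Q.A" "poly_eval P t \<noteq> 0"
    "x = frac (coord_alg V X) T (cs f) (cs t)"
proof -
  obtain a s where a: "a \<in> carrier (coord_alg V X)" and s: "s \<in> T" and x: "x = frac (coord_alg V X) T a s"
    using assms unfolding R_eq L.carrier_L by blast
  obtain f where "f \<in> carrier Q.A" "a = cs f" using a unfolding Q.carrier_coord by blast
  moreover obtain t where "t \<in> carrier Q.A" "poly_eval P t \<noteq> 0" "s = cs t" using s unfolding T_eq by blast
  ultimately show ?thesis using that x by blast
qed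

lemma frac_props:
  assumes f: "f \<in> carrier Q.A" and t: "t \<in> carrier Q.A" "poly_eval P t \<noteq> 0"
  shows "frac (coord_alg V X) T (cs f) (cs t) \<in> carrier R"
    and "E (frac (coord_alg V X) T (cs f) (cs t)) = hseries wt (\<phi> f) * \<iota> (cs t)"
    and "hseries wt (\<phi> t) * \<iota> (cs t) = 1"
proof -
  have T: "cs t \<in> T" using t T_eq by blast
  show "frac (coord_alg V X) T (cs f) (cs t) \<in> carrier R"
    unfolding R_eq by (rule L.frac_in) (use f T Q.coset_in in auto)
  show "E (frac (coord_alg V X) T (cs f) (cs t)) = hseries wt (\<phi> f) * \<iota> (cs t)"
    using L.lval_frac[OF Q.coset_in[OF f] T] f by (simp add: Q.cval_coset)
  show "hseries wt (\<phi> t) * \<iota> (cs t) = 1"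
    using L.\<iota>[OF T] t by (simp add: Q.cval_coset)
qed

abbreviation "\<mm> \<equiv> local_max_ideal V X P"

lemma max_eq: "\<mm> = {x \<in> carrier R. E x $ 0 = 0}"
proof (intro equalityI subsetI)
  fix x assume "x \<in> \<mm>"
  then obtain f t where *: "f \<in> carrier Q.A" "poly_eval P f = 0" "t \<in> carrier Q.A" "poly_eval P t \<noteq> 0"
      "x = frac (coord_alg V X) T (cs f) (cs t)"
  proof -
    obtain a s where a: "a \<in> M" and s: "s \<in> T" and x: "x = frac (coord_alg V X) T a s"
      using \<open>x \<in> \<mm>\<close> unfolding local_max_ideal_def by blast
    obtain f where "f \<in> carrier Q.A" "poly_eval P f = 0" "a = cs f" using a unfolding M_eq by blast
    moreover obtain t where "t \<in> carrier Q.A" "poly_eval P t \<noteq> 0" "s = cs t" using s unfolding T_eq by blast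
    ultimately show ?thesis using that x by blast
  qed
  then show "x \<in> {x \<in> carrier R. E x $ 0 = 0}"
    using frac_props[OF *(1,3,4)] hs_nth_0[OF *(1)] by simp
next
  fix x assume x: "x \<in> {x \<in> carrier R. E x $ 0 = 0}"
  then obtain f t where *: "f \<in> carrier Q.A" "t \<in> carrier Q.A" "poly_eval P t \<noteq> 0"
      "x = frac (coord_alg V X) T (cs f) (cs t)"
    using R_cases by blast
  note fr = frac_props[OF *(1-3)]
  have "hseries wt (\<phi> f) = E x * hseries wt (\<phi> t)"
    using fr * by (simp add: mult.assoc mult.commute[of "\<iota> _"])
  then have "single (0::'m) (poly_eval P f) = 0"
    using hs_nth_0[OF *(1)] x by simp
  then have "poly_eval P f = 0" by (metis lookup_single_eq lookup_zero)
  then have "cs f \<in> M" "cs t \<in> T" using * cs_in_M_iff T_eq by blast+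
  then show "x \<in> \<mm>" using * unfolding local_max_ideal_def by blast
qed

sublocale R: cring R by (rule RE.is_cring)

lemma max_ideal: "ideal \<mm> R"
proof (rule idealI)
  show "ring R" by (rule R.ring_axioms)
  show "subgroup \<mm> (add_monoid R)"
  proof (rule R.add.subgroupI)
    show "\<mm> \<noteq> {}" using RE.zero_in RE.h_zero by (auto simp: max_eq)
    show "a \<in> \<mm> \<Longrightarrow> \<ominus>\<^bsub>R\<^esub> a \<in> \<mm>" for a
      by (auto simp: max_eq RE.h_a_inv)
  qed (auto simp: max_eq RE.h_add)
qed (auto simp: max_eq RE.h_mult)

lemma pow_ideal: "ideal (ideal_pow R \<mm> q) R"
  by (induction q) (auto simp: ideal_pow.simps(2) R.oneideal intro: R.ideal_prod_is_ideal max_ideal)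

lemma pow_carrier: "x \<in> ideal_pow R \<mm> q \<Longrightarrow> x \<in> carrier R"
  using ideal.Icarr[OF pow_ideal] .

lemma pow_subset: "x \<in> ideal_pow R \<mm> q \<Longrightarrow> x \<in> carrier R \<and> (\<forall>j<q. E x $ j = 0)"
proof (induction q arbitrary: x)
  case (Suc q)
  have "x \<in> ideal_prod R (ideal_pow R \<mm> q) \<mm>" using Suc.prems by (simp add: ideal_pow.simps(2))
  then show ?case
  proof (induction rule: ideal_prod.induct)
    case (prod a b)
    have a: "a \<in> carrier R" "\<And>j. j < q \<Longrightarrow> E a $ j = 0" using Suc.IH prod by auto
    have b: "b \<in> carrier R" "E b $ 0 = 0" using prod by (auto simp: max_eq)
    have "E (a \<otimes>\<^bsub>R\<^esub> b) $ j = 0" if "j < Suc q" for j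
    proof -
      have "E a $ l * E b $ (j - l) = 0" if "l \<le> j" for l
        using a(2)[of l] b(2) that \<open>j < Suc q\<close> by (cases "l = j") auto
      then show ?thesis using a b by (simp add: RE.h_mult fps_mult_nth)
    qed
    then show ?case using a b by (simp add: RE.mult_closed)
  next
    case (sum a b)
    then show ?case by (simp add: RE.add_closed RE.h_add)
  qed
qed simp

lemma pow_mono: "q \<le> r \<Longrightarrow> ideal_pow R \<mm> r \<subseteq> ideal_pow R \<mm> q"
proof (induction r)
  case (Suc r)
  have "ideal_pow R \<mm> (Suc r) \<subseteq> ideal_pow R \<mm> r"
    using R.ideal_prod_inter[OF pow_ideal max_ideal] by (auto simp: ideal_pow.simps(2))
  with Suc show ?case by (cases "q = Suc r") auto
qed simp

text \<open>Induction on the weight: by \<open>lift\<close> a generator of weight 1 is a quotient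
  a/t with a vanishing at P, hence lies in the maximal ideal, and a product of q of them lies in its
  q-th power.\<close>

lemma pow_monom: "e \<in> S \<Longrightarrow> \<exists>x\<in>ideal_pow R \<mm> (wt e). E x = hseries wt (single e 1)"
proof (induction "wt e" arbitrary: e)
  case 0
  then have "e = 0" using wt_pos by simp
  then show ?case
    by (intro bexI[of _ "\<one>\<^bsub>R\<^esub>"]) (simp_all add: RE.h_one wt_0 RE.one_in hs_one)
next
  case (Suc q)
  then obtain g e' where g: "g \<in> S" "e' \<in> S" "e = e' + g" "wt g = 1"
    using S_gen[of e q] by auto
  then have "wt e' = q" using Suc(2) wt_add[of e' g] by simp
  then obtain x where x: "x \<in> ideal_pow R \<mm> q" "E x = hseries wt (single e' 1)"
    using Suc(1)[of e'] g by auto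
  obtain a t where a: "a \<in> carrier Q.A" "poly_eval P a = 0" and t: "t \<in> carrier Q.A" "poly_eval P t \<noteq> 0"
    and at: "\<phi> a = \<phi> t * single g 1"
    using lift[OF g(1,4)] by blast
  let ?y = "frac (coord_alg V X) T (cs a) (cs t)"
  note fr = frac_props[OF a(1) t]
  have "E ?y = hseries wt (single g 1) * (hseries wt (\<phi> t) * \<iota> (cs t))"
    by (simp add: fr(2) at hs_mult ac_simps)
  then have y: "E ?y = hseries wt (single g 1)" by (simp add: fr(3))
  have "cs a \<in> M" "cs t \<in> T" using a t M_eq T_eq by blast+
  then have "?y \<in> \<mm>" unfolding local_max_ideal_def by blast
  then have "x \<otimes>\<^bsub>R\<^esub> ?y \<in> ideal_pow R \<mm> (wt e)"
    using x(1) by (simp add: Suc(2)[symmetric] ideal_pow.simps(2) ideal_prod.prod)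
  moreover have "E (x \<otimes>\<^bsub>R\<^esub> ?y) = hseries wt (single e 1)"
    using x y fr(1) pow_carrier[OF x(1)] g(3) by (simp add: RE.h_mult mult_single flip: hs_mult)
  ultimately show ?case by blast
qed

lemma pow_lift:
  assumes "keys b \<subseteq> {e \<in> S. q \<le> wt e}"
  shows "\<exists>x\<in>ideal_pow R \<mm> q. E x = hseries wt b"
proof -
  interpret J: additive_subgroup "ideal_pow R \<mm> q" R
    using pow_ideal by (rule ideal.axioms)
  have "\<exists>x\<in>ideal_pow R \<mm> q. E x = hseries wt (\<Sum>e\<in>A. single e (lookup b e))"
    if "finite A" "A \<subseteq> keys b" for A
    using that
  proof (induction A rule: finite_induct)
    case empty
    then show ?case by (intro bexI[of _ "\<zero>\<^bsub>R\<^esub>"]) (simp_all add: RE.h_zero hseries_zero J.zero_closed)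
  next
    case (insert e A)
    obtain x where x: "x \<in> ideal_pow R \<mm> q" "E x = hseries wt (\<Sum>e\<in>A. single e (lookup b e))"
      using insert by auto
    have e: "e \<in> S" "q \<le> wt e" using insert.prems assms by auto
    obtain y where y: "y \<in> ideal_pow R \<mm> q" "E y = hseries wt (single e 1)"
      using pow_monom[OF e(1)] pow_mono[OF e(2)] by blast
    let ?c = "lookup b e \<odot>\<^bsub>R\<^esub> \<one>\<^bsub>R\<^esub>"
    have c: "?c \<in> carrier R" "E ?c = fps_const (single 0 (lookup b e))"
      by (simp_all add: RE.smult_in RE.h_smult RE.one_in RE.h_one)
    have cy: "?c \<otimes>\<^bsub>R\<^esub> y \<in> ideal_pow R \<mm> q"
      using ideal.I_l_closed[OF pow_ideal y(1) c(1)] .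
    have "E (?c \<otimes>\<^bsub>R\<^esub> y) = hseries wt (single 0 (lookup b e) * single e 1)"
      using c pow_carrier[OF y(1)] y(2) by (simp add: RE.h_mult hs_mult hs_const)
    then have "E (?c \<otimes>\<^bsub>R\<^esub> y) = hseries wt (single e (lookup b e))"
      by (simp add: mult_single)
    then have "E (?c \<otimes>\<^bsub>R\<^esub> y \<oplus>\<^bsub>R\<^esub> x) = hseries wt (\<Sum>e\<in>insert e A. single e (lookup b e))"
      using insert.hyps pow_carrier[OF cy] pow_carrier[OF x(1)] x(2) by (simp add: RE.h_add hseries_add)
    then show ?case using J.a_closed[OF cy x(1)] by blast
  qed
  from this[OF _ subset_refl] show ?thesis by (simp flip: poly_mapping_sum_single)
qed

text \<open>Clearing the denominator of an element of order at least q leaves a function all of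
  whose monomials have weight at least q. By \<open>pow_lift\<close> it is already in the q-th
  power, and dividing by the unit again stays there.\<close>

lemma pow_eq: "ideal_pow R \<mm> q = {x \<in> carrier R. \<forall>j<q. E x $ j = 0}"
proof (intro equalityI subsetI)
  fix x assume "x \<in> ideal_pow R \<mm> q"
  then show "x \<in> {x \<in> carrier R. \<forall>j<q. E x $ j = 0}" using pow_subset by blast
next
  fix x assume x: "x \<in> {x \<in> carrier R. \<forall>j<q. E x $ j = 0}"
  then obtain f t where *: "f \<in> carrier Q.A" "t \<in> carrier Q.A" "poly_eval P t \<noteq> 0"
      "x = frac (coord_alg V X) T (cs f) (cs t)"
    using R_cases by blast
  note fr = frac_props[OF *(1-3)] and one = frac_props[OF Q.A_closed(4) *(2,3)]
  have F: "hseries wt (\<phi> f) = E x * hseries wt (\<phi> t)"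
    using fr * by (simp add: mult.assoc mult.commute[of "\<iota> _"])
  have 0: "hseries wt (\<phi> f) $ j = 0" if "j < q" for j
    unfolding F fps_mult_nth using x that by (intro sum.neutral) auto
  have "keys (\<phi> f) \<subseteq> {e \<in> S. q \<le> wt e}"
  proof
    fix e assume e: "e \<in> keys (\<phi> f)"
    then have "e \<in> keys (hseries wt (\<phi> f) $ wt e)" by (simp add: keys_hseries)
    then have "q \<le> wt e" using 0[of "wt e"] by (cases "q \<le> wt e") auto
    then show "e \<in> {e \<in> S. q \<le> wt e}" using e closed[OF *(1)] by blast
  qed
  then obtain y where y: "y \<in> ideal_pow R \<mm> q" "E y = hseries wt (\<phi> f)"
    using pow_lift by blast
  let ?z = "frac (coord_alg V X) T (cs 1) (cs t)"
  have "E (y \<otimes>\<^bsub>R\<^esub> ?z) = E x"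
    using one(1,2) fr(2) y *(4) pow_carrier[OF y(1)] Q.\<phi>_one by (simp add: RE.h_mult)
  then have "y \<otimes>\<^bsub>R\<^esub> ?z = x"
    using RE.h_eq_iff[of "y \<otimes>\<^bsub>R\<^esub> ?z" x] x one(1) pow_carrier[OF y(1)] by (simp add: RE.mult_closed)
  then show "x \<in> ideal_pow R \<mm> q"
    using ideal.I_r_closed[OF pow_ideal y(1) one(1)] by simp
qed

text \<open>Passing from f/t to f multiplies the coefficient at the order by the scalar t(P) only,
  so this coefficient is a component of an element of K[S].\<close>

lemma pow_homog: "(\<lambda>x. E x $ q) ` ideal_pow R \<mm> q = {b. keys b \<subseteq> {e \<in> S. wt e = q}}"
proof (intro equalityI subsetI)
  fix b assume "b \<in> (\<lambda>x. E x $ q) ` ideal_pow R \<mm> q"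
  then obtain x where x: "x \<in> carrier R" "\<And>j. j < q \<Longrightarrow> E x $ j = 0" "b = E x $ q"
    by (auto simp: pow_eq)
  then obtain f t where *: "f \<in> carrier Q.A" "t \<in> carrier Q.A" "poly_eval P t \<noteq> 0"
      "x = frac (coord_alg V X) T (cs f) (cs t)"
    using R_cases by blast
  note fr = frac_props[OF *(1-3)]
  have F: "hseries wt (\<phi> f) = E x * hseries wt (\<phi> t)"
    using fr * by (simp add: mult.assoc mult.commute[of "\<iota> _"])
  have "hseries wt (\<phi> f) $ q = (\<Sum>j = 0..q. if j = q then E x $ q * hseries wt (\<phi> t) $ 0 else 0)"
    unfolding F fps_mult_nth by (rule sum.cong) (use x in auto)
  also have "\<dots> = b * single 0 (poly_eval P t)"
    using hs_nth_0[OF *(2)] x by simp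
  finally have "hseries wt (\<phi> f) $ q * single 0 (inverse (poly_eval P t))
      = b * (single 0 (poly_eval P t) * single 0 (inverse (poly_eval P t)))" by (simp add: mult.assoc)
  then have b: "b = hseries wt (\<phi> f) $ q * single 0 (inverse (poly_eval P t))"
    using *(3) by (simp add: mult_single)
  have "keys b \<subseteq> keys (hseries wt (\<phi> f) $ q)"
    unfolding b using keys_mult[of "hseries wt (\<phi> f) $ q" "single 0 (inverse (poly_eval P t))"]
    by (auto split: if_splits)
  then show "b \<in> {b. keys b \<subseteq> {e \<in> S. wt e = q}}"
    using closed[OF *(1)] by (auto simp: keys_hseries)
next
  fix b :: "'m \<Rightarrow>\<^sub>0 'k" assume b: "b \<in> {b. keys b \<subseteq> {e \<in> S. wt e = q}}"
  then obtain x where x: "x \<in> ideal_pow R \<mm> q" "E x = hseries wt b"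
    using pow_lift[of b q] by force
  have "hseries wt b $ q = b"
    by (rule poly_mapping_eqI) (use b in \<open>auto simp: lookup_hseries in_keys_iff\<close>)
  then show "b \<in> (\<lambda>x. E x $ q) ` ideal_pow R \<mm> q"
    using x by (intro image_eqI[of _ _ x]) auto
qed

sublocale G: graded_embedding R E "single 0" \<mm> "\<lambda>q. {b. keys b \<subseteq> {e \<in> S. wt e = q}}"
  by (intro graded_embedding.intro graded_embedding_axioms.intro)
    (rule RE.alg_embedding_axioms pow_ideal pow_eq pow_homog)+

lemma series_eq: "G.series = hseries wt ` carrier (monoid_alg S)"
  unfolding G.series_def monoid_alg_sel hseries_image by auto

abbreviation "\<Psi> b \<equiv> G.sym (hseries wt b)"

lemma sym_iso: "\<Psi> \<in> alg_iso (monoid_alg S) (tangent_cone V X P)"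
proof -
  have s: "hseries wt b \<in> G.series" if "b \<in> carrier (monoid_alg S)" for b
    using that series_eq by blast
  have "\<Psi> \<in> ring_hom (monoid_alg S) (tangent_cone V X P)"
    using s unfolding tangent_cone_def
    by (intro ring_hom_memI)
      (simp_all add: G.sym_in hs_mult hseries_add G.sym_mult G.sym_add G.sym_one[symmetric] hs_one)
  moreover have "bij_betw \<Psi> (carrier (monoid_alg S)) (carrier (tangent_cone V X P))"
  proof (rule bij_betwI')
    fix b c :: "'m \<Rightarrow>\<^sub>0 'k" assume bc: "b \<in> carrier (monoid_alg S)" "c \<in> carrier (monoid_alg S)"
    then show "(\<Psi> b = \<Psi> c) = (b = c)"
      using G.sym_inj s inj_hseries by blast
  next
    fix b :: "'m \<Rightarrow>\<^sub>0 'k" assume "b \<in> carrier (monoid_alg S)"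
    then show "\<Psi> b \<in> carrier (tangent_cone V X P)"
      using s G.sym_in by (simp add: tangent_cone_def)
  next
    fix f assume "f \<in> carrier (tangent_cone V X P)"
    then obtain F where "F \<in> G.series" "f = G.sym F"
      using G.sym_surj unfolding tangent_cone_def by blast
    then show "\<exists>b\<in>carrier (monoid_alg S). f = \<Psi> b" unfolding series_eq by blast
  qed
  moreover have "\<Psi> (c \<odot>\<^bsub>monoid_alg S\<^esub> b) = c \<odot>\<^bsub>tangent_cone V X P\<^esub> \<Psi> b"
    if "b \<in> carrier (monoid_alg S)" for b c
    using G.sym_smult[OF s[OF that], of c] by (simp add: tangent_cone_def hs_mult hs_const)
  ultimately show ?thesis unfolding alg_iso_def ring_iso_def by blast
qed

text \<open>The isomorphism respects the grading, so the Hilbert function can be computed in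
  K[S].\<close>

lemma sym_piece: "\<Psi> ` {b. keys b \<subseteq> {e \<in> S. wt e = q}} = graded_piece R \<mm> q"
proof -
  have "{F \<in> G.series. \<forall>i. i \<noteq> q \<longrightarrow> F $ i = 0} = hseries wt ` {b. keys b \<subseteq> {e \<in> S. wt e = q}}"
  proof (intro equalityI subsetI)
    fix F assume F: "F \<in> {F \<in> G.series. \<forall>i. i \<noteq> q \<longrightarrow> F $ i = 0}"
    then obtain b where b: "F = hseries wt b" "keys b \<subseteq> S" by (auto simp: series_eq)
    have "keys b \<subseteq> {e \<in> S. wt e = q}"
    proof
      fix e assume e: "e \<in> keys b"
      then have "e \<in> keys (F $ wt e)" by (simp add: b keys_hseries)
      then have "wt e = q" using F by (cases "wt e = q") auto
      then show "e \<in> {e \<in> S. wt e = q}" using e b by blast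
    qed
    then show "F \<in> hseries wt ` {b. keys b \<subseteq> {e \<in> S. wt e = q}}" using b by blast
  next
    fix F :: "('m \<Rightarrow>\<^sub>0 'k) fps" assume "F \<in> hseries wt ` {b. keys b \<subseteq> {e \<in> S. wt e = q}}"
    then obtain b where b: "F = hseries wt b" "keys b \<subseteq> {e \<in> S. wt e = q}" by blast
    then have "keys (F $ i) = {}" if "i \<noteq> q" for i using that by (auto simp: keys_hseries)
    then show "F \<in> {F \<in> G.series. \<forall>i. i \<noteq> q \<longrightarrow> F $ i = 0}"
      using b by (auto simp: series_eq)
  qed
  then show ?thesis by (simp add: G.graded_piece_eq image_image)
qed

end

unbundle no fps_syntax

section \<open>Hibi varieties of planar lattices\<close>

definition sublattice :: "'a::lattice set \<Rightarrow> bool"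
  where "sublattice L \<longleftrightarrow> (\<forall>\<alpha>\<in>L. \<forall>\<beta>\<in>L. sup \<alpha> \<beta> \<in> L \<and> inf \<alpha> \<beta> \<in> L)"

text \<open>The exponent of a product of coordinates after the substitution x_ab = u_a v_b. Join and
  meet only pair first and second indices differently, so the two sides of a Hibi relation have the
  same exponent.\<close>

definition expo :: "(nat \<times> nat) multiset \<Rightarrow> bimon"
  where "expo M = (image_mset fst M, image_mset snd M)"

definition hibi_monoid :: "(nat \<times> nat) set \<Rightarrow> bimon set"
  where "hibi_monoid L = {expo M | M. set_mset M \<subseteq> L}"

text \<open>Both components of an element of \<open>hibi_monoid\<close> have the same size, so the
  first one gives the degree.\<close>

definition biwt :: "bimon \<Rightarrow> nat"
  where "biwt e = size (fst e)"

lemma expo_simps [simp]: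
  "expo {#} = 0" "expo (add_mset \<alpha> M) = ({#fst \<alpha>#}, {#snd \<alpha>#}) + expo M"
  "expo (M + N) = expo M + expo N" "fst (expo M) = image_mset fst M" "snd (expo M) = image_mset snd M"
  by (simp_all add: expo_def zero_prod_def)

lemma biwt_simps [simp]: "biwt (e + e') = biwt e + biwt e'" "biwt (expo M) = size M" "biwt 0 = 0"
  by (simp_all add: biwt_def)

lemma expo_eq_0_iff [simp]: "expo M = 0 \<longleftrightarrow> M = {#}"
  by (auto simp: expo_def zero_prod_def)

text \<open>The join of \<open>(A, b)\<close> and \<open>(a, B)\<close>, where \<open>A\<close> and \<open>B\<close> are the largest coordinates that occur,
  can be split off any monomial modulo the Hibi relations.\<close>

lemma hibi_exchange:
  fixes y :: "nat \<times> nat \<Rightarrow> 'k::comm_monoid_mult"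
  assumes L: "sublattice L" and M: "set_mset M \<subseteq> L" "M \<noteq> {#}"
    and y: "\<And>\<alpha> \<beta>. \<alpha> \<in> L \<Longrightarrow> \<beta> \<in> L \<Longrightarrow> y \<alpha> * y \<beta> = y (sup \<alpha> \<beta>) * y (inf \<alpha> \<beta>)"
  defines "\<gamma> \<equiv> (Max (fst ` set_mset M), Max (snd ` set_mset M))"
  obtains N where "\<gamma> \<in> L" "set_mset N \<subseteq> L" "expo M = expo (add_mset \<gamma> N)"
    "prod_mset (image_mset y M) = y \<gamma> * prod_mset (image_mset y N)"
    "\<And>\<beta>. \<beta> \<in># N \<Longrightarrow> \<beta> \<le> \<gamma>"
proof -
  define A B where "A = Max (fst ` set_mset M)" and "B = Max (snd ` set_mset M)"
  have \<gamma>: "\<gamma> = (A, B)" by (simp add: \<gamma>_def A_def B_def)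
  have le: "a \<le> A" "b \<le> B" if "(a, b) \<in># M" for a b
    using that by (force simp: A_def B_def intro!: Max_ge)+
  have "A \<in> fst ` set_mset M" "B \<in> snd ` set_mset M"
    unfolding A_def B_def using M(2) by (intro Max_in; simp)+
  then obtain a b where ab: "(A, b) \<in># M" "(a, B) \<in># M" by auto
  show ?thesis
  \<comment> \<open>If b = B the join is itself a factor and can be removed; otherwise two distinct
    factors are replaced by their join and meet.\<close>
  proof (cases "b = B")
    case True
    then obtain N where N: "M = add_mset (A, B) N" using ab by (metis multi_member_split)
    show ?thesis
    proof (rule that[of N])
      show "\<beta> \<le> \<gamma>" if "\<beta> \<in># N" for \<beta>
        using le[of "fst \<beta>" "snd \<beta>"] that N by (simp add: \<gamma> less_eq_prod_def)
    qed (use M N in \<open>auto simp: \<gamma>\<close>)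
  next
    case False
    then have "(a, B) \<in># M - {#(A, b)#}" using ab by (auto simp: in_diff_count)
    then obtain M' where M': "M = {#(A, b), (a, B)#} + M'"
      using ab(1) by (metis add_mset_add_single insert_DiffM2 mset_add union_commute union_mset_add_mset_left)
    have L2: "(A, b) \<in> L" "(a, B) \<in> L" using ab M by auto
    have "a \<le> A" "b \<le> B" using le ab by auto
    then have sup: "sup (A, b) (a, B) = (A, B)" and inf: "inf (A, b) (a, B) = (a, b)"
      by (simp_all add: sup_prod_def inf_prod_def sup_nat_def inf_nat_def)
    have top: "(A, B) \<in> L" "(a, b) \<in> L"
      using L L2 sup inf unfolding sublattice_def by metis+
    have y2: "y (A, b) * y (a, B) = y (A, B) * y (a, b)" using y[OF L2] sup inf by simp
    show ?thesis
    proof (rule that[of "add_mset (a, b) M'"])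
      show "expo M = expo (add_mset \<gamma> (add_mset (a, b) M'))"
        by (simp add: M' \<gamma> expo_def)
      show "prod_mset (image_mset y M) = y \<gamma> * prod_mset (image_mset y (add_mset (a, b) M'))"
        using y2 by (simp add: M' \<gamma> mult.assoc[symmetric])
      show "\<beta> \<le> \<gamma>" if "\<beta> \<in># add_mset (a, b) M'" for \<beta>
        using le[of "fst \<beta>" "snd \<beta>"] that \<open>a \<le> A\<close> \<open>b \<le> B\<close> M'
        by (auto simp: \<gamma> less_eq_prod_def)
    qed (use M M' top in \<open>auto simp: \<gamma>\<close>)
  qed
qed

text \<open>Both products have the same largest coordinates, which can be read off the exponent, so
  the same join splits off on both sides; then induction on the degree. Thus the quadratic relations
  imply every binomial relation between products with equal exponents.\<close>

lemma hibi_prod_eq: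
  fixes y :: "nat \<times> nat \<Rightarrow> 'k::comm_monoid_mult"
  assumes L: "sublattice L" and "set_mset M \<subseteq> L" "set_mset N \<subseteq> L" "expo M = expo N"
    and y: "\<And>\<alpha> \<beta>. \<alpha> \<in> L \<Longrightarrow> \<beta> \<in> L \<Longrightarrow> y \<alpha> * y \<beta> = y (sup \<alpha> \<beta>) * y (inf \<alpha> \<beta>)"
  shows "prod_mset (image_mset y M) = prod_mset (image_mset y N)"
  using assms(2-4)
proof (induction "size M" arbitrary: M N)
  case 0
  then show ?case by (metis expo_eq_0_iff size_eq_0_iff_empty)
next
  case (Suc n)
  have ne: "M \<noteq> {#}" "N \<noteq> {#}" using Suc.hyps(2) Suc.prems(3) by (metis expo_eq_0_iff size_empty nat.distinct(1))+
  have fs: "fst ` set_mset M = fst ` set_mset N" "snd ` set_mset M = snd ` set_mset N"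
    using Suc.prems(3) by (metis expo_simps(4,5) set_image_mset)+
  obtain M' where M': "set_mset M' \<subseteq> L"
      "expo M = expo (add_mset (Max (fst ` set_mset M), Max (snd ` set_mset M)) M')"
      "prod_mset (image_mset y M) = y (Max (fst ` set_mset M), Max (snd ` set_mset M)) * prod_mset (image_mset y M')"
    by (rule hibi_exchange[OF L Suc.prems(1) ne(1), of y, OF y]) blast+
  obtain N' where N': "set_mset N' \<subseteq> L"
      "expo N = expo (add_mset (Max (fst ` set_mset N), Max (snd ` set_mset N)) N')"
      "prod_mset (image_mset y N) = y (Max (fst ` set_mset N), Max (snd ` set_mset N)) * prod_mset (image_mset y N')"
    by (rule hibi_exchange[OF L Suc.prems(2) ne(2), of y, OF y]) blast+
  have "size M = Suc (size M')" using arg_cong[OF M'(2), of biwt] by (simp add: biwt_def)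
  moreover have "expo M' = expo N'"
    using M'(2) N'(2) Suc.prems(3) fs by (simp add: expo_def)
  ultimately have "prod_mset (image_mset y M') = prod_mset (image_mset y N')"
    using Suc.hyps(1)[of M' N'] Suc.hyps(2) M'(1) N'(1) by simp
  then show ?case using M' N' fs by simp
qed

lemma submonoid_hibi: "is_submonoid (hibi_monoid L)"
  unfolding is_submonoid_def
proof (intro conjI ballI)
  show "0 \<in> hibi_monoid L"
    unfolding hibi_monoid_def mem_Collect_eq by (intro exI[of _ "{#}"]) simp
  fix x y assume "x \<in> hibi_monoid L" "y \<in> hibi_monoid L"
  then obtain M N where "x = expo M" "set_mset M \<subseteq> L" "y = expo N" "set_mset N \<subseteq> L"
    unfolding hibi_monoid_def by blast
  then show "x + y \<in> hibi_monoid L"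
    unfolding hibi_monoid_def mem_Collect_eq by (intro exI[of _ "M + N"]) simp
qed

lemma hibi_monoid_wt_0: "e \<in> hibi_monoid L \<Longrightarrow> biwt e = 0 \<Longrightarrow> e = 0"
  by (auto simp: hibi_monoid_def)

lemma hibi_monoid_gen:
  assumes "e \<in> hibi_monoid L" "biwt e = Suc q"
  shows "\<exists>g\<in>hibi_monoid L. \<exists>e'\<in>hibi_monoid L. e = e' + g \<and> biwt g = 1"
proof -
  obtain M where M: "e = expo M" "set_mset M \<subseteq> L" using assms by (auto simp: hibi_monoid_def)
  then obtain \<alpha> N where N: "M = add_mset \<alpha> N" using assms(2) by (metis biwt_simps(2) size_eq_Suc_imp_eq_union)
  then have "set_mset {#\<alpha>#} \<subseteq> L" "set_mset N \<subseteq> L"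
    using M by auto
  then have "expo {#\<alpha>#} \<in> hibi_monoid L" "expo N \<in> hibi_monoid L"
    unfolding hibi_monoid_def by blast+
  moreover have "e = expo N + expo {#\<alpha>#}" "biwt (expo {#\<alpha>#}) = 1"
    by (simp_all add: M N biwt_def ac_simps)
  ultimately show ?thesis by blast
qed

lemma hibi_monoid_wt_1:
  assumes "e \<in> hibi_monoid L" "biwt e = 1"
  obtains a b where "(a, b) \<in> L" "e = ({#a#}, {#b#})"
proof -
  obtain M where M: "e = expo M" "set_mset M \<subseteq> L" using assms by (auto simp: hibi_monoid_def)
  then obtain \<alpha> where "M = {#\<alpha>#}" using assms(2) by (metis biwt_simps(2) size_1_singleton_mset)
  then show ?thesis using M that[of "fst \<alpha>" "snd \<alpha>"] by (simp add: zero_prod_def)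
qed

lemma hibi_monoid_single: "(a, b) \<in> L \<Longrightarrow> ({#a#}, {#b#}) \<in> hibi_monoid L"
  unfolding hibi_monoid_def by (auto intro!: exI[of _ "{#(a, b)#}"] simp: zero_prod_def)

section \<open>Polynomial exponents as multisets, and the substitution x_ab = u_a v_b\<close>

definition mset_of :: "('v \<Rightarrow>\<^sub>0 nat) \<Rightarrow> 'v multiset"
  where "mset_of m = Abs_multiset (lookup m)"

lemma count_mset_of [simp]: "count (mset_of m) v = lookup m v"
  unfolding mset_of_def by (subst count_Abs_multiset) auto

lemma set_mset_of [simp]: "set_mset (mset_of m) = keys m"
  by (auto simp: set_mset_def in_keys_iff)

lemma mset_of_add [simp]: "mset_of (m + n) = mset_of m + mset_of n"
  by (rule multiset_eqI) (simp add: lookup_add)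

lemma mset_of_zero [simp]: "mset_of 0 = {#}"
  by (rule multiset_eqI) simp

lemma mset_of_surj: "\<exists>m. mset_of m = M"
proof -
  have "finite {x. count M x \<noteq> 0}" by (simp add: set_mset_def[symmetric] not_le)
  then have "mset_of (Abs_poly_mapping (count M)) = M"
    by (intro multiset_eqI) simp
  then show ?thesis by blast
qed

lemma prod_keys_mset_of:
  "(\<Prod>v\<in>keys m. x v ^ lookup m v) = prod_mset (image_mset x (mset_of m) :: 'k::comm_monoid_mult multiset)"
  by (simp add: image_prod_mset_multiplicity)

definition hibi_exp :: "('v \<Rightarrow> nat \<times> nat) \<Rightarrow> ('v \<Rightarrow>\<^sub>0 nat) \<Rightarrow> bimon"
  where "hibi_exp \<nu> m = expo (image_mset \<nu> (mset_of m))"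

definition hibi_hom :: "('v \<Rightarrow> nat \<times> nat) \<Rightarrow> (('v \<Rightarrow>\<^sub>0 nat) \<Rightarrow>\<^sub>0 'k::field) \<Rightarrow> bimon \<Rightarrow>\<^sub>0 'k"
  where "hibi_hom \<nu> = mlift (single 0) (\<lambda>m. single (hibi_exp \<nu> m) 1)"

lemma hibi_hom_simps:
  fixes f g :: "('v \<Rightarrow>\<^sub>0 nat) \<Rightarrow>\<^sub>0 'k::field"
  shows hibi_hom_add: "hibi_hom \<nu> (f + g) = hibi_hom \<nu> f + hibi_hom \<nu> g"
    and hibi_hom_mult: "hibi_hom \<nu> (f * g) = hibi_hom \<nu> f * hibi_hom \<nu> g"
    and hibi_hom_single: "hibi_hom \<nu> (single m (c::'k)) = single (hibi_exp \<nu> m) c"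
    and hibi_hom_sum: "hibi_hom \<nu> (\<Sum>i\<in>A. F i :: ('v \<Rightarrow>\<^sub>0 nat) \<Rightarrow>\<^sub>0 'k) = (\<Sum>i\<in>A. hibi_hom \<nu> (F i))"
proof -
  interpret scalar_hom "\<lambda>c::'k. single (0::bimon) c" by (rule scalar_hom_single)
  show "hibi_hom \<nu> (f + g) = hibi_hom \<nu> f + hibi_hom \<nu> g"
    unfolding hibi_hom_def by (rule mlift_add)
  show "hibi_hom \<nu> (f * g) = hibi_hom \<nu> f * hibi_hom \<nu> g"
    unfolding hibi_hom_def by (rule mlift_mult) (simp add: hibi_exp_def mult_single)
  show "hibi_hom \<nu> (single m c) = single (hibi_exp \<nu> m) c"
    unfolding hibi_hom_def mlift_single by (simp add: mult_single)
  show "hibi_hom \<nu> (\<Sum>i\<in>A. F i :: ('v \<Rightarrow>\<^sub>0 nat) \<Rightarrow>\<^sub>0 'k) = (\<Sum>i\<in>A. hibi_hom \<nu> (F i))"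
    unfolding hibi_hom_def by (rule mlift_sum)
qed

lemma hibi_exp_0 [simp]: "hibi_exp \<nu> 0 = 0"
  by (simp add: hibi_exp_def)

lemma bival_expo: "bival u v (expo M) = prod_mset (image_mset (\<lambda>\<alpha>. u (fst \<alpha>) * v (snd \<alpha>)) M)"
  by (simp add: bival_def prod_mset.distrib image_mset.compositionality comp_def)

lemma poly_carrier: "carrier (poly_alg V) = {f. \<forall>m\<in>keys f. keys m \<subseteq> V}"
  by (auto simp: poly_alg_def)

lemma bieval_hibi_hom:
  assumes f: "f \<in> carrier (poly_alg V)" and x: "\<And>v. v \<in> V \<Longrightarrow> x v = u (fst (\<nu> v)) * w (snd (\<nu> v))"
  shows "bieval u w (hibi_hom \<nu> f) = poly_eval x (f :: ('v \<Rightarrow>\<^sub>0 nat) \<Rightarrow>\<^sub>0 'k::field)"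
proof -
  have "bieval u w (\<Sum>m\<in>B. single (hibi_exp \<nu> m) (lookup f m)) = (\<Sum>m\<in>B. lookup f m * bival u w (hibi_exp \<nu> m))"
    for B by (induction B rule: infinite_finite_induct) (simp_all add: bieval_simps)
  moreover have "hibi_hom \<nu> f = (\<Sum>m\<in>keys f. single (hibi_exp \<nu> m) (lookup f m))"
    by (subst (1) poly_mapping_sum_single) (simp add: hibi_hom_sum hibi_hom_single)
  moreover have "bival u w (hibi_exp \<nu> m) = (\<Prod>v\<in>keys m. x v ^ lookup m v)" if "m \<in> keys f" for m
  proof -
    have "keys m \<subseteq> V" using that f by (simp add: poly_carrier)
    then have "image_mset (\<lambda>v. u (fst (\<nu> v)) * w (snd (\<nu> v))) (mset_of m) = image_mset x (mset_of m)"
      using x by (intro image_mset_cong) auto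
    then show ?thesis
      unfolding prod_keys_mset_of hibi_exp_def bival_expo image_mset.compositionality comp_def by simp
  qed
  ultimately show ?thesis by (simp add: poly_eval_def)
qed

text \<open>The labelling \<nu> lets one argument serve both a lattice itself and the product of a
  Hibi variety with an affine space, where the variables form a disjoint union.\<close>

locale planar_hibi =
  fixes V :: "'v set" and \<nu> :: "'v \<Rightarrow> nat \<times> nat" and X :: "('v \<Rightarrow> 'k::alg_closed_field) set"
  assumes inj: "inj_on \<nu> V" and lat: "sublattice (\<nu> ` V)"
    and X_eq: "X = {x \<in> affine_space V. \<forall>a\<in>V. \<forall>b\<in>V. \<forall>c\<in>V. \<forall>d\<in>V.
      \<nu> c = sup (\<nu> a) (\<nu> b) \<longrightarrow> \<nu> d = inf (\<nu> a) (\<nu> b) \<longrightarrow> x a * x b = x c * x d}"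
begin

text \<open>In each coordinate maximum and minimum only permute the two factors.\<close>

lemma torus_point: "(\<lambda>a\<in>V. u (fst (\<nu> a)) * w (snd (\<nu> a))) \<in> X"
proof -
  have "u (fst \<alpha>) * w (snd \<alpha>) * (u (fst \<beta>) * w (snd \<beta>))
      = u (fst (sup \<alpha> \<beta>)) * w (snd (sup \<alpha> \<beta>)) * (u (fst (inf \<alpha> \<beta>)) * w (snd (inf \<alpha> \<beta>)))"
    for \<alpha> \<beta> :: "nat \<times> nat"
    by (cases "fst \<alpha> \<le> fst \<beta>"; cases "snd \<alpha> \<le> snd \<beta>")
      (simp_all add: sup_prod_def inf_prod_def sup_nat_def inf_nat_def max_def min_def)
  then show ?thesis by (auto simp: X_eq affine_space_def)
qed

lemma eval_fiber:
  assumes x: "x \<in> X" and m: "keys m \<subseteq> V" "keys n \<subseteq> V" "hibi_exp \<nu> m = hibi_exp \<nu> n"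
  shows "(\<Prod>v\<in>keys m. x v ^ lookup m v) = (\<Prod>v\<in>keys n. x v ^ lookup n v)"
proof -
  define y where "y = x \<circ> inv_into V \<nu>"
  have y: "y (\<nu> v) = x v" if "v \<in> V" for v using that inj by (simp add: y_def)
  have eq: "prod_mset (image_mset y (image_mset \<nu> (mset_of m))) = (\<Prod>v\<in>keys m. x v ^ lookup m v)"
    if "keys m \<subseteq> V" for m
    unfolding prod_keys_mset_of image_mset.compositionality
    by (intro arg_cong[of _ _ prod_mset] image_mset_cong) (use that y in auto)
  have "prod_mset (image_mset y (image_mset \<nu> (mset_of m))) = prod_mset (image_mset y (image_mset \<nu> (mset_of n)))"
  proof (rule hibi_prod_eq[OF lat])
    fix \<alpha> \<beta> assume ab: "\<alpha> \<in> \<nu> ` V" "\<beta> \<in> \<nu> ` V"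
    then have "sup \<alpha> \<beta> \<in> \<nu> ` V" "inf \<alpha> \<beta> \<in> \<nu> ` V" using lat by (auto simp: sublattice_def)
    moreover obtain a where a: "a \<in> V" "\<alpha> = \<nu> a" using ab(1) by (rule imageE)
    moreover obtain b where b: "b \<in> V" "\<beta> = \<nu> b" using ab(2) by (rule imageE)
    ultimately obtain c d where cd: "c \<in> V" "d \<in> V" "sup \<alpha> \<beta> = \<nu> c" "inf \<alpha> \<beta> = \<nu> d"
      by (auto elim!: imageE)
    have "\<forall>a\<in>V. \<forall>b\<in>V. \<forall>c\<in>V. \<forall>d\<in>V.
        \<nu> c = sup (\<nu> a) (\<nu> b) \<longrightarrow> \<nu> d = inf (\<nu> a) (\<nu> b) \<longrightarrow> x a * x b = x c * x d"
      using x unfolding X_eq by blast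
    then have "x a * x b = x c * x d" using a b cd by simp
    then show "y \<alpha> * y \<beta> = y (sup \<alpha> \<beta>) * y (inf \<alpha> \<beta>)" using a b cd y by simp
  qed (use m in \<open>auto simp: hibi_exp_def\<close>)
  then show ?thesis using eq m by simp
qed

text \<open>One direction tests f on torus points, where independence of characters applies. The
  other groups the monomials of f by exponent: at a point of X all monomials of a group take the
  same value, and the coefficients of the group add up to a coefficient of
  \<open>hibi_hom \<nu> f\<close>.\<close>

lemma vanishing_iff:
  assumes f: "f \<in> carrier (poly_alg V)"
  shows "f \<in> vanishing_ideal V X \<longleftrightarrow> hibi_hom \<nu> f = 0"
proof
  assume van: "f \<in> vanishing_ideal V X"
  show "hibi_hom \<nu> f = 0"
  proof (rule bieval_zero_iff)
    fix u w :: "nat \<Rightarrow> 'k"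
    have "bieval u w (hibi_hom \<nu> f) = poly_eval (\<lambda>a\<in>V. u (fst (\<nu> a)) * w (snd (\<nu> a))) f"
      by (rule bieval_hibi_hom[OF f]) simp
    then show "bieval u w (hibi_hom \<nu> f) = 0"
      using van torus_point by (simp add: vanishing_ideal_def)
  qed
next
  assume 0: "hibi_hom \<nu> f = 0"
  have "poly_eval x f = 0" if x: "x \<in> X" for x
  proof -
    let ?g = "\<lambda>m. lookup f m * (\<Prod>v\<in>keys m. x v ^ lookup m v)"
    have "poly_eval x f = (\<Sum>e\<in>hibi_exp \<nu> ` keys f. sum ?g {m \<in> keys f. hibi_exp \<nu> m = e})"
      unfolding poly_eval_def by (rule sum.image_gen) simp
    also have "\<dots> = 0"
    proof (rule sum.neutral, rule ballI)
      fix e assume "e \<in> hibi_exp \<nu> ` keys f"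
      then obtain n where n: "n \<in> keys f" "e = hibi_exp \<nu> n" by blast
      have "sum ?g {m \<in> keys f. hibi_exp \<nu> m = e}
          = (\<Sum>m\<in>{m \<in> keys f. hibi_exp \<nu> m = e}. lookup f m) * (\<Prod>v\<in>keys n. x v ^ lookup n v)"
        unfolding sum_distrib_right
      proof (rule sum.cong)
        fix m assume "m \<in> {m \<in> keys f. hibi_exp \<nu> m = e}"
        then show "?g m = lookup f m * (\<Prod>v\<in>keys n. x v ^ lookup n v)"
          using eval_fiber[OF x, of m n] n f by (simp add: poly_carrier)
      qed simp
      also have "(\<Sum>m\<in>{m \<in> keys f. hibi_exp \<nu> m = e}. lookup f m) = 0"
        using lookup_mlift_single[of "hibi_exp \<nu>" f e] 0 by (simp add: hibi_hom_def)
      finally show "sum ?g {m \<in> keys f. hibi_exp \<nu> m = e} = 0" by simp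
    qed
    finally show ?thesis .
  qed
  then show "f \<in> vanishing_ideal V X" using f by (simp add: vanishing_ideal_def)
qed

lemma hibi_exp_in: "keys m \<subseteq> V \<Longrightarrow> hibi_exp \<nu> m \<in> hibi_monoid (\<nu> ` V)"
  unfolding hibi_exp_def hibi_monoid_def mem_Collect_eq
  by (intro exI[of _ "image_mset \<nu> (mset_of m)"]) auto

lemma hibi_exp_surj:
  assumes "e \<in> hibi_monoid (\<nu> ` V)"
  shows "\<exists>m. keys m \<subseteq> V \<and> hibi_exp \<nu> m = e"
proof -
  obtain M where M: "e = expo M" "set_mset M \<subseteq> \<nu> ` V" using assms by (auto simp: hibi_monoid_def)
  obtain m where m: "mset_of m = image_mset (inv_into V \<nu>) M" using mset_of_surj by blast
  have "image_mset \<nu> (mset_of m) = image_mset (\<lambda>a. a) M"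
    unfolding m image_mset.compositionality
    by (rule image_mset_cong) (use M(2) in \<open>auto simp: f_inv_into_f\<close>)
  moreover have "keys m \<subseteq> V"
    using arg_cong[OF m, of set_mset] M(2) by (auto simp: inv_into_into)
  ultimately show ?thesis using M by (auto simp: hibi_exp_def)
qed

lemma hibi_hom_image:
  "hibi_hom \<nu> ` carrier (poly_alg V) = (carrier (monoid_alg (hibi_monoid (\<nu> ` V))) :: (bimon \<Rightarrow>\<^sub>0 'k) set)"
proof (intro equalityI subsetI)
  fix b :: "bimon \<Rightarrow>\<^sub>0 'k" assume "b \<in> hibi_hom \<nu> ` carrier (poly_alg V)"
  then show "b \<in> carrier (monoid_alg (hibi_monoid (\<nu> ` V)))"
    using keys_mlift_single[of "hibi_exp \<nu>"] hibi_exp_in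
    by (fastforce simp: hibi_hom_def poly_carrier)
next
  fix b :: "bimon \<Rightarrow>\<^sub>0 'k" assume b: "b \<in> carrier (monoid_alg (hibi_monoid (\<nu> ` V)))"
  then have "\<forall>e\<in>keys b. \<exists>m. keys m \<subseteq> V \<and> hibi_exp \<nu> m = e" using hibi_exp_surj by auto
  then obtain \<mu> where \<mu>: "\<And>e. e \<in> keys b \<Longrightarrow> keys (\<mu> e) \<subseteq> V \<and> hibi_exp \<nu> (\<mu> e) = e" by metis
  define f where "f = (\<Sum>e\<in>keys b. single (\<mu> e) (lookup b e))"
  have "keys f \<subseteq> (\<Union>e\<in>keys b. keys (single (\<mu> e) (lookup b e)))"
    unfolding f_def by (rule keys_sum)
  then have "\<exists>e\<in>keys b. m = \<mu> e" if "m \<in> keys f" for m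
    using that by (fastforce split: if_splits)
  then have "f \<in> carrier (poly_alg V)"
    using \<mu> by (fastforce simp: poly_carrier)
  moreover have "hibi_hom \<nu> f = (\<Sum>e\<in>keys b. single e (lookup b e))"
    unfolding f_def hibi_hom_sum hibi_hom_single using \<mu> by (intro sum.cong) auto
  then have "hibi_hom \<nu> f = b" by (simp flip: poly_mapping_sum_single)
  ultimately show "b \<in> hibi_hom \<nu> ` carrier (poly_alg V)" by blast
qed

lemma coord_alg_iso:
  "alg_iso (monoid_alg (hibi_monoid (\<nu> ` V)) :: ('k, bimon \<Rightarrow>\<^sub>0 'k) module) (coord_alg V X) \<noteq> {}"
proof -
  interpret coord_hom V X "hibi_hom \<nu>" "single 0"
    by (rule coord_hom.intro) (simp_all add: hibi_hom_simps scalar_hom_single vanishing_iff)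
  show ?thesis
    using coord_iso[OF hibi_hom_image alg_embedding_monoid_alg[OF submonoid_hibi]] by blast
qed

end

section \<open>Hilbert functions of planar Hibi rings\<close>

definition layer :: "(nat \<times> nat) set \<Rightarrow> nat \<Rightarrow> bimon set"
  where "layer L j = {e \<in> hibi_monoid L. biwt e = j}"

lemma layer_0: "layer L 0 = {0}"
  using submonoid_hibi[of L] by (auto simp: layer_def is_submonoid_def dest: hibi_monoid_wt_0)

lemma sublattice_below: "sublattice L \<Longrightarrow> sublattice (L \<inter> {..\<alpha>})"
  by (auto simp: sublattice_def intro: le_infI1)

text \<open>The top element can be recovered from the exponent; this makes the union in
  \<open>layer_Suc\<close> disjoint.\<close>

lemma layer_top:
  assumes "e \<in> layer (L \<inter> {..\<beta>}) j"
  shows "Max (set_mset (fst (({#fst \<beta>#}, {#snd \<beta>#}) + e))) = fst \<beta>"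
    "Max (set_mset (snd (({#fst \<beta>#}, {#snd \<beta>#}) + e))) = snd \<beta>"
proof -
  obtain M where M: "e = expo M" "set_mset M \<subseteq> L \<inter> {..\<beta>}"
    using assms by (auto simp: layer_def hibi_monoid_def)
  then have "x \<le> fst \<beta>" "y \<le> snd \<beta>" if "(x, y) \<in># M" for x y
    using that by (auto simp: less_eq_prod_def)
  then show "Max (set_mset (fst (({#fst \<beta>#}, {#snd \<beta>#}) + e))) = fst \<beta>"
    "Max (set_mset (snd (({#fst \<beta>#}, {#snd \<beta>#}) + e))) = snd \<beta>"
    using M by (auto intro!: Max_eqI)
qed

text \<open>Every element of the monoid splits off the join of its factors, and the rest lies below
  that join. Iterating, elements of degree j correspond to multichains of length j.\<close>

lemma layer_Suc:
  assumes L: "sublattice L"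
  shows "layer (L \<inter> {..\<alpha>}) (Suc j)
    = (\<Union>\<beta>\<in>L \<inter> {..\<alpha>}. (\<lambda>e. ({#fst \<beta>#}, {#snd \<beta>#}) + e) ` layer (L \<inter> {..\<beta>}) j)" (is "?A = ?B")
proof (intro equalityI subsetI)
  fix e assume "e \<in> ?A"
  then obtain M where M: "e = expo M" "set_mset M \<subseteq> L \<inter> {..\<alpha>}" "size M = Suc j"
    by (auto simp: layer_def hibi_monoid_def)
  then have "M \<noteq> {#}" by auto
  \<comment> \<open>Only the exponent is of interest here, hence the constant function for
    y.\<close>
  then obtain \<gamma> N where N: "\<gamma> \<in> L \<inter> {..\<alpha>}" "set_mset N \<subseteq> L \<inter> {..\<alpha>}" "expo M = expo (add_mset \<gamma> N)"
      "\<And>\<beta>. \<beta> \<in># N \<Longrightarrow> \<beta> \<le> \<gamma>"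
    by (rule hibi_exchange[OF sublattice_below[OF L] M(2), where y="\<lambda>_. 1::nat"]) auto
  have "size N = j" using arg_cong[OF N(3), of biwt] M(3) by (simp add: biwt_def)
  moreover have "set_mset N \<subseteq> L \<inter> {..\<gamma>}" using N(2,4) by blast
  ultimately have "expo N \<in> layer (L \<inter> {..\<gamma>}) j"
    unfolding layer_def hibi_monoid_def by auto
  then show "e \<in> ?B" using N M(1) by auto
next
  fix e assume "e \<in> ?B"
  then obtain \<beta> M where \<beta>: "\<beta> \<in> L" "\<beta> \<le> \<alpha>" and M: "set_mset M \<subseteq> L \<inter> {..\<beta>}" "size M = j"
      "e = ({#fst \<beta>#}, {#snd \<beta>#}) + expo M"
    by (auto simp: layer_def hibi_monoid_def)
  have "set_mset (add_mset \<beta> M) \<subseteq> L \<inter> {..\<alpha>}" using \<beta> M(1) by (auto intro: order_trans)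
  then have "expo (add_mset \<beta> M) \<in> hibi_monoid (L \<inter> {..\<alpha>})"
    unfolding hibi_monoid_def by blast
  then show "e \<in> ?A" using M by (simp add: layer_def biwt_def)
qed

lemma finite_layer_below:
  assumes "sublattice L" "finite L"
  shows "finite (layer (L \<inter> {..\<alpha>}) j)"
proof (induction j arbitrary: \<alpha>)
  case (Suc j)
  then show ?case unfolding layer_Suc[OF assms(1)] using assms(2) by auto
qed (simp add: layer_0)

lemma card_layer_Suc:
  assumes L: "sublattice L" "finite L"
  shows "card (layer (L \<inter> {..\<alpha>}) (Suc j)) = (\<Sum>\<beta>\<in>L \<inter> {..\<alpha>}. card (layer (L \<inter> {..\<beta>}) j))"
proof -
  let ?F = "\<lambda>\<beta>. (\<lambda>e. ({#fst \<beta>#}, {#snd \<beta>#}) + e) ` layer (L \<inter> {..\<beta>}) j"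
  have "card (layer (L \<inter> {..\<alpha>}) (Suc j)) = (\<Sum>\<beta>\<in>L \<inter> {..\<alpha>}. card (?F \<beta>))"
    unfolding layer_Suc[OF L(1)]
  proof (rule card_UN_disjoint)
    show "\<forall>\<beta>\<in>L \<inter> {..\<alpha>}. finite (?F \<beta>)" using finite_layer_below[OF L] by blast
    show "\<forall>\<beta>\<in>L \<inter> {..\<alpha>}. \<forall>\<gamma>\<in>L \<inter> {..\<alpha>}. \<beta> \<noteq> \<gamma> \<longrightarrow> ?F \<beta> \<inter> ?F \<gamma> = {}"
    proof (intro ballI impI, rule ccontr)
      fix \<beta> \<gamma> :: "nat \<times> nat" assume ne: "\<beta> \<noteq> \<gamma>" and "?F \<beta> \<inter> ?F \<gamma> \<noteq> {}"
      then obtain e e' where "e \<in> layer (L \<inter> {..\<beta>}) j" "e' \<in> layer (L \<inter> {..\<gamma>}) j"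
          "({#fst \<beta>#}, {#snd \<beta>#}) + e = ({#fst \<gamma>#}, {#snd \<gamma>#}) + e'"
        by blast
      then have "fst \<beta> = fst \<gamma>" "snd \<beta> = snd \<gamma>" using layer_top by metis+
      then show False using ne by (simp add: prod_eq_iff)
    qed
  qed (use L(2) in auto)
  also have "\<dots> = (\<Sum>\<beta>\<in>L \<inter> {..\<alpha>}. card (layer (L \<inter> {..\<beta>}) j))"
    by (intro sum.cong refl card_image) (auto simp: inj_on_def)
  finally show ?thesis .
qed

text \<open>The coefficients are required to vanish beyond d so that expansions of different lengths
  can be added term by term.\<close>

definition binom_expansion :: "(nat \<Rightarrow> nat) \<Rightarrow> nat \<Rightarrow> (nat \<Rightarrow> rat) \<Rightarrow> bool"
  where "binom_expansion f d c \<longleftrightarrow>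
    (\<forall>i>d. c i = 0) \<and> (\<forall>j. of_nat (f j) = (\<Sum>i\<le>d. c i * of_nat (j choose i)))"

lemma binom_expansion_mono:
  assumes "binom_expansion f d c" "d \<le> d'"
  shows "of_nat (f j) = (\<Sum>i\<le>d'. c i * of_nat (j choose i))"
proof -
  have "(\<Sum>i\<le>d. c i * of_nat (j choose i)) = (\<Sum>i\<le>d'. c i * of_nat (j choose i) :: rat)"
    by (rule sum.mono_neutral_left) (use assms in \<open>auto simp: binom_expansion_def\<close>)
  then show ?thesis using assms by (simp add: binom_expansion_def)
qed

text \<open>The number of elements of the chains of maximal length, and of maximal chains, below \<open>\<alpha>\<close>
  determine the leading term: in the binomial basis the recursion of \<open>card_layer_Suc\<close> is just a shift.\<close>

lemma layer_binom_expansion: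
  fixes \<rho> :: "nat \<times> nat \<Rightarrow> nat" and \<epsilon> :: "nat \<times> nat \<Rightarrow> rat"
  assumes L: "sublattice L" "finite L"
    and \<rho>: "\<And>\<alpha> \<beta>. \<alpha> \<in> L \<Longrightarrow> \<beta> \<in> L \<Longrightarrow> \<beta> < \<alpha> \<Longrightarrow> \<rho> \<beta> < \<rho> \<alpha>"
    and \<epsilon>0: "\<And>\<alpha>. \<alpha> \<in> L \<Longrightarrow> \<rho> \<alpha> = 0 \<Longrightarrow> \<epsilon> \<alpha> = 1"
    and \<epsilon>: "\<And>\<alpha>. \<alpha> \<in> L \<Longrightarrow> \<rho> \<alpha> > 0 \<Longrightarrow> \<epsilon> \<alpha> = (\<Sum>\<beta>\<in>{\<beta>\<in>L. \<beta> < \<alpha> \<and> Suc (\<rho> \<beta>) = \<rho> \<alpha>}. \<epsilon> \<beta>)"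
    and "\<alpha> \<in> L"
  shows "\<exists>c. binom_expansion (\<lambda>j. card (layer (L \<inter> {..\<alpha>}) j)) (\<rho> \<alpha>) c \<and> c (\<rho> \<alpha>) = \<epsilon> \<alpha>"
  using \<open>\<alpha> \<in> L\<close>
proof (induction "\<rho> \<alpha>" arbitrary: \<alpha> rule: less_induct)
  case less
  let ?f = "\<lambda>\<alpha> j. card (layer (L \<inter> {..\<alpha>}) j)"
  let ?B = "{\<beta>\<in>L. \<beta> < \<alpha>}"
  have split: "L \<inter> {..\<alpha>} = insert \<alpha> ?B" using less.prems by auto
  \<comment> \<open>The difference in j at \<alpha> is the sum over the elements strictly below
    \<alpha>; likewise the difference of j choose i + 1 is j choose i.\<close>
  have f_Suc: "?f \<alpha> (Suc j) = ?f \<alpha> j + (\<Sum>\<beta>\<in>?B. ?f \<beta> j)" for j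
  proof -
    have "(\<Sum>\<beta>\<in>L \<inter> {..\<alpha>}. g \<beta>) = g \<alpha> + (\<Sum>\<beta>\<in>?B. g \<beta>)" for g :: "nat \<times> nat \<Rightarrow> nat"
      unfolding split by (subst sum.insert) (use L in auto)
    then show ?thesis unfolding card_layer_Suc[OF L] .
  qed
  have f_0: "?f \<alpha> 0 = 1" by (simp add: layer_0)
  show ?case
  proof (cases "\<rho> \<alpha>")
    case 0
    \<comment> \<open>Rank 0 forces minimality, because \<rho> is strictly increasing.\<close>
    then have B: "?B = {}" using \<rho> less.prems by fastforce
    have "?f \<alpha> j = 1" for j
      by (induction j) (simp add: f_0, subst f_Suc, subst B, simp)
    then show ?thesis
      using 0 \<epsilon>0[OF less.prems] by (intro exI[of _ "\<lambda>i. if i = 0 then 1 else 0"]) (simp add: binom_expansion_def)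
  next
    case (Suc d)
    have "\<forall>\<beta>\<in>?B. \<exists>c. binom_expansion (?f \<beta>) (\<rho> \<beta>) c \<and> c (\<rho> \<beta>) = \<epsilon> \<beta>"
      using less.hyps \<rho> less.prems by blast
    from bchoice[OF this] obtain c where
      c0: "\<forall>\<beta>\<in>?B. binom_expansion (?f \<beta>) (\<rho> \<beta>) (c \<beta>) \<and> c \<beta> (\<rho> \<beta>) = \<epsilon> \<beta>" by blast
    have c: "binom_expansion (?f \<beta>) (\<rho> \<beta>) (c \<beta>)" "c \<beta> (\<rho> \<beta>) = \<epsilon> \<beta>" if "\<beta> \<in> ?B" for \<beta>
      using bspec[OF c0 that] by simp_all
    have \<rho>B: "\<rho> \<beta> \<le> d" if "\<beta> \<in> ?B" for \<beta> using \<rho>[of \<alpha> \<beta>] that less.prems Suc by auto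
    define q where "q i = (\<Sum>\<beta>\<in>?B. c \<beta> i)" for i
    have q: "of_nat (\<Sum>\<beta>\<in>?B. ?f \<beta> j) = (\<Sum>i\<le>d. q i * of_nat (j choose i))" for j
    proof -
      have "of_nat (\<Sum>\<beta>\<in>?B. ?f \<beta> j) = (\<Sum>\<beta>\<in>?B. \<Sum>i\<le>d. c \<beta> i * of_nat (j choose i))"
        unfolding of_nat_sum by (intro sum.cong refl binom_expansion_mono[OF c(1)] \<rho>B)
      also have "\<dots> = (\<Sum>i\<le>d. \<Sum>\<beta>\<in>?B. c \<beta> i * of_nat (j choose i))" by (rule sum.swap)
      finally show ?thesis by (simp add: q_def sum_distrib_right)
    qed
    have f: "of_nat (?f \<alpha> j) = 1 + (\<Sum>i\<le>d. q i * of_nat (j choose Suc i))" for j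
    proof (induction j)
      case (Suc j)
      have "of_nat (?f \<alpha> (Suc j)) = 1 + (\<Sum>i\<le>d. q i * of_nat (j choose Suc i)) + (\<Sum>i\<le>d. q i * of_nat (j choose i))"
        using Suc q[of j] by (simp add: f_Suc)
      also have "\<dots> = 1 + (\<Sum>i\<le>d. q i * of_nat (Suc j choose Suc i))"
        by (simp add: algebra_simps sum.distrib)
      finally show ?case .
    qed (simp add: f_0)
    define c' where "c' i = (case i of 0 \<Rightarrow> 1 | Suc i \<Rightarrow> if i \<le> d then q i else 0)" for i
    have "binom_expansion (?f \<alpha>) (Suc d) c'"
      unfolding binom_expansion_def sum.atMost_Suc_shift f by (auto simp: c'_def split: nat.splits)
    moreover have "q d = \<epsilon> \<alpha>"
    proof -
      \<comment> \<open>The expansion of an element of rank below d is too short to reach the index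
        d.\<close>
      have "q d = (\<Sum>\<beta>\<in>?B. if Suc (\<rho> \<beta>) = \<rho> \<alpha> then \<epsilon> \<beta> else 0)"
        unfolding q_def
      proof (rule sum.cong)
        fix \<beta> assume \<beta>: "\<beta> \<in> ?B"
        show "c \<beta> d = (if Suc (\<rho> \<beta>) = \<rho> \<alpha> then \<epsilon> \<beta> else 0)"
          using c(1)[OF \<beta>] c(2)[OF \<beta>] \<rho>B[OF \<beta>] Suc
          by (cases "\<rho> \<beta> = d") (auto simp: binom_expansion_def)
      qed simp
      also have "\<dots> = (\<Sum>\<beta>\<in>{\<beta>\<in>?B. Suc (\<rho> \<beta>) = \<rho> \<alpha>}. \<epsilon> \<beta>)"
        by (rule sum.inter_filter[symmetric]) (use L(2) in auto)
      also have "{\<beta>\<in>?B. Suc (\<rho> \<beta>) = \<rho> \<alpha>} = {\<beta>\<in>L. \<beta> < \<alpha> \<and> Suc (\<rho> \<beta>) = \<rho> \<alpha>}" by auto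
      finally show ?thesis using \<epsilon>[OF less.prems] Suc by simp
    qed
    ultimately show ?thesis using Suc by (intro exI[of _ c']) (simp add: c'_def)
  qed
qed

section \<open>From binomial expansions to Hilbert polynomials\<close>

definition binom_poly :: "nat \<Rightarrow> rat Polynomial.poly"
  where "binom_poly i = Polynomial.smult (1 / fact i) (\<Prod>l<i. [:- of_nat l, 1:])"

lemma poly_binom_poly: "Polynomial.poly (binom_poly i) (of_nat j) = of_nat (j choose i)"
proof -
  have "of_nat (j choose i) = (of_nat j gchoose i :: rat)" by (rule binomial_gbinomial)
  then show ?thesis
    by (simp add: binom_poly_def poly_prod gbinomial_prod_rev atLeast0LessThan)
qed

lemma degree_binom_poly: "Polynomial.degree (binom_poly i) = i"
  and coeff_binom_poly: "Polynomial.coeff (binom_poly i) i = 1 / fact i"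
proof -
  let ?p = "\<Prod>l<i. [:- of_nat l, 1:] :: rat Polynomial.poly"
  have d: "Polynomial.degree ?p = i"
    by (subst degree_prod_eq_sum_degree) auto
  have "Polynomial.lead_coeff ?p = 1"
    by (subst lead_coeff_prod) simp
  then show "Polynomial.degree (binom_poly i) = i" "Polynomial.coeff (binom_poly i) i = 1 / fact i"
    using d by (simp_all add: binom_poly_def)
qed

lemma binom_expansion_poly:
  assumes "binom_expansion f d c"
  obtains p where "\<And>j. of_nat (f j) = Polynomial.poly p (of_nat j)"
    "Polynomial.degree p \<le> d" "Polynomial.coeff p d = c d / fact d"
proof
  let ?p = "\<Sum>i\<le>d. Polynomial.smult (c i) (binom_poly i)"
  show "of_nat (f j) = Polynomial.poly ?p (of_nat j)" for j
    using assms by (simp add: binom_expansion_def poly_sum poly_binom_poly)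
  show "Polynomial.degree ?p \<le> d"
    by (rule degree_sum_le) (auto intro: order_trans[OF Polynomial.degree_smult_le] simp: degree_binom_poly)
  have "Polynomial.coeff ?p d = (\<Sum>i\<le>d. if i = d then c d / fact d else 0)"
    unfolding coeff_sum
    by (rule sum.cong) (auto simp: coeff_binom_poly intro!: coeff_eq_0 simp: degree_binom_poly)
  then show "Polynomial.coeff ?p d = c d / fact d" by simp
qed

text \<open>A crude growth bound, which is all that the estimate for chains of primes uses.\<close>

lemma binom_expansion_bound:
  assumes "binom_expansion f d c"
  obtains C where "\<And>j. f j \<le> C * (j + 1) ^ d"
proof -
  obtain C :: nat where C: "(\<Sum>i\<le>d. \<bar>c i\<bar>) \<le> of_nat C" using real_arch_simple by blast
  have "f j \<le> C * (j + 1) ^ d" for j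
  proof -
    have "(of_nat (f j) :: rat) \<le> (\<Sum>i\<le>d. \<bar>c i\<bar> * of_nat ((j + 1) ^ d))"
    proof -
      have "c i * of_nat (j choose i) \<le> \<bar>c i\<bar> * of_nat ((j + 1) ^ d)" if "i \<le> d" for i
      proof -
        have "j choose i \<le> (j + 1) ^ i"
        proof (cases "i \<le> j")
          case True
          then have "j choose i \<le> j ^ i" by (rule binomial_le_pow)
          also have "\<dots> \<le> (j + 1) ^ i" by (rule power_mono) auto
          finally show ?thesis .
        qed (simp add: binomial_eq_0)
        also have "\<dots> \<le> (j + 1) ^ d" using that by (intro power_increasing) auto
        finally have *: "j choose i \<le> (j + 1) ^ d" .
        have "c i * of_nat (j choose i) \<le> \<bar>c i\<bar> * of_nat (j choose i)"
          by (intro mult_right_mono) auto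
        also have "\<dots> \<le> \<bar>c i\<bar> * of_nat ((j + 1) ^ d)"
          by (intro mult_left_mono of_nat_mono *) auto
        finally show ?thesis .
      qed
      then show ?thesis using assms unfolding binom_expansion_def by (auto intro!: sum_mono)
    qed
    also have "\<dots> = (\<Sum>i\<le>d. \<bar>c i\<bar>) * of_nat ((j + 1) ^ d)" by (simp only: sum_distrib_right)
    also have "\<dots> \<le> of_nat C * of_nat ((j + 1) ^ d)" by (intro mult_right_mono C) auto
    finally show ?thesis by (metis of_nat_le_iff of_nat_mult)
  qed
  then show ?thesis by (rule that)
qed

text \<open>The description by \<open>THE\<close> is unique: a second candidate agrees with p at
  infinitely many integers.\<close>

lemma hilbert_poly_eqI:
  assumes "\<And>q. of_nat (hilbert_fun G c q) = Polynomial.poly p (of_nat q)"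
  shows "hilbert_poly G c = p"
  unfolding hilbert_poly_def
proof (rule the_equality)
  show "\<forall>\<^sub>F q in sequentially. of_nat (hilbert_fun G c q) = Polynomial.poly p (of_nat q)"
    using assms by simp
  fix p' :: "rat Polynomial.poly"
  assume "\<forall>\<^sub>F q in sequentially. of_nat (hilbert_fun G c q) = Polynomial.poly p' (of_nat q)"
  then obtain N where N: "\<And>q. q \<ge> N \<Longrightarrow> of_nat (hilbert_fun G c q) = Polynomial.poly p' (of_nat q)"
    by (auto simp: eventually_sequentially)
  have "infinite (of_nat ` {N..} :: rat set)"
    by (subst finite_image_iff) (auto simp: inj_on_def infinite_Ici)
  moreover have "of_nat ` {N..} \<subseteq> {x. Polynomial.poly (p' - p) x = 0}"
    using N assms by auto
  ultimately have "infinite {x. Polynomial.poly (p' - p) x = 0}" using finite_subset by blast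
  then have "p' - p = 0" using poly_roots_finite by blast
  then show "p' = p" by simp
qed

section \<open>Krull dimension\<close>

text \<open>Preimages of primes are prime, and surjectivity keeps the inclusions strict.\<close>

lemma krull_dim_le_hom:
  assumes h: "h \<in> ring_hom A B" and surj: "carrier B \<subseteq> h ` carrier A" and "cring A" "cring B"
  shows "krull_dim B \<le> krull_dim A"
  unfolding krull_dim_def
proof (rule Sup_mono, clarify)
  fix l p assume p: "\<forall>i\<le>l. primeideal (p i) B" "\<forall>i<l. p i \<subset> (p (Suc i) :: 'b set)"
  interpret ring_hom_ring A B h
    using assms by (intro ring_hom_ringI2) (auto simp: cring_def)
  define p' where "p' i = {r \<in> carrier A. h r \<in> p i}" for i
  have "\<forall>i\<le>l. primeideal (p' i) A"
    using p(1) primeideal_vimage[OF assms(3)] by (auto simp: p'_def)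
  moreover have "p' i \<subset> p' (Suc i)" if i: "i < l" for i
  proof -
    have sub: "p i \<subset> p (Suc i)" using p(2) i by blast
    then obtain b where b: "b \<in> p (Suc i)" "b \<notin> p i" by blast
    have "p (Suc i) \<subseteq> carrier B"
      using p(1) i by (meson Suc_leI additive_subgroup.a_subset ideal.axioms(1) primeideal.axioms(1))
    then obtain a where "a \<in> carrier A" "b = h a" using b surj by blast
    then have "a \<in> p' (Suc i)" "a \<notin> p' i" using b by (auto simp: p'_def)
    then show ?thesis using sub by (auto simp: p'_def)
  qed
  ultimately show "\<exists>a\<in>{enat l |l. \<exists>p. (\<forall>i\<le>l. primeideal (p i) A) \<and> (\<forall>i<l. p i \<subset> p (Suc i))}. enat l \<le> a"
    by blast
qed

lemma krull_dim_iso: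
  assumes "h \<in> ring_iso A B" "cring A" "cring B"
  shows "krull_dim B = krull_dim A"
proof (rule antisym)
  show "krull_dim B \<le> krull_dim A"
    by (rule krull_dim_le_hom[of h]) (use assms in \<open>auto simp: ring_iso_def bij_betw_def\<close>)
  have "inv_into (carrier A) h \<in> ring_iso B A"
    using ring_iso_set_sym[OF _ assms(1)] assms(2) by (simp add: cring_def)
  then show "krull_dim A \<le> krull_dim B"
    by (intro krull_dim_le_hom[of "inv_into (carrier A) h"]) (use assms in \<open>auto simp: ring_iso_def bij_betw_def\<close>)
qed

section \<open>Upper bound for chains of primes\<close>

definition powers :: "'a::comm_ring_1 list \<Rightarrow> nat list \<Rightarrow> 'a"
  where "powers xs rs = prod_list (map2 (\<lambda>x r. x ^ r) xs rs)"

lemma powers_Nil: "powers [] rs = 1" "powers xs [] = 1"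
  by (simp_all add: powers_def)

definition exps :: "nat \<Rightarrow> nat \<Rightarrow> nat list set"
  where "exps Q n = {rs. set rs \<subseteq> {..<Q} \<and> length rs = n}"

lemma exps_Suc: "exps Q (Suc n) = (\<lambda>(r, rs). r # rs) ` ({..<Q} \<times> exps Q n)"
  by (auto simp: exps_def length_Suc_conv image_iff)

lemma finite_exps: "finite (exps Q n)" and card_exps: "card (exps Q n) = Q ^ n"
  unfolding exps_def by (simp_all add: finite_lists_length_eq card_lists_length_eq)

context
  fixes S :: "'m::comm_monoid_add set"
  assumes S: "is_submonoid S"
begin

abbreviation (input) MA :: "('k::field, 'm \<Rightarrow>\<^sub>0 'k) module"
  where "MA \<equiv> monoid_alg S"

lemma MA_cring: "cring (MA :: ('k::field, 'm \<Rightarrow>\<^sub>0 'k) module)"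
  using alg_embedding_monoid_alg[OF S] by (rule alg_embedding.is_cring)

lemma MA_closed:
  fixes a b :: "'m \<Rightarrow>\<^sub>0 'k::field"
  shows "keys a \<subseteq> S \<Longrightarrow> keys b \<subseteq> S \<Longrightarrow> keys (a + b) \<subseteq> S"
    and "keys a \<subseteq> S \<Longrightarrow> keys b \<subseteq> S \<Longrightarrow> keys (a * b) \<subseteq> S"
    and "keys (single 0 c :: 'm \<Rightarrow>\<^sub>0 'k) \<subseteq> S" and "keys (1 :: 'm \<Rightarrow>\<^sub>0 'k) \<subseteq> S"
proof -
  interpret alg_embedding "MA :: ('k, 'm \<Rightarrow>\<^sub>0 'k) module" "\<lambda>p. p" "single 0"
    by (rule alg_embedding_monoid_alg[OF S])
  show "keys a \<subseteq> S \<Longrightarrow> keys b \<subseteq> S \<Longrightarrow> keys (a + b) \<subseteq> S"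
    and "keys a \<subseteq> S \<Longrightarrow> keys b \<subseteq> S \<Longrightarrow> keys (a * b) \<subseteq> S"
    using add_closed[of a b] mult_closed[of a b] by simp_all
  show "keys (1 :: 'm \<Rightarrow>\<^sub>0 'k) \<subseteq> S" using one_in by simp
  show "keys (single 0 c :: 'm \<Rightarrow>\<^sub>0 'k) \<subseteq> S" using S by (simp add: is_submonoid_def)
qed

lemma MA_sum_closed: "(\<And>i. i \<in> A \<Longrightarrow> keys (f i :: 'm \<Rightarrow>\<^sub>0 'k::field) \<subseteq> S) \<Longrightarrow> keys (\<Sum>i\<in>A. f i) \<subseteq> S"
  by (induction A rule: infinite_finite_induct) (simp_all add: MA_closed(1))

lemma MA_power_closed: "keys (x :: 'm \<Rightarrow>\<^sub>0 'k::field) \<subseteq> S \<Longrightarrow> keys (x ^ r) \<subseteq> S"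
  by (induction r) (simp_all only: power_0 power_Suc MA_closed)

lemma MA_prime:
  fixes p :: "('m \<Rightarrow>\<^sub>0 'k::field) set"
  assumes "primeideal p (MA :: ('k, 'm \<Rightarrow>\<^sub>0 'k) module)"
  shows "a \<in> p \<Longrightarrow> keys a \<subseteq> S" and "a \<in> p \<Longrightarrow> b \<in> p \<Longrightarrow> a + b \<in> p"
    and "a \<in> p \<Longrightarrow> keys x \<subseteq> S \<Longrightarrow> x * a \<in> p"
    and "keys a \<subseteq> S \<Longrightarrow> keys b \<subseteq> S \<Longrightarrow> a * b \<in> p \<Longrightarrow> a \<in> p \<or> b \<in> p"
    and "0 \<in> p" and "a \<in> p \<Longrightarrow> a + b \<in> p \<Longrightarrow> b \<in> p" and "1 \<notin> p"
proof -
  note I = primeideal.axioms(1)[OF assms]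
  note G = ideal.axioms(1)[OF I]
  show carr: "a \<in> p \<Longrightarrow> keys a \<subseteq> S" for a
    using ideal.Icarr[OF I, of a] by simp
  show add: "a \<in> p \<Longrightarrow> b \<in> p \<Longrightarrow> a + b \<in> p" for a b
    using additive_subgroup.a_closed[OF G, of a b] by simp
  show mult: "a \<in> p \<Longrightarrow> keys x \<subseteq> S \<Longrightarrow> x * a \<in> p" for a x
    using ideal.I_l_closed[OF I, of a x] by simp
  show "keys a \<subseteq> S \<Longrightarrow> keys b \<subseteq> S \<Longrightarrow> a * b \<in> p \<Longrightarrow> a \<in> p \<or> b \<in> p"
    using primeideal.I_prime[OF assms, of a b] by simp
  show "0 \<in> p"
    using additive_subgroup.zero_closed[OF G] by simp
  show "a \<in> p \<Longrightarrow> a + b \<in> p \<Longrightarrow> b \<in> p"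
  proof -
    assume "a \<in> p" "a + b \<in> p"
    then have "single 0 (-1) * a + (a + b) \<in> p" using add[OF mult[OF _ MA_closed(3)]] by blast
    moreover have "single 0 (-1) * a = - a" by (simp add: single_uminus)
    ultimately show "b \<in> p" by simp
  qed
  show "1 \<notin> p"
  proof
    assume "1 \<in> p"
    then have "carrier (MA :: ('k, 'm \<Rightarrow>\<^sub>0 'k) module) = p"
      using mult[of 1] carr by auto
    then show False using primeideal.I_notcarr[OF assms] by blast
  qed
qed

text \<open>Modulo p' only the term r = 0 survives, which kills \<open>w 0\<close>; then x can be
  cancelled modulo p, because p is prime and does not contain x. The hypothesis that
  \<open>w r\<close> vanishes once it lies in p' stands for the independence of the later elements
  of the chain modulo p'.\<close>

lemma power_step:
  fixes p p' :: "('m \<Rightarrow>\<^sub>0 'k::field) set" and w :: "nat \<Rightarrow> 'm \<Rightarrow>\<^sub>0 'k"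
  assumes p: "primeideal p MA" and p': "primeideal p' MA" and "p \<subseteq> p'" and x: "x \<in> p'" "x \<notin> p"
  shows "(\<And>r. keys (w r) \<subseteq> S) \<Longrightarrow> (\<And>r. w r \<in> p' \<Longrightarrow> w r = 0) \<Longrightarrow> (\<Sum>r<n. x ^ r * w r) \<in> p
    \<Longrightarrow> r < n \<Longrightarrow> w r = 0"
proof (induction n arbitrary: w r)
  case (Suc n)
  let ?T = "\<Sum>r<n. x ^ r * w (Suc r)"
  have xS: "keys x \<subseteq> S" using MA_prime(1)[OF p' x(1)] .
  have T: "keys ?T \<subseteq> S" by (intro MA_sum_closed MA_closed MA_power_closed xS Suc.prems(1))
  have eq: "(\<Sum>r<Suc n. x ^ r * w r) = w 0 + x * ?T"
    unfolding sum.lessThan_Suc_shift by (simp add: sum_distrib_left mult.assoc)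
  have "x * ?T \<in> p'" using MA_prime(3)[OF p' x(1) T] by (simp add: mult.commute)
  moreover have "x * ?T + w 0 \<in> p'"
    using subsetD[OF \<open>p \<subseteq> p'\<close> Suc.prems(3)] unfolding eq by (simp add: add.commute)
  ultimately have "w 0 \<in> p'" by (rule MA_prime(6)[OF p'])
  then have w0: "w 0 = 0" by (rule Suc.prems(2))
  then have "x * ?T \<in> p" using Suc.prems(3) unfolding eq by simp
  then have "?T \<in> p" using MA_prime(4)[OF p xS T] x(2) by blast
  then have "w (Suc r) = 0" if "r < n" for r
    using Suc.IH[of "\<lambda>r. w (Suc r)" r] Suc.prems(1,2) that by blast
  then show ?case using w0 Suc.prems(4) by (cases r) auto
qed simp

text \<open>Elements \<open>x\<^sub>i \<in> p\<^sub>i\<^sub>+\<^sub>1 \<setminus> p\<^sub>i\<close> of a chain of primes are algebraically independent modulo \<open>p\<^sub>0\<close>.\<close>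

lemma powers_independent:
  fixes p :: "nat \<Rightarrow> ('m \<Rightarrow>\<^sub>0 'k::field) set"
  assumes "\<And>i. i \<le> n \<Longrightarrow> primeideal (p i) MA" and "\<And>i. i < n \<Longrightarrow> p i \<subseteq> p (Suc i)"
    and "length xs = n" and "\<And>i. i < n \<Longrightarrow> xs ! i \<in> p (Suc i) - p i"
    and "(\<Sum>rs\<in>exps Q n. single 0 (c rs) * powers xs rs) \<in> p 0" and "rs \<in> exps Q n"
  shows "c rs = 0"
  using assms
proof (induction n arbitrary: p xs c rs)
  case 0
  have "exps Q 0 = {[]}" by (auto simp: exps_def)
  then have mem: "single 0 (c []) \<in> p 0" and rs: "rs = []"
    using 0 by (simp_all add: powers_def)
  show ?case
  proof (rule ccontr)
    assume "c rs \<noteq> 0"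
    moreover have "single 0 (inverse (c [])) * single 0 (c []) \<in> p 0"
      by (rule MA_prime(3)[OF 0(1) mem MA_closed(3)]) simp
    ultimately have "1 \<in> p 0" using rs by (simp add: mult_single)
    then show False using MA_prime(7)[OF 0(1)] by simp
  qed
next
  case (Suc n)
  obtain x ys where xs: "xs = x # ys" using Suc.prems(3) by (cases xs) auto
  obtain r0 rs0 where rs: "rs = r0 # rs0" "r0 < Q" "rs0 \<in> exps Q n"
    using Suc.prems(6) unfolding exps_Suc by auto
  have x: "x \<in> p 1" "x \<notin> p 0" using Suc.prems(4)[of 0] by (simp_all add: xs)
  have ys: "ys ! i \<in> p (Suc (Suc i)) - p (Suc i)" if "i < n" for i
    using Suc.prems(4)[of "Suc i"] that by (simp add: xs)
  define w where "w r = (\<Sum>rs\<in>exps Q n. single 0 (c (r # rs)) * powers ys rs)" for r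
  have IH: "c (r # rs) = 0" if "w r \<in> p 1" "rs \<in> exps Q n" for r rs
    by (rule Suc.IH[of "\<lambda>i. p (Suc i)" ys "\<lambda>rs. c (r # rs)"])
      (use Suc.prems that ys in \<open>auto simp: w_def xs\<close>)
  have ysS: "keys y \<subseteq> S" if "y \<in> set ys" for y
  proof -
    obtain i where "i < n" "y = ys ! i" using \<open>y \<in> set ys\<close> Suc.prems(3) by (auto simp: in_set_conv_nth xs)
    then show ?thesis using MA_prime(1)[OF Suc.prems(1)[of "Suc (Suc i)"]] ys[of i] by auto
  qed
  have pS: "keys (powers zs rs) \<subseteq> S" if "\<forall>y\<in>set zs. keys y \<subseteq> S" for zs :: "('m \<Rightarrow>\<^sub>0 'k) list" and rs
    using that unfolding powers_def
    by (induction zs rs rule: list_induct2') (simp_all add: MA_closed MA_power_closed S[unfolded is_submonoid_def])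
  have wS: "keys (w r) \<subseteq> S" for r
    unfolding w_def using ysS by (intro MA_sum_closed MA_closed pS) auto
  have "(\<Sum>rs\<in>exps Q (Suc n). single 0 (c rs) * powers xs rs)
      = (\<Sum>(r, rs)\<in>{..<Q} \<times> exps Q n. single 0 (c (r # rs)) * powers xs (r # rs))"
    unfolding exps_Suc by (subst sum.reindex) (auto simp: inj_on_def intro!: sum.cong)
  also have "\<dots> = (\<Sum>r<Q. \<Sum>rs\<in>exps Q n. single 0 (c (r # rs)) * powers xs (r # rs))"
    by (rule sum.cartesian_product[symmetric])
  also have "\<dots> = (\<Sum>r<Q. x ^ r * w r)"
    by (simp add: w_def sum_distrib_left xs powers_def ac_simps)
  finally have "(\<Sum>r<Q. x ^ r * w r) \<in> p 0" using Suc.prems(5) by simp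
  moreover have "w r = 0" if "w r \<in> p 1" for r
    unfolding w_def using IH[OF that] by (intro sum.neutral) auto
  ultimately have "w r0 = 0"
    using power_step[of "p 0" "p 1" x w Q r0] Suc.prems(1)[of 0] Suc.prems(1)[of 1] Suc.prems(2)[of 0] x wS rs(2)
    by auto
  then have "w r0 \<in> p 1" using MA_prime(5)[OF Suc.prems(1)[of 1]] by simp
  then show ?case using IH rs by blast
qed

end

lemma card_le_of_independent:
  fixes v :: "'i \<Rightarrow> 'm::comm_monoid_add \<Rightarrow>\<^sub>0 'k::field"
  assumes "finite T" "finite J" and keys: "\<And>i. i \<in> J \<Longrightarrow> keys (v i) \<subseteq> T"
    and indep: "\<And>c i. (\<Sum>i\<in>J. single 0 (c i) * v i) = 0 \<Longrightarrow> i \<in> J \<Longrightarrow> c i = (0::'k)"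
  shows "card J \<le> card T"
proof -
  interpret vs: vector_space "\<lambda>(c::'k) (b::'m \<Rightarrow>\<^sub>0 'k). single 0 c * b"
    by unfold_locales (simp_all add: algebra_simps single_add mult_single flip: mult.assoc)
  \<comment> \<open>Independence is assumed for the family; a repeated member would give a relation
    with coefficients 1 and -1. Only then can it be passed to the set of its members.\<close>
  have inj: "inj_on v J"
  proof (rule inj_onI, rule ccontr)
    fix i j assume ij: "i \<in> J" "j \<in> J" "v i = v j" "i \<noteq> j"
    define c where "c = (\<lambda>l. if l = i then 1 else if l = j then - 1 else (0::'k))"
    have "(\<Sum>l\<in>J. single 0 (c l) * v l) = (\<Sum>l\<in>{i, j}. single 0 (c l) * v l)"
      by (rule sum.mono_neutral_right) (use ij assms(2) in \<open>auto simp: c_def\<close>)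
    also have "\<dots> = 0" using ij by (simp add: c_def single_uminus)
    finally have "c i = 0" using indep ij by blast
    then show False by (simp add: c_def)
  qed
  have "vs.independent (v ` J)"
    unfolding vs.dependent_finite[OF finite_imageI[OF assms(2)]]
  proof clarify
    fix u i assume "(\<Sum>x\<in>v ` J. single 0 (u x) * x) = 0" "i \<in> J" "u (v i) \<noteq> 0"
    then show False using indep[of "\<lambda>i. u (v i)" i] inj by (simp add: sum.reindex)
  qed
  moreover have "v ` J \<subseteq> vs.span ((\<lambda>e. single e 1) ` T)"
  proof
    fix b assume "b \<in> v ` J"
    then have "keys b \<subseteq> T" using keys by blast
    then have "(\<Sum>e\<in>keys b. single 0 (lookup b e) * single e 1) \<in> vs.span ((\<lambda>e. single e 1) ` T)"
      by (intro vs.span_sum vs.span_scale vs.span_base) auto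
    moreover have "(\<Sum>e\<in>keys b. single 0 (lookup b e) * single e 1) = b"
      by (simp add: mult_single flip: poly_mapping_sum_single)
    ultimately show "b \<in> vs.span ((\<lambda>e. single e 1) ` T)" by simp
  qed
  ultimately have "card (v ` J) \<le> card ((\<lambda>e. single e (1::'k)) ` T)"
    using vs.independent_span_bound[of "(\<lambda>e. single e 1) ` T" "v ` J"] assms(1) by blast
  also have "\<dots> \<le> card T" by (rule card_image_le) fact
  finally show ?thesis using inj by (simp add: card_image)
qed

text \<open>A chain of length l gives Q^l independent monomials, with exponents below Q, whose
  weights are at most a constant times Q. They fit into a space whose dimension is of order Q^d, so
  l cannot exceed d.\<close>

lemma krull_chain_bound:
  fixes S :: "'m::comm_monoid_add set" and p :: "nat \<Rightarrow> ('m \<Rightarrow>\<^sub>0 'k::field) set"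
  assumes S: "is_submonoid S" and wt: "\<And>x y. wt (x + y) = wt x + (wt y :: nat)"
    and fin: "\<And>N. finite {e \<in> S. wt e \<le> N}" and card: "\<And>N. card {e \<in> S. wt e \<le> N} \<le> C * (N + 1) ^ d"
    and p: "\<And>i. i \<le> l \<Longrightarrow> primeideal (p i) (monoid_alg S :: ('k, 'm \<Rightarrow>\<^sub>0 'k) module)"
      "\<And>i. i < l \<Longrightarrow> p i \<subset> p (Suc i)"
  shows "l \<le> d"
proof (rule ccontr)
  assume "\<not> l \<le> d"
  have "\<forall>i. \<exists>x. i < l \<longrightarrow> x \<in> p (Suc i) - p i" using p(2) by blast
  then obtain x where x: "\<And>i. i < l \<Longrightarrow> x i \<in> p (Suc i) - p i" by metis
  have xS: "keys (x i) \<subseteq> S" if "i < l" for i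
    using MA_prime(1)[OF S p(1)[of "Suc i"]] x[OF that] that by auto
  define xs where "xs = map x [0..<l]"
  define E where "E = Max (insert 0 (\<Union>i<l. wt ` keys (x i)))"
  have E: "wt e \<le> E" if "e \<in> keys (x i)" "i < l" for e i
    unfolding E_def using that by (intro Max_ge) auto
  have wt0: "wt 0 = 0" using wt[of 0 0] by simp
  let ?V = "\<lambda>N. {b :: 'm \<Rightarrow>\<^sub>0 'k. keys b \<subseteq> {e \<in> S. wt e \<le> N}}"
  have V_mult: "a * b \<in> ?V (N + N')" if "a \<in> ?V N" "b \<in> ?V N'" for a b N N'
  proof -
    have "e \<in> S \<and> wt e \<le> N + N'" if e: "e \<in> keys (a * b)" for e
    proof -
      obtain f g where fg: "e = f + g" "f \<in> keys a" "g \<in> keys b" using e keys_mult[of a b] by blast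
      then have "f \<in> S" "g \<in> S" "wt f \<le> N" "wt g \<le> N'" using \<open>a \<in> ?V N\<close> \<open>b \<in> ?V N'\<close> by auto
      then show ?thesis using S fg(1) wt[of f g] by (auto simp: is_submonoid_def)
    qed
    then show ?thesis by blast
  qed
  have V_one: "1 \<in> ?V N" for N using S by (simp add: is_submonoid_def wt0 flip: single_one)
  have V_pow: "a ^ r \<in> ?V (r * N)" if "a \<in> ?V N" for a r N
  proof (induction r)
    case (Suc r)
    then show ?case using V_mult[OF that, of "a ^ r" "r * N"] by simp
  qed (simp only: power_0 V_one)
  have V_mono: "a \<in> ?V N \<Longrightarrow> N \<le> N' \<Longrightarrow> a \<in> ?V N'" for a N N' by fastforce
  have V_powers: "powers zs rs \<in> ?V (length zs * (Q * E))"
    if "\<forall>z\<in>set zs. z \<in> ?V E" "set rs \<subseteq> {..<Q}" for zs rs Q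
    using that
  proof (induction zs rs rule: list_induct2')
    case (4 z zs r rs)
    have "z ^ r \<in> ?V (Q * E)"
      using V_mono[OF V_pow[of z E r]] 4(2,3) by auto
    moreover have "powers zs rs \<in> ?V (length zs * (Q * E))" using 4 by auto
    ultimately have "z ^ r * powers zs rs \<in> ?V (Q * E + length zs * (Q * E))" by (rule V_mult)
    then show ?case by (simp add: powers_def)
  qed (simp_all only: powers_Nil V_one)
  have xsV: "\<forall>z\<in>set xs. z \<in> ?V E" 
  proof
    fix z assume "z \<in> set xs"
    then obtain i where "i < l" "z = x i" by (auto simp: xs_def)
    then show "z \<in> ?V E" using E xS[of i] by auto
  qed
  have len: "length xs = l" by (simp add: xs_def)
  have ineq: "Q ^ l \<le> C * (l * (Q * E) + 1) ^ d" for Q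
  proof -
    have "card (exps Q l) \<le> card {e \<in> S. wt e \<le> l * (Q * E)}"
    proof (rule card_le_of_independent[OF fin finite_exps])
      fix rs assume "rs \<in> exps Q l"
      then show "keys (powers xs rs) \<subseteq> {e \<in> S. wt e \<le> l * (Q * E)}"
        using V_powers[OF xsV, of rs Q] by (simp add: exps_def len)
    next
      fix c rs assume 0: "(\<Sum>rs\<in>exps Q l. single 0 (c rs) * powers xs rs) = 0" and rs: "rs \<in> exps Q l"
      show "c rs = (0::'k)"
      proof (rule powers_independent[OF S _ _ len _ _ rs])
        show "(\<Sum>rs\<in>exps Q l. single 0 (c rs) * powers xs rs) \<in> p 0"
          unfolding 0 using MA_prime(5)[OF S p(1)] by simp
      qed (use p x in \<open>auto simp: xs_def\<close>)
    qed
    then show ?thesis using card[of "l * (Q * E)"] by (simp add: card_exps)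
  qed
  \<comment> \<open>With Q = D + 1 the counting inequality gives Q^(d + 1) \<le> D * Q^d, since l *
    Q * E + 1 is at most (l * E + 1) * Q.\<close>
  let ?D = "C * (l * E + 1) ^ d"
  have "Suc ?D ^ Suc d \<le> Suc ?D ^ l" using \<open>\<not> l \<le> d\<close> by (intro power_increasing) auto
  also have "\<dots> \<le> C * (l * (Suc ?D * E) + 1) ^ d" by (rule ineq)
  also have "\<dots> \<le> C * ((l * E + 1) * Suc ?D) ^ d"
    by (intro mult_left_mono power_mono) (simp_all add: algebra_simps)
  also have "\<dots> = ?D * Suc ?D ^ d" by (simp only: power_mult_distrib mult.assoc)
  finally have "Suc ?D * Suc ?D ^ d \<le> ?D * Suc ?D ^ d" by simp
  then have "Suc ?D \<le> ?D" by (rule mult_right_le_imp_le) simp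
  then show False by simp
qed

section \<open>Monomial primes and the lower bound for the dimension\<close>

definition pm_of :: "nat multiset \<Rightarrow> nat \<Rightarrow>\<^sub>0 nat"
  where "pm_of M = Abs_poly_mapping (count M)"

lemma lookup_pm_of [simp]: "lookup (pm_of M) v = count M v"
proof -
  have "finite {x. count M x \<noteq> 0}" by (simp add: set_mset_def[symmetric] not_le)
  then show ?thesis by (simp add: pm_of_def)
qed

text \<open>Numbering the first family of variables by even and the second by odd numbers embeds the
  algebra in a polynomial algebra with variables indexed by numbers, which is a domain.\<close>

lemma bimon_no_zero_divisors:
  fixes f g :: "bimon \<Rightarrow>\<^sub>0 'k::field"
  assumes "f * g = 0"
  shows "f = 0 \<or> g = 0"
proof -
  interpret scalar_hom "\<lambda>c::'k. single (0 :: nat \<Rightarrow>\<^sub>0 nat) c" by (rule scalar_hom_single)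
  define enc :: "bimon \<Rightarrow> nat \<Rightarrow>\<^sub>0 nat" where
    "enc e = pm_of (image_mset (\<lambda>a. 2 * a) (fst e) + image_mset (\<lambda>b. 2 * b + 1) (snd e))" for e
  have add: "enc (e + e') = enc e + enc e'" for e e'
    by (rule poly_mapping_eqI) (simp add: enc_def lookup_add)
  have cnt: "lookup (enc e) (2 * a) = count (fst e) a" "lookup (enc e) (2 * a + 1) = count (snd e) a" for e a
  proof -
    have "count (image_mset (\<lambda>a. 2 * a) M) (2 * a) = count M a"
      "count (image_mset (\<lambda>a. 2 * a) M) (2 * a + 1) = 0"
      "count (image_mset (\<lambda>a. 2 * a + 1) M) (2 * a + 1) = count M a"
      "count (image_mset (\<lambda>a. 2 * a + 1) M) (2 * a) = 0" for M :: "nat multiset"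
      by (induction M) (auto, presburger+)
    then show "lookup (enc e) (2 * a) = count (fst e) a" "lookup (enc e) (2 * a + 1) = count (snd e) a"
      by (simp_all add: enc_def)
  qed
  have inj: "enc e = enc e' \<Longrightarrow> e = e'" for e e'
    by (rule prod_eqI; rule multiset_eqI) (metis cnt)+
  define h where "h = mlift (single 0) (\<lambda>e. single (enc e) (1::'k))"
  have look: "lookup (h p) (enc e) = lookup p e" for p e
  proof -
    have "enc m = enc e \<longleftrightarrow> m = e" for m using inj by blast
    then have "{m \<in> keys p. enc m = enc e} = (if e \<in> keys p then {e} else {})" by auto
    then show ?thesis
      using lookup_mlift_single[of enc p "enc e"] by (simp add: h_def in_keys_iff)
  qed
  have 0: "h p = 0 \<Longrightarrow> p = 0" for p
    by (rule poly_mapping_eqI) (metis look lookup_zero)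
  have "h (f * g) = h f * h g"
    unfolding h_def by (rule mlift_mult) (simp add: add mult_single)
  then have "h f * h g = 0" using assms by (simp add: h_def)
  then show ?thesis using 0 by auto
qed

text \<open>The primes spanned by the monomials that involve a variable outside of \<open>A\<close> and \<open>B\<close>.\<close>

definition face :: "nat set \<Rightarrow> nat set \<Rightarrow> bimon set"
  where "face A B = {e. set_mset (fst e) \<subseteq> A \<and> set_mset (snd e) \<subseteq> B}"

text \<open>The defining property of a face of a monoid; it makes the complement a prime ideal of
  the monoid.\<close>

lemma face_add: "e + e' \<in> face A B \<longleftrightarrow> e \<in> face A B \<and> e' \<in> face A B"
  by (auto simp: face_def)

text \<open>The quotient is the algebra of the face, which is a domain: the part of a product
  supported on the face is the product of the parts supported there.\<close>

lemma face_primeideal: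
  fixes S :: "bimon set" and A B :: "nat set"
  assumes S: "is_submonoid S"
  defines "p \<equiv> {b :: bimon \<Rightarrow>\<^sub>0 'k::field. keys b \<subseteq> S \<and> keys b \<inter> face A B = {}}"
  shows "primeideal p (monoid_alg S)"
proof (rule primeidealI2)
  interpret alg_embedding "monoid_alg S :: ('k, bimon \<Rightarrow>\<^sub>0 'k) module" "\<lambda>p. p" "single 0"
    by (rule alg_embedding_monoid_alg[OF S])
  show cr: "cring (monoid_alg S :: ('k, bimon \<Rightarrow>\<^sub>0 'k) module)" by (rule is_cring)
  show "additive_subgroup p (monoid_alg S)"
  proof (rule additive_subgroup.intro, rule group.subgroupI)
    show "group (add_monoid (monoid_alg S :: ('k, bimon \<Rightarrow>\<^sub>0 'k) module))"
      using cr by (intro abelian_group.a_group ring.is_abelian_group) (simp add: cring_def)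
    show "p \<subseteq> carrier (add_monoid (monoid_alg S))" by (auto simp: p_def)
    show "p \<noteq> {}" by (auto simp: p_def intro!: exI[of _ 0])
    fix a assume a: "a \<in> p"
    then have "\<ominus>\<^bsub>monoid_alg S\<^esub> a = - a" using h_a_inv[of a] by (simp add: p_def)
    then show "inv\<^bsub>add_monoid (monoid_alg S)\<^esub> a \<in> p"
      unfolding a_inv_def[symmetric] using a by (simp add: p_def)
    fix b assume "b \<in> p"
    then show "a \<otimes>\<^bsub>add_monoid (monoid_alg S)\<^esub> b \<in> p"
      using a Poly_Mapping.keys_add[of a b] by (auto simp: p_def)
  qed
  have mult: "a * b \<in> p" if "a \<in> p" "keys b \<subseteq> S" for a b
  proof -
    have "e \<in> S \<and> e \<notin> face A B" if e: "e \<in> keys (a * b)" for e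
    proof -
      obtain f g where fg: "e = f + g" "f \<in> keys a" "g \<in> keys b" using e keys_mult[of a b] by blast
      then have "f \<in> S" "g \<in> S" "f \<notin> face A B" using \<open>a \<in> p\<close> \<open>keys b \<subseteq> S\<close> by (auto simp: p_def)
      then show ?thesis using S fg(1) by (auto simp: is_submonoid_def face_add)
    qed
    then show ?thesis by (auto simp: p_def)
  qed
  show "\<And>a x. a \<in> p \<Longrightarrow> x \<in> carrier (monoid_alg S) \<Longrightarrow> a \<otimes>\<^bsub>monoid_alg S\<^esub> x \<in> p" using mult by simp
  show "\<And>a x. a \<in> p \<Longrightarrow> x \<in> carrier (monoid_alg S) \<Longrightarrow> x \<otimes>\<^bsub>monoid_alg S\<^esub> a \<in> p"
    using mult by (simp add: mult.commute)
  have "(1 :: bimon \<Rightarrow>\<^sub>0 'k) \<notin> p" by (simp add: p_def face_def flip: single_one)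
  then show "carrier (monoid_alg S) \<noteq> p" using one_in by auto
  fix a b :: "bimon \<Rightarrow>\<^sub>0 'k"
  assume a: "a \<in> carrier (monoid_alg S)" and b: "b \<in> carrier (monoid_alg S)"
    and ab: "a \<otimes>\<^bsub>monoid_alg S\<^esub> b \<in> p"
  define r where "r f = (\<Sum>e\<in>keys f \<inter> face A B. single e (lookup f e))" for f :: "bimon \<Rightarrow>\<^sub>0 'k"
  have look: "lookup (r f) e = (if e \<in> face A B then lookup f e else 0)" for f e
    by (auto simp: r_def lookup_sum lookup_single when_def in_keys_iff)
  have keys_r: "keys (r f) \<subseteq> face A B" for f by (auto simp: in_keys_iff look split: if_splits)
  have rest: "keys (f - r f) \<inter> face A B = {}" for f by (auto simp: in_keys_iff look lookup_minus)
  have in_face: "keys (f * g) \<inter> face A B = {}" if "keys f \<inter> face A B = {}" for f g :: "bimon \<Rightarrow>\<^sub>0 'k"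
  proof (rule equals0I)
    fix e assume e: "e \<in> keys (f * g) \<inter> face A B"
    then obtain x y where "e = x + y" "x \<in> keys f" using keys_mult[of f g] by blast
    then show False using e that by (auto simp: face_add)
  qed
  have eq: "a * b = r a * r b + ((a - r a) * b + (b - r b) * r a)" by (simp add: algebra_simps)
  have "lookup (r a * r b) e = 0" for e
  proof (cases "e \<in> face A B")
    case True
    have out: "lookup f e = 0" if "keys f \<inter> face A B = {}" for f :: "bimon \<Rightarrow>\<^sub>0 'k"
    proof -
      have "e \<notin> keys f" using that True by blast
      then show ?thesis by (simp add: in_keys_iff)
    qed
    have "lookup ((a - r a) * b) e = 0" "lookup ((b - r b) * r a) e = 0"
      by (rule out[OF in_face[OF rest]])+
    moreover have "lookup (a * b) e = 0"
      using ab by (intro out) (simp add: p_def)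
    ultimately show ?thesis using arg_cong[OF eq, of "\<lambda>f. lookup f e"] by (simp add: lookup_add)
  next
    case False
    have "keys (r a * r b) \<subseteq> face A B"
    proof
      fix e assume "e \<in> keys (r a * r b)"
      then obtain x y where "e = x + y" "x \<in> keys (r a)" "y \<in> keys (r b)"
        using keys_mult[of "r a" "r b"] by blast
      then show "e \<in> face A B" using keys_r[of a] keys_r[of b] by (auto simp: face_add)
    qed
    then show ?thesis using False by (auto simp: in_keys_iff)
  qed
  then have "r a * r b = 0" by (intro poly_mapping_eqI) simp
  then have "r a = 0 \<or> r b = 0" by (rule bimon_no_zero_divisors)
  moreover have "r f = 0 \<Longrightarrow> keys f \<inter> face A B = {}" for f using rest[of f] by simp
  ultimately show "a \<in> p \<or> b \<in> p" using a b by (auto simp: p_def)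
qed

lemma krull_dim_hibi:
  fixes \<gamma> :: "nat \<Rightarrow> nat \<times> nat"
  assumes L: "sublattice L" "finite L" and top: "\<alpha> \<in> L" "L \<subseteq> {..\<alpha>}"
    and exp: "binom_expansion (\<lambda>j. card (layer L j)) \<rho> c"
    and \<gamma>: "\<And>t. t \<le> \<rho> \<Longrightarrow> \<gamma> t \<in> L" "\<And>s t. s < t \<Longrightarrow> t \<le> \<rho> \<Longrightarrow> \<gamma> s < \<gamma> t"
  shows "krull_dim (monoid_alg (hibi_monoid L) :: ('k::field, bimon \<Rightarrow>\<^sub>0 'k) module) = enat (Suc \<rho>)"
proof (rule antisym)
  let ?S = "hibi_monoid L"
  note S = submonoid_hibi[of L]
  have LL: "L \<inter> {..\<alpha>} = L" using top by blast
  obtain C where C: "\<And>j. card (layer L j) \<le> C * (j + 1) ^ \<rho>" using binom_expansion_bound[OF exp] by blast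
  have layers: "{e \<in> ?S. biwt e \<le> N} = (\<Union>j\<le>N. layer L j)" for N by (auto simp: layer_def)
  have fin: "finite {e \<in> ?S. biwt e \<le> N}" for N
    unfolding layers using finite_layer_below[OF L, of \<alpha>] by (simp add: LL)
  \<comment> \<open>Summing the layers up to N raises the exponent by one; this is the step from the
    degree \<rho> of the Hilbert polynomial to the dimension \<rho> + 1.\<close>
  have card: "card {e \<in> ?S. biwt e \<le> N} \<le> C * (N + 1) ^ Suc \<rho>" for N
  proof -
    have "card {e \<in> ?S. biwt e \<le> N} \<le> (\<Sum>j\<le>N. card (layer L j))"
      unfolding layers by (rule card_UN_le) simp
    also have "\<dots> \<le> (\<Sum>j\<le>N. C * (N + 1) ^ \<rho>)"
      by (intro sum_mono order_trans[OF C] mult_left_mono power_mono) auto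
    finally show ?thesis by (simp add: algebra_simps)
  qed
  show "krull_dim (monoid_alg ?S :: ('k, bimon \<Rightarrow>\<^sub>0 'k) module) \<le> enat (Suc \<rho>)"
    unfolding krull_dim_def
  proof (rule Sup_least, clarify)
    fix l and p :: "nat \<Rightarrow> (bimon \<Rightarrow>\<^sub>0 'k) set"
    assume "\<forall>i\<le>l. primeideal (p i) (monoid_alg ?S)" "\<forall>i<l. p i \<subset> p (Suc i)"
    then show "enat l \<le> enat (Suc \<rho>)"
      using krull_chain_bound[OF S biwt_simps(1) fin card, of l p] by simp
  qed
  \<comment> \<open>Coordinates lying below one of the first t chain elements. The faces grow with
    t, so the ideals are numbered backwards by \<open>Suc \<rho> - i\<close>.\<close>
  define A where "A t = {x. \<exists>s<t. x \<le> fst (\<gamma> s)}" for t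
  define B where "B t = {y. \<exists>s<t. y \<le> snd (\<gamma> s)}" for t
  define p where "p i = {b :: bimon \<Rightarrow>\<^sub>0 'k. keys b \<subseteq> ?S \<and> keys b \<inter> face (A (Suc \<rho> - i)) (B (Suc \<rho> - i)) = {}}" for i
  have "primeideal (p i) (monoid_alg ?S)" for i
    unfolding p_def by (rule face_primeideal[OF S])
  moreover have "p i \<subset> p (Suc i)" if i: "i < Suc \<rho>" for i
  proof
    obtain t where t: "Suc \<rho> - i = Suc t" "Suc \<rho> - Suc i = t" "t \<le> \<rho>" using i by (metis Suc_diff_Suc Suc_diff_le diff_le_self diff_Suc_Suc less_Suc_eq_le)
    have pi: "p i = {b. keys b \<subseteq> ?S \<and> keys b \<inter> face (A (Suc t)) (B (Suc t)) = {}}"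
      "p (Suc i) = {b. keys b \<subseteq> ?S \<and> keys b \<inter> face (A t) (B t) = {}}"
      unfolding p_def t by (rule refl)+
    have "face (A t) (B t) \<subseteq> face (A (Suc t)) (B (Suc t))"
      by (auto simp: face_def A_def B_def less_Suc_eq) 
    then show "p i \<subseteq> p (Suc i)" unfolding pi by blast
    let ?e = "({#fst (\<gamma> t)#}, {#snd (\<gamma> t)#})"
    have "?e \<in> ?S" using \<gamma>(1)[OF t(3)] by (intro hibi_monoid_single) simp
    moreover have "?e \<in> face (A (Suc t)) (B (Suc t))" by (auto simp: face_def A_def B_def)
    \<comment> \<open>The monomial of \<open>\<gamma> t\<close> is the new one: if both its
      coordinates were bounded by earlier chain elements, then \<open>\<gamma> t\<close> would lie
      below the later of the two.\<close>
    moreover have "?e \<notin> face (A t) (B t)"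
    proof
      assume "?e \<in> face (A t) (B t)"
      then obtain s s' where s: "s < t" "fst (\<gamma> t) \<le> fst (\<gamma> s)" "s' < t" "snd (\<gamma> t) \<le> snd (\<gamma> s')"
        by (auto simp: face_def A_def B_def)
      have "\<gamma> s < \<gamma> t" "\<gamma> s' < \<gamma> t" "\<gamma> s \<le> \<gamma> (max s s')" "\<gamma> s' \<le> \<gamma> (max s s')" "\<gamma> (max s s') < \<gamma> t"
        using \<gamma>(2)[of s t] \<gamma>(2)[of s' t] \<gamma>(2)[of s s'] \<gamma>(2)[of s' s] s t(3)
        by (auto simp: max_def not_le order.order_iff_strict)
      then show False using s by (auto simp: less_le_not_le less_eq_prod_def)
    qed
    ultimately have "single ?e 1 \<in> p (Suc i)" "single ?e 1 \<notin> p i" by (auto simp: pi)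
    then show "p i \<noteq> p (Suc i)" by blast
  qed
  ultimately show "enat (Suc \<rho>) \<le> krull_dim (monoid_alg ?S :: ('k, bimon \<Rightarrow>\<^sub>0 'k) module)"
    unfolding krull_dim_def by (intro Sup_upper) blast
qed

section \<open>Cones\<close>

lemma lookup_scaleR [simp]: "lookup (c *\<^sub>R v) z = c * lookup (v :: 'z \<Rightarrow>\<^sub>0 real) z"
proof -
  have "finite {i. c * lookup v i \<noteq> 0}"
    by (rule finite_subset[of _ "keys v"]) (auto simp: in_keys_iff)
  then show ?thesis by (simp add: scaleR_poly_mapping_def)
qed

lemma lookup_lattice_vec [simp]: "lookup (lattice_vec v) z = real_of_int (lookup v z)"
  by (simp add: lattice_vec_def Poly_Mapping.map.rep_eq when_def)

lemma keys_lattice_vec [simp]: "keys (lattice_vec v) = keys v"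
  by (auto simp: in_keys_iff)

lemma pairing_superset:
  assumes "finite A" "keys v \<subseteq> A"
  shows "pairing u v = (\<Sum>z\<in>A. lookup u z * lookup v z)"
  unfolding pairing_def by (rule sum.mono_neutral_left) (use assms in \<open>auto simp: in_keys_iff\<close>)

lemma pairing_add: "pairing u (v + w) = pairing u v + pairing u w"
proof -
  let ?A = "keys v \<union> keys w"
  have "keys (v + w) \<subseteq> ?A" by (rule Poly_Mapping.keys_add)
  then show ?thesis
    by (subst (1 2 3) pairing_superset[of ?A]) (auto simp: lookup_add algebra_simps sum.distrib)
qed

lemma pairing_scaleR: "pairing u (c *\<^sub>R v) = c * pairing u v"
proof -
  have "keys (c *\<^sub>R v) \<subseteq> keys v" by (auto simp: in_keys_iff)
  then show ?thesis
    by (subst pairing_superset[of "keys v"]) (auto simp: pairing_def sum_distrib_left algebra_simps)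
qed

lemma pairing_uminus: "pairing u (- v) = - pairing u v"
  using pairing_scaleR[of u "-1" v] by simp

lemma pairing_zero [simp]: "pairing u 0 = 0"
  by (simp add: pairing_def)

lemma pairing_single [simp]: "pairing u (single z 1) = lookup u z"
  by (simp add: pairing_def)

lemma pairing_diff [simp]: "pairing u (single y 1 - single z 1) = lookup u y - lookup u z"
  using pairing_add[of u "single y 1" "- single z 1"] by (simp add: pairing_uminus)

lemma lattice_vec_single [simp]: "lattice_vec (single z 1) = single z 1"
  by (rule poly_mapping_eqI) (simp add: lookup_single when_def)

lemma lattice_vec_diff [simp]: "lattice_vec (single y 1 - single z 1) = single y 1 - single z 1"
  by (rule poly_mapping_eqI) (simp add: lookup_minus lookup_single when_def)

lemma hull_subset_cone:
  fixes G :: "('z \<Rightarrow>\<^sub>0 real) set"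
  assumes "G \<subseteq> C" and "0 \<in> C" and "\<And>x y. x \<in> C \<Longrightarrow> y \<in> C \<Longrightarrow> x + y \<in> C"
    and "\<And>x c. x \<in> C \<Longrightarrow> 0 \<le> c \<Longrightarrow> c *\<^sub>R x \<in> C"
  shows "convex_cone hull G \<subseteq> C"
  by (rule hull_minimal[OF assms(1)]) (auto simp: convex_cone_iff assms)

lemma dual_cone_hull:
  "dual_cone J (convex_cone hull G) = {u. keys u \<subseteq> J \<and> (\<forall>g\<in>G. 0 \<le> pairing u g)}"
proof -
  have "(\<forall>v\<in>convex_cone hull G. 0 \<le> pairing u v) \<longleftrightarrow> (\<forall>g\<in>G. 0 \<le> pairing u g)" for u
  proof
    assume "\<forall>g\<in>G. 0 \<le> pairing u g"
    then have "convex_cone hull G \<subseteq> {v. 0 \<le> pairing u v}"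
      by (intro hull_subset_cone) (auto simp: pairing_add pairing_scaleR)
    then show "\<forall>v\<in>convex_cone hull G. 0 \<le> pairing u v" by blast
  qed (auto intro: hull_inc)
  then show ?thesis by (simp add: dual_cone_def)
qed

text \<open>On the cone u is nonnegative, so u vanishes on a sum only if it vanishes on both terms.
  The set \<open>?C\<close> carries this alternative through the hull.\<close>

lemma face_subset_span:
  assumes "\<And>g. g \<in> G \<Longrightarrow> 0 \<le> pairing u g"
  shows "{v \<in> convex_cone hull G. pairing u v = 0} \<subseteq> span {g \<in> G. pairing u g = 0}"
proof -
  let ?C = "{v. 0 \<le> pairing u v \<and> (pairing u v = 0 \<longrightarrow> v \<in> span {g \<in> G. pairing u g = 0})}"
  have "convex_cone hull G \<subseteq> ?C"
  proof (rule hull_subset_cone)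
    show "G \<subseteq> ?C" using assms by (auto intro: span_base)
    fix x y assume "x \<in> ?C" "y \<in> ?C"
    then show "x + y \<in> ?C" by (auto simp: pairing_add add_nonneg_eq_0_iff intro: span_add)
  next
    fix x and c :: real assume x: "x \<in> ?C" "0 \<le> c"
    have "c *\<^sub>R x \<in> span {g \<in> G. pairing u g = 0}" if "c * pairing u x = 0"
      using that x by (cases "c = 0") (auto intro: span_scale span_zero)
    then show "c *\<^sub>R x \<in> ?C" using x by (simp add: pairing_scaleR)
  qed (auto intro: span_zero)
  then show ?thesis by blast
qed

text \<open>A functional positive on all generators is positive on every nonzero element of the
  cone, so the cone contains no line.\<close>

lemma strongly_convex_hull:
  assumes "\<And>g. g \<in> G \<Longrightarrow> 0 < pairing u g"
  shows "strongly_convex (convex_cone hull G)"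
proof -
  let ?C = "{v. v = 0 \<or> 0 < pairing u v}"
  have "convex_cone hull G \<subseteq> ?C"
  proof (rule hull_subset_cone)
    fix x and c :: real assume "x \<in> ?C" "0 \<le> c"
    then show "c *\<^sub>R x \<in> ?C" by (cases "c = 0") (auto simp: pairing_scaleR)
  qed (use assms in \<open>auto simp: pairing_add\<close>)
  then have "v = 0 \<or> 0 < pairing u v" if "v \<in> convex_cone hull G" for v using that by blast
  from this this[of "- _"] show ?thesis unfolding strongly_convex_def
    by (metis neg_0_less_iff_less neg_equal_0_iff_equal order_less_asym pairing_uminus)
qed

lemma single_key_inject: "single x (1::real) = single y 1 \<Longrightarrow> x = y"
  by (metis lookup_single_eq lookup_single_not_eq zero_neq_one)

text \<open>Each vector is 1 in the coordinate of its own index, where the others are 0.\<close>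

lemma independent_singles: "independent ((\<lambda>z. single z 1) ` B :: ('z \<Rightarrow>\<^sub>0 real) set)"
  and independent_single_diffs: "w \<notin> B \<Longrightarrow> independent ((\<lambda>z. single z 1 - single w 1) ` B :: ('z \<Rightarrow>\<^sub>0 real) set)"
proof -
  have ind: "independent (f ` B)" if f: "\<And>z z'. z \<in> B \<Longrightarrow> z' \<in> B \<Longrightarrow> lookup (f z) z' = (if z = z' then 1 else 0)"
    for f :: "'z \<Rightarrow> 'z \<Rightarrow>\<^sub>0 real"
    unfolding independent_explicit_module
  proof (intro allI impI)
    fix t u v assume t: "finite t" "t \<subseteq> f ` B" and s: "(\<Sum>v\<in>t. u v *\<^sub>R v) = 0" and "v \<in> t"
    then obtain z where z: "z \<in> B" "v = f z" by blast
    have "0 = (\<Sum>v\<in>t. u v * lookup v z)"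
      using arg_cong[OF s, of "\<lambda>p. lookup p z"] by (simp add: lookup_sum)
    also have "\<dots> = (\<Sum>v'\<in>t. if v' = v then u v else 0)"
    proof (rule sum.cong)
      fix v' assume "v' \<in> t"
      then obtain z' where z': "z' \<in> B" "v' = f z'" using t by blast
      show "u v' * lookup v' z = (if v' = v then u v else 0)"
      proof (cases "z' = z")
        case True
        then show ?thesis using f[OF z(1) z(1)] z z' by simp
      next
        case False
        then have "lookup v' z = 0" "lookup v z = 1" using f[OF z'(1) z(1)] f[OF z(1) z(1)] z z' by simp_all
        then show ?thesis by auto
      qed
    qed simp
    finally show "u v = 0" using t \<open>v \<in> t\<close> by simp
  qed
  show "independent ((\<lambda>z. single z 1) ` B :: ('z \<Rightarrow>\<^sub>0 real) set)"
    by (rule ind) (simp add: lookup_single when_def)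
  show "w \<notin> B \<Longrightarrow> independent ((\<lambda>z. single z 1 - single w 1) ` B :: ('z \<Rightarrow>\<^sub>0 real) set)"
    by (rule ind) (auto simp: lookup_minus lookup_single when_def)
qed

lemma dim_eqI:
  assumes "V \<subseteq> span B" "B \<subseteq> span V" "independent B"
  shows "dim V = card B"
  using assms by (metis dim_eq_card_independent dim_span span_eq)

section \<open>The cone of the Grassmannian of lines\<close>

text \<open>An element (a, b) with 2 \<le> a and a + 2 \<le> b is the join of (a - 1, b) and (a, b -
  1); all others lie on the chain of the (1, b) or on the diagonal of the (a, a + 1).\<close>

lemma join_irreducibles_I2:
  "join_irreducibles (I2 n) = {(1, b) | b. 2 \<le> b \<and> b \<le> n} \<union> {(a, a + 1) | a. 2 \<le> a \<and> a < n}" (is "_ = ?J")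
proof (intro equalityI subsetI)
  fix z assume z: "z \<in> join_irreducibles (I2 n)"
  obtain a b where ab: "z = (a, b)" by (cases z)
  have I: "1 \<le> a" "a < b" "b \<le> n" using z by (auto simp: ab join_irreducibles_def I2_def)
  show "z \<in> ?J"
  proof (rule ccontr)
    assume "z \<notin> ?J"
    then have c: "2 \<le> a" "a + 2 \<le> b" using I by (auto simp: ab)
    have "(a - 1, b) \<in> I2 n" "(a, b - 1) \<in> I2 n" "z = sup (a - 1, b) (a, b - 1)"
      using I c by (auto simp: I2_def ab sup_prod_def sup_nat_def)
    then have "z = (a - 1, b) \<or> z = (a, b - 1)" using z unfolding join_irreducibles_def by blast
    then show False using c by (auto simp: ab)
  qed
next
  fix z assume z: "z \<in> ?J"
  have "z = x \<or> z = y" if xy: "x \<in> I2 n" "y \<in> I2 n" "z = sup x y" for x y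
    using z xy by (cases x; cases y) (auto simp: I2_def sup_prod_def sup_nat_def max_def split: if_splits)
  moreover have "z \<in> I2 n" using z by (auto simp: I2_def)
  ultimately show "z \<in> join_irreducibles (I2 n)" unfolding join_irreducibles_def by blast
qed

context
  fixes n :: nat
  assumes n: "4 \<le> n"
begin

abbreviation (input) "J \<equiv> join_irreducibles (I2 n)"

lemma J_cases:
  assumes "z \<in> J"
  obtains b where "z = (1, b)" "2 \<le> b" "b \<le> n" | a where "z = (a, a + 1)" "2 \<le> a" "a < n"
  using assms unfolding join_irreducibles_I2 by blast

lemma J_mem: "2 \<le> b \<Longrightarrow> b \<le> n \<Longrightarrow> (1, b) \<in> J" "2 \<le> a \<Longrightarrow> a < n \<Longrightarrow> (a, a + 1) \<in> J"
  unfolding join_irreducibles_I2 by blast+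

lemma card_J: "finite J" "card J = 2 * n - 3"
proof -
  have J: "J = (\<lambda>b. (1, b)) ` {2..n} \<union> (\<lambda>a. (a, a + 1)) ` {2..<n}"
    unfolding join_irreducibles_I2 by auto
  have "card J = card ((\<lambda>b. (1::nat, b)) ` {2..n}) + card ((\<lambda>a. (a, a + 1)) ` {2..<n})"
    unfolding J by (rule card_Un_disjoint) auto
  also have "\<dots> = (n - 1) + (n - 2)"
    by (subst (1 2) card_image) (auto simp: inj_on_def)
  finally show "card J = 2 * n - 3" using n by simp
  show "finite J" unfolding J by simp
qed

lemma max_J: "z \<in> J \<Longrightarrow> z \<le> (n - 1, n)"
  by (erule J_cases) (use n in \<open>auto simp: less_eq_prod_def\<close>)

lemma max_J_iff: "z \<in> J \<and> \<not> (\<exists>w\<in>J. z < w) \<longleftrightarrow> z = (n - 1, n)"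
proof
  have m: "(n - 1, n) \<in> J" using J_mem(2)[of "n - 1"] n by simp
  show "z \<in> J \<and> \<not> (\<exists>w\<in>J. z < w) \<Longrightarrow> z = (n - 1, n)"
    using max_J m by (metis order.not_eq_order_implies_strict)
  show "z = (n - 1, n) \<Longrightarrow> z \<in> J \<and> \<not> (\<exists>w\<in>J. z < w)"
    using max_J m by (metis order.strict_iff_not)
qed

definition gens :: "(nat \<times> nat \<Rightarrow>\<^sub>0 real) set"
  where "gens = insert (single (n - 1, n) 1) {single y' 1 - single y 1 | y y'. covers_in J y y'}"

lemma hibi_cone_eq: "hibi_cone (I2 n) = convex_cone hull gens"
proof -
  have "{single z (1::real) | z. z \<in> J \<and> \<not> (\<exists>w\<in>J. z < w)} = {single (n - 1, n) 1}"
    unfolding max_J_iff by blast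
  then show ?thesis by (simp add: hibi_cone_def gens_def Let_def)
qed

lemma covers_chain: "2 \<le> b \<Longrightarrow> b < n \<Longrightarrow> covers_in J (1, b + 1) (1, b)"
  unfolding covers_in_def
proof (intro conjI notI)
  assume b: "2 \<le> b" "b < n"
  assume "\<exists>z\<in>J. (1, b) < z \<and> z < (1, b + 1)"
  then obtain z where "z \<in> J" "(1, b) < z" "z < (1, b + 1)" by blast
  then show False by (cases z) (auto simp: less_le_not_le less_eq_prod_def)
qed (auto simp: J_mem[simplified] less_le_not_le less_eq_prod_def intro: J_mem)

lemma covers_diag: "2 \<le> a \<Longrightarrow> a < n \<Longrightarrow> covers_in J (a, a + 1) (1, a + 1)"
  unfolding covers_in_def
proof (intro conjI notI)
  assume a: "2 \<le> a" "a < n"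
  assume "\<exists>z\<in>J. (1, a + 1) < z \<and> z < (a, a + 1)"
  then obtain z where z: "z \<in> J" "(1, a + 1) < z" "z < (a, a + 1)" by blast
  from z(1) show False
    by (rule J_cases) (use z(2,3) in \<open>auto simp: less_le_not_le less_eq_prod_def\<close>)
qed (auto simp: less_le_not_le less_eq_prod_def intro: J_mem[simplified])

lemma gens_chain: "2 \<le> b \<Longrightarrow> b < n \<Longrightarrow> single (1, b) 1 - single (1, b + 1) 1 \<in> gens"
  and gens_diag: "2 \<le> a \<Longrightarrow> a < n \<Longrightarrow> single (1, a + 1) 1 - single (a, a + 1) 1 \<in> gens"
  unfolding gens_def using covers_chain covers_diag by blast+

text \<open>The differences along the chain (1, b), and from (1, a + 1) to (a, a + 1), form a
  spanning tree of J. Together with the basis vector of the maximal element they generate every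
  basis vector.\<close>

lemma dim_hibi_cone: "dim (hibi_cone (I2 n)) = 2 * n - 3"
proof -
  let ?B = "(\<lambda>z. single z (1::real)) ` J"
  have "dim (hibi_cone (I2 n)) = card ?B"
  proof (rule dim_eqI)
    have "gens \<subseteq> span ?B"
    proof
      fix g assume "g \<in> gens"
      then consider "g = single (n - 1, n) 1" | y y' where "g = single y' 1 - single y 1" "y \<in> J" "y' \<in> J"
        by (auto simp: gens_def covers_in_def)
      then show "g \<in> span ?B"
        using max_J_iff[of "(n - 1, n)"] by cases (auto intro!: span_diff intro: span_base)
    qed
    then show "hibi_cone (I2 n) \<subseteq> span ?B"
      unfolding hibi_cone_eq by (intro hull_subset_cone) (auto intro: span_zero span_add span_scale)
    have g: "g \<in> span (hibi_cone (I2 n))" if "g \<in> gens" for g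
      unfolding hibi_cone_eq using that by (intro span_base hull_inc)
    have max: "single (n - 1, n) 1 \<in> span (hibi_cone (I2 n))" by (rule g) (simp add: gens_def)
    have diag: "single (1, a + 1) 1 \<in> span (hibi_cone (I2 n)) \<longleftrightarrow> single (a, a + 1) 1 \<in> span (hibi_cone (I2 n))"
      if "2 \<le> a" "a < n" for a
      using span_add[OF g[OF gens_diag[OF that]], of "single (a, a + 1) 1"]
        span_diff[OF _ g[OF gens_diag[OF that]], of "single (1, a + 1) 1"] by auto
    have chain: "single (1, b) 1 \<in> span (hibi_cone (I2 n))" if "2 \<le> b" "b \<le> n" for b
      using that(2,1)
    proof (induction b rule: inc_induct)
      case base
      then show ?case using diag[of "n - 1"] max n by simp
    next
      case (step b)
      then show ?case using span_add[OF g[OF gens_chain[of b]], of "single (1, b + 1) 1"] by simp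
    qed
    show "?B \<subseteq> span (hibi_cone (I2 n))"
    proof clarify
      fix z assume "z \<in> J"
      then show "single z 1 \<in> span (hibi_cone (I2 n))"
        by (rule J_cases) (use chain diag in auto)
    qed
  qed (rule independent_singles)
  also have "\<dots> = card J" by (rule card_image) (meson inj_onI single_key_inject)
  finally show ?thesis by (simp add: card_J)
qed

section \<open>Order ideals of J and faces of the Hibi cone\<close>

lemma lookup_f_ideal: "lookup (f_ideal (I2 n) \<alpha>) z = (if z \<in> J \<and> z \<le> \<alpha> then 1 else 0)"
proof -
  have "finite {z \<in> J. z \<le> \<alpha>}" using card_J(1) by simp
  then show ?thesis by (simp add: f_ideal_def lookup_sum lookup_single when_def)
qed

text \<open>A superlevel set of a functional in the dual cone is an order ideal of \<open>J\<close>.\<close>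

lemma level_set:
  assumes u: "\<And>g. g \<in> gens \<Longrightarrow> 0 \<le> pairing u g" and y: "y \<in> J" "c \<le> lookup u y"
  shows "\<exists>\<alpha>\<in>I2 n. \<forall>z\<in>J. z \<le> \<alpha> \<longleftrightarrow> c \<le> lookup u z"
proof -
  have u_chain: "lookup u (1, Suc b) \<le> lookup u (1, b)" if "2 \<le> b" "b < n" for b
    using u[OF gens_chain[OF that]] by simp
  have u_diag: "lookup u (a, a + 1) \<le> lookup u (1, a + 1)" if "2 \<le> a" "a < n" for a
    using u[OF gens_diag[OF that]] by simp
  have u_diag2: "lookup u (Suc a, Suc (Suc a)) \<le> lookup u (a, Suc a)" if a: "2 \<le> a" "Suc a < n" for a
  proof -
    have "covers_in J (Suc a, Suc (Suc a)) (a, Suc a)"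
      unfolding covers_in_def
    proof (intro conjI notI)
      assume "\<exists>z\<in>J. (a, Suc a) < z \<and> z < (Suc a, Suc (Suc a))"
      then obtain z where z: "z \<in> J" "(a, Suc a) < z" "z < (Suc a, Suc (Suc a))" by blast
      from z(1) show False
        by (rule J_cases) (use z(2,3) a in \<open>auto simp: less_le_not_le less_eq_prod_def\<close>)
    qed (use a J_mem(2)[of a] J_mem(2)[of "Suc a"] in \<open>auto simp: less_le_not_le less_eq_prod_def\<close>)
    then have "single (a, Suc a) 1 - single (Suc a, Suc (Suc a)) 1 \<in> gens" unfolding gens_def by blast
    from u[OF this] show ?thesis by simp
  qed
  have anti_chain: "lookup u (1, b') \<le> lookup u (1, b)" if "2 \<le> b" "b \<le> b'" "b' \<le> n" for b b'
    using that(2,3)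
  proof (induction b' rule: dec_induct)
    case (step j)
    then show ?case using u_chain[of j] that(1) by simp
  qed simp
  have anti_diag: "lookup u (a', a' + 1) \<le> lookup u (a, a + 1)" if "2 \<le> a" "a \<le> a'" "a' < n" for a a'
    using that(2,3)
  proof (induction a' rule: dec_induct)
    case (step j)
    then show ?case using u_diag2[of j] that(1) by simp
  qed simp
  define B where "B = {b \<in> {2..n}. c \<le> lookup u (1, b)}"
  \<comment> \<open>The 1 stands for the absence of diagonal elements; the ideal then lies in the
    chain of the (1, b).\<close>
  define A where "A = insert 1 {a \<in> {2..<n}. c \<le> lookup u (a, a + 1)}"
  have "B \<noteq> {}" using y(1)
  proof (rule J_cases)
    fix a assume a: "y = (a, a + 1)" "2 \<le> a" "a < n"
    then have "a + 1 \<in> B" using y(2) u_diag[of a] by (simp add: B_def)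
    then show ?thesis by blast
  qed (use y(2) in \<open>auto simp: B_def\<close>)
  then have B: "Max B \<in> B" by (intro Max_in) (simp_all add: B_def)
  have A: "Max A \<in> A" by (intro Max_in) (simp_all add: A_def)
  have Ale: "a \<le> Max A" if "a \<in> A" for a using that by (intro Max_ge) (simp_all add: A_def)
  have Ble: "b \<le> Max B" if "b \<in> B" for b using that by (intro Max_ge) (simp_all add: B_def)
  have B_iff: "b \<le> Max B \<longleftrightarrow> c \<le> lookup u (1, b)" if "2 \<le> b" "b \<le> n" for b
    using B Ble[of b] anti_chain[of b "Max B"] that by (auto simp: B_def)
  have A_imp: "a + 1 \<in> B" if "a \<in> A" "2 \<le> a" for a
    using that u_diag[of a] by (auto simp: A_def B_def)
  have A_iff: "a \<le> Max A \<longleftrightarrow> c \<le> lookup u (a, a + 1)" if "2 \<le> a" "a < n" for a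
  proof
    assume "a \<le> Max A"
    then have "Max A \<in> {a \<in> {2..<n}. c \<le> lookup u (a, a + 1)}" using A that by (auto simp: A_def)
    then show "c \<le> lookup u (a, a + 1)" using anti_diag[of a "Max A"] that \<open>a \<le> Max A\<close> by auto
  next
    assume "c \<le> lookup u (a, a + 1)"
    then show "a \<le> Max A" using that by (intro Ale) (simp add: A_def)
  qed
  have AB: "Max A < Max B"
  proof (cases "Max A = 1")
    case True
    then show ?thesis using B by (simp add: B_def)
  next
    case False
    then have "2 \<le> Max A" using A by (simp add: A_def)
    then show ?thesis using Ble[OF A_imp[OF A]] by simp
  qed
  show ?thesis
  proof (intro bexI[of _ "(Max A, Max B)"] ballI)
    show "(Max A, Max B) \<in> I2 n" using A B AB by (auto simp: I2_def A_def B_def)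
    have A1: "1 \<le> Max A" using Ale[of 1] by (simp add: A_def)
    fix z assume "z \<in> J"
    then show "z \<le> (Max A, Max B) \<longleftrightarrow> c \<le> lookup u z"
    proof (rule J_cases)
      fix b assume "z = (1, b)" "2 \<le> b" "b \<le> n"
      then show ?thesis using B_iff[of b] A1 by (simp add: less_eq_prod_def)
    next
      fix a assume a: "z = (a, a + 1)" "2 \<le> a" "a < n"
      have "a + 1 \<le> Max B" if "a \<le> Max A"
        using AB that by simp
      then show ?thesis using A_iff[OF a(2,3)] a by (auto simp: less_eq_prod_def)
    qed
  qed
qed

text \<open>The generator belonging to a cover y of y' lies in \<tau> exactly if no \<alpha> with
  nonzero coordinate at P contains y' without y. This expresses the dimension of \<tau> through the
  set of nonzero coordinates; the condition at (n - 1, n) excludes the generator of the maximal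
  element of J.\<close>

lemma face_gens:
  fixes P :: "nat \<times> nat \<Rightarrow> 'k::field"
  assumes face: "cone_face J (hibi_cone (I2 n)) \<tau>" and P: "P = face_point (I2 n) \<tau>"
    and top: "P (n - 1, n) \<noteq> 0"
  defines "G0 \<equiv> {single y' (1::real) - single y 1 | y y'. covers_in J y y' \<and>
    (\<forall>\<alpha>\<in>I2 n. P \<alpha> \<noteq> 0 \<longrightarrow> y' \<le> \<alpha> \<longrightarrow> y \<le> \<alpha>)}"
  shows "dim \<tau> = dim G0"
proof -
  obtain u where u: "u \<in> dual_cone J (hibi_cone (I2 n))" and \<tau>: "\<tau> = {v \<in> hibi_cone (I2 n). pairing u v = 0}"
    using face by (auto simp: cone_face_def)
  have ug: "0 \<le> pairing u g" if "g \<in> gens" for g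
    using u that by (simp add: hibi_cone_eq dual_cone_hull)
  let ?T = "{g \<in> gens. pairing u g = 0}"
  have T: "?T \<subseteq> \<tau>" unfolding \<tau> hibi_cone_eq by (auto intro: hull_inc)
  have sp: "\<tau> \<subseteq> span ?T"
    unfolding \<tau> hibi_cone_eq by (rule face_subset_span) (rule ug)
  have P_iff: "P \<alpha> \<noteq> 0 \<longleftrightarrow> (\<forall>v\<in>\<tau>. pairing (lattice_vec (f_ideal (I2 n) \<alpha>)) v = 0)" if "\<alpha> \<in> I2 n" for \<alpha>
    using that by (simp add: P face_point_def)
  let ?f = "\<lambda>\<alpha>. lattice_vec (f_ideal (I2 n) \<alpha>)"
  have nI: "(n - 1, n) \<in> I2 n" using n by (simp add: I2_def)
  have max_not: "single (n - 1, n) 1 \<notin> \<tau>"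
  proof
    assume "single (n - 1, n) 1 \<in> \<tau>"
    then have "pairing (?f (n - 1, n)) (single (n - 1, n) 1) = 0" using P_iff[OF nI] top by blast
    then show False using max_J_iff[of "(n - 1, n)"] by (simp add: lookup_f_ideal)
  qed
  have u_max: "0 \<le> lookup u (n - 1, n)" using ug[of "single (n - 1, n) 1"] by (simp add: gens_def)
  have u_nonneg: "0 \<le> lookup u z" if "z \<in> J" for z
  proof -
    obtain \<alpha> where "\<alpha> \<in> I2 n" "\<forall>z\<in>J. z \<le> \<alpha> \<longleftrightarrow> 0 \<le> lookup u z"
      using level_set[OF ug, of "(n - 1, n)" 0] u_max max_J_iff by blast
    moreover have "z \<le> (n - 1, n)" by (rule max_J) fact
    moreover have "(n - 1, n) \<in> J" using max_J_iff[of "(n - 1, n)"] by simp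
    ultimately show ?thesis using u_max \<open>z \<in> J\<close> by (meson order_trans)
  qed
  have "?T = G0"
  proof (intro equalityI subsetI)
    fix g assume g: "g \<in> ?T"
    then have "g \<noteq> single (n - 1, n) 1" using T max_not by blast
    then obtain y y' where y: "g = single y' 1 - single y 1" "covers_in J y y'"
      using g by (auto simp: gens_def)
    have "y \<le> \<alpha>" if "\<alpha> \<in> I2 n" "P \<alpha> \<noteq> 0" "y' \<le> \<alpha>" for \<alpha>
    proof -
      have "g \<in> \<tau>" using g T by blast
      then have "pairing (?f \<alpha>) g = 0" using P_iff[OF that(1)] that(2) by blast
      then show ?thesis using y that(3) by (auto simp: lookup_f_ideal covers_in_def split: if_splits)
    qed
    then show "g \<in> G0" using y unfolding G0_def by blast
  next
    fix g assume "g \<in> G0"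
    then obtain y y' where y: "g = single y' 1 - single y 1" "covers_in J y y'"
      and sep: "\<And>\<alpha>. \<alpha> \<in> I2 n \<Longrightarrow> P \<alpha> \<noteq> 0 \<Longrightarrow> y' \<le> \<alpha> \<Longrightarrow> y \<le> \<alpha>"
      unfolding G0_def by blast
    have gg: "g \<in> gens" using y unfolding gens_def by blast
    have yJ: "y \<in> J" "y' \<in> J" using y(2) by (auto simp: covers_in_def)
    have "pairing u g = 0"
    proof (rule ccontr)
      assume "pairing u g \<noteq> 0"
      then have lt: "lookup u y < lookup u y'" using ug[OF gg] y(1) by simp
      \<comment> \<open>The superlevel set of u at y' is the order ideal of some \<alpha>. Its
        functional vanishes on \<tau>, since u takes equal values at the two ends of every generator
        in \<tau>, yet it separates y' from y.\<close>
      obtain \<alpha> where \<alpha>: "\<alpha> \<in> I2 n" "\<forall>z\<in>J. z \<le> \<alpha> \<longleftrightarrow> lookup u y' \<le> lookup u z"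
        using level_set[OF ug yJ(2) order_refl] by blast
      have "pairing (?f \<alpha>) v = 0" if "v \<in> \<tau>" for v
      proof -
        have "?T \<subseteq> {v. pairing (?f \<alpha>) v = 0}"
        proof clarify
          fix h assume h: "h \<in> gens" "pairing u h = 0"
          then have "h \<noteq> single (n - 1, n) 1" using T max_not by blast
          then obtain x x' where x: "h = single x' 1 - single x 1" "covers_in J x x'"
            using h by (auto simp: gens_def)
          then show "pairing (?f \<alpha>) h = 0"
            using h \<alpha> by (auto simp: lookup_f_ideal covers_in_def)
        qed
        moreover have "subspace {v. pairing (?f \<alpha>) v = 0}"
          by (rule subspaceI) (auto simp: pairing_add pairing_scaleR)
        ultimately have "span ?T \<subseteq> {v. pairing (?f \<alpha>) v = 0}" by (rule span_minimal)
        then show ?thesis using sp that by blast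
      qed
      then have "P \<alpha> \<noteq> 0" using P_iff[OF \<alpha>(1)] by blast
      moreover have "y' \<le> \<alpha>" "\<not> y \<le> \<alpha>" using \<alpha>(2) yJ lt by auto
      ultimately show False using sep \<alpha>(1) by blast
    qed
    then show "g \<in> ?T" using gg by blast
  qed
  moreover have "span \<tau> = span ?T"
    unfolding span_eq using sp subset_trans[OF T span_superset] by blast
  ultimately show ?thesis by (metis dim_span)
qed

text \<open>The differences in \<open>G0\<close> are the edges of a graph on J; all of them lie
  within \<open>W\<close>, and they connect \<open>W\<close>. So they span a space of dimension |W|
  - 1 = 2k + 3, and 2n - 3 - (2k + 3) = 2(n - k) - 6.\<close>

lemma codim_face:
  fixes P :: "nat \<times> nat \<Rightarrow> 'k::field"
  assumes face: "cone_face J (hibi_cone (I2 n)) \<tau>" and P: "P = face_point (I2 n) \<tau>"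
    and i: "1 \<le> i" "i + k + 3 \<le> n"
    and D: "\<And>\<alpha>. \<alpha> \<in> I2 n \<Longrightarrow> P \<alpha> \<noteq> 0 \<longleftrightarrow> \<alpha> \<le> (i, i + 1) \<or> (i + k + 2, i + k + 3) \<le> \<alpha>"
  shows "cone_codim (hibi_cone (I2 n)) \<tau> = 2 * (n - k) - 6"
proof -
  define G0 where "G0 = {single y' (1::real) - single y 1 | y y'. covers_in J y y' \<and>
    (\<forall>\<alpha>\<in>I2 n. P \<alpha> \<noteq> 0 \<longrightarrow> y' \<le> \<alpha> \<longrightarrow> y \<le> \<alpha>)}"
  have top: "P (n - 1, n) \<noteq> 0" using D[of "(n - 1, n)"] i by (simp add: I2_def less_eq_prod_def)
  have dim: "dim \<tau> = dim G0" unfolding G0_def by (rule face_gens[OF face P top])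
  define W where "W = (\<lambda>b. (1::nat, b)) ` {i + 2..i + k + 3} \<union> (\<lambda>a. (a, a + 1)) ` {i + 1..i + k + 2}"
  define w where "w = (1::nat, i + 2)"
  have W_mem: "i + 2 \<le> b \<Longrightarrow> b \<le> i + k + 3 \<Longrightarrow> (1, b) \<in> W"
    "i + 1 \<le> a \<Longrightarrow> a \<le> i + k + 2 \<Longrightarrow> (a, a + 1) \<in> W" for a b
    by (auto simp: W_def)
  have wW: "w \<in> W" using W_mem(1)[of "i + 2"] by (simp add: w_def)
  have card_W: "card W = 2 * k + 4" "finite W"
  proof -
    have "card W = card ((\<lambda>b. (1::nat, b)) ` {i + 2..i + k + 3}) + card ((\<lambda>a. (a, a + 1)) ` {i + 1..i + k + 2})"
      unfolding W_def by (rule card_Un_disjoint) (use i in auto)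
    also have "\<dots> = (k + 2) + (k + 2)" by (subst (1 2) card_image) (auto simp: inj_on_def)
    finally show "card W = 2 * k + 4" by simp
    show "finite W" by (simp add: W_def)
  qed
  have JI: "z \<in> I2 n" if "z \<in> J" for z using that by (simp add: join_irreducibles_def)
  have in_W: "y \<in> W \<and> y' \<in> W"
    if y: "y \<in> J" "y' \<in> J" "y' < y" and sep: "\<And>\<alpha>. \<alpha> \<in> I2 n \<Longrightarrow> P \<alpha> \<noteq> 0 \<Longrightarrow> y' \<le> \<alpha> \<Longrightarrow> y \<le> \<alpha>" for y y'
  proof -
    \<comment> \<open>Otherwise y' is itself an admissible \<alpha>, and it contains y' but not
      y.\<close>
    have y': "\<not> y' \<le> (i, i + 1)"
      using sep[of y'] D[of y'] JI[OF y(2)] y(3) by auto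
    \<comment> \<open>For larger b the element (b - 2, b - 1) of the upper block separates y' from
      y; in the diagonal case this is done by (a - 1, n).\<close>
    have y_chain: "b \<le> i + k + 3" if b: "y = (1, b)" for b
    proof (rule ccontr)
      assume "\<not> b \<le> i + k + 3"
      moreover have "b \<le> n" using JI[OF y(1)] b by (simp add: I2_def)
      ultimately have \<alpha>: "(b - 2, b - 1) \<in> I2 n" "(i + k + 2, i + k + 3) \<le> (b - 2, b - 1)"
        by (auto simp: I2_def less_eq_prod_def)
      have "y' \<le> (b - 2, b - 1)"
        using y(3) JI[OF y(2)] b \<open>\<not> b \<le> i + k + 3\<close>
        by (cases y') (auto simp: less_le_not_le less_eq_prod_def I2_def)
      then have "y \<le> (b - 2, b - 1)" using sep D \<alpha> by blast
      then show False using b \<open>\<not> b \<le> i + k + 3\<close> by (auto simp: less_eq_prod_def)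
    qed
    have y_diag: "a \<le> i + k + 2" if a: "y = (a, a + 1)" for a
    proof (rule ccontr)
      assume "\<not> a \<le> i + k + 2"
      moreover have "a + 1 \<le> n" using JI[OF y(1)] a by (simp add: I2_def)
      ultimately have \<alpha>: "(a - 1, n) \<in> I2 n" "(i + k + 2, i + k + 3) \<le> (a - 1, n)"
        by (auto simp: I2_def less_eq_prod_def)
      have "y' \<le> (a - 1, n)"
        using y(2)
      proof (rule J_cases)
        fix b assume "y' = (1, b)" "2 \<le> b" "b \<le> n"
        then show ?thesis using \<open>\<not> a \<le> i + k + 2\<close> by (simp add: less_eq_prod_def)
      next
        fix a' assume "y' = (a', a' + 1)" "2 \<le> a'" "a' < n"
        then show ?thesis using y(3) a by (auto simp: less_le_not_le less_eq_prod_def)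
      qed
      then have "y \<le> (a - 1, n)" using sep D \<alpha> by blast
      then show False using a \<open>\<not> a \<le> i + k + 2\<close> by (auto simp: less_eq_prod_def)
    qed
    from y(2) show ?thesis
    proof (rule J_cases)
      fix b' assume b': "y' = (1, b')" "2 \<le> b'" "b' \<le> n"
      then have b'2: "i + 2 \<le> b'" using y' i by (simp add: less_eq_prod_def)
      from y(1) show ?thesis
      proof (rule J_cases)
        fix b assume b: "y = (1, b)" "2 \<le> b" "b \<le> n"
        then have "b' < b" using y(3) b' by (auto simp: less_le_not_le less_eq_prod_def)
        then show ?thesis using b b' b'2 y_chain[OF b(1)] W_mem(1) by simp
      next
        fix a assume a: "y = (a, a + 1)" "2 \<le> a" "a < n"
        then have "b' \<le> a + 1" using y(3) b' by (auto simp: less_le_not_le less_eq_prod_def)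
        then show ?thesis using a b' b'2 y_diag[OF a(1)] W_mem(1)[of b'] W_mem(2)[of a] by simp
      qed
    next
      fix a' assume a': "y' = (a', a' + 1)" "2 \<le> a'" "a' < n"
      then have a'2: "i + 1 \<le> a'" using y' by (simp add: less_eq_prod_def)
      from y(1) show ?thesis
      proof (rule J_cases)
        fix b assume b: "y = (1, b)" "2 \<le> b" "b \<le> n"
        then show ?thesis using y(3) a' by (auto simp: less_le_not_le less_eq_prod_def)
      next
        fix a assume a: "y = (a, a + 1)" "2 \<le> a" "a < n"
        then have "a' < a" using y(3) a' by (auto simp: less_le_not_le less_eq_prod_def)
        then show ?thesis using a a' a'2 y_diag[OF a(1)] W_mem(2)[of a] W_mem(2)[of a'] by simp
      qed
    qed
  qed
  have G_chain: "single (1, b) 1 - single (1, b + 1) 1 \<in> G0" if "i + 2 \<le> b" "b \<le> i + k + 2" for b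
  proof -
    have "(1, b + 1) \<le> \<alpha>" if "\<alpha> \<in> I2 n" "P \<alpha> \<noteq> 0" "(1, b) \<le> \<alpha>" for \<alpha>
      using that D[OF that(1)] \<open>i + 2 \<le> b\<close> \<open>b \<le> i + k + 2\<close> by (cases \<alpha>) auto
    moreover have "covers_in J (1, b + 1) (1, b)" by (rule covers_chain) (use that i in auto)
    ultimately show ?thesis unfolding G0_def by blast
  qed
  have G_diag: "single (1, a + 1) 1 - single (a, a + 1) 1 \<in> G0" if "i + 1 \<le> a" "a \<le> i + k + 2" for a
  proof -
    have "(a, a + 1) \<le> \<alpha>" if "\<alpha> \<in> I2 n" "P \<alpha> \<noteq> 0" "(1, a + 1) \<le> \<alpha>" for \<alpha>
      using that D[OF that(1)] \<open>i + 1 \<le> a\<close> \<open>a \<le> i + k + 2\<close> by (cases \<alpha>) auto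
    moreover have "covers_in J (a, a + 1) (1, a + 1)" by (rule covers_diag) (use that i in auto)
    ultimately show ?thesis unfolding G0_def by blast
  qed
  let ?B = "(\<lambda>z. single z (1::real) - single w 1) ` (W - {w})"
  have "dim G0 = card ?B"
  proof (rule dim_eqI)
    have B: "single z 1 - single w 1 \<in> span ?B" if "z \<in> W" for z
      using that by (cases "z = w") (auto intro: span_zero span_base)
    show "G0 \<subseteq> span ?B"
    proof
      fix g assume "g \<in> G0"
      then obtain y y' where g: "g = single y' 1 - single y 1" and c: "covers_in J y y'"
        and sep: "\<And>\<alpha>. \<alpha> \<in> I2 n \<Longrightarrow> P \<alpha> \<noteq> 0 \<Longrightarrow> y' \<le> \<alpha> \<Longrightarrow> y \<le> \<alpha>"
        unfolding G0_def by blast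
      have "y \<in> W" "y' \<in> W" using in_W[of y y'] c sep by (auto simp: covers_in_def)
      then have "(single y' 1 - single w 1) - (single y 1 - single w 1) \<in> span ?B"
        by (rule span_diff[OF B B, rotated])
      then show "g \<in> span ?B" by (simp add: g)
    qed
    have chain: "single (1, b) 1 - single w 1 \<in> span G0" if "i + 2 \<le> b" "b \<le> i + k + 3" for b
      using that
    proof (induction b rule: dec_induct)
      case (step b)
      have "single (1, b) 1 - single (1, b + 1) 1 \<in> span G0"
        using step by (intro span_base G_chain) auto
      moreover have "single (1, b) 1 - single w 1 \<in> span G0" using step by simp
      ultimately have "(single (1, b) 1 - single w 1) - (single (1, b) 1 - single (1, b + 1) 1) \<in> span G0"
        by (rule span_diff[rotated])
      then show ?case by simp
    qed (simp add: w_def span_zero)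
    show "?B \<subseteq> span G0"
    proof (rule image_subsetI)
      fix z assume "z \<in> W - {w}"
      then consider b where "z = (1, b)" "i + 2 \<le> b" "b \<le> i + k + 3"
        | a where "z = (a, a + 1)" "i + 1 \<le> a" "a \<le> i + k + 2"
        by (auto simp: W_def)
      then show "single z 1 - single w 1 \<in> span G0"
      proof cases
        case (2 a)
        then have "(single (1, a + 1) 1 - single w 1) - (single (1, a + 1) 1 - single (a, a + 1) 1) \<in> span G0"
          by (intro span_diff[OF chain span_base[OF G_diag]]) auto
        then show ?thesis using 2 by simp
      qed (use chain in auto)
    qed
    show "independent ?B" by (rule independent_single_diffs) simp
  qed
  also have "\<dots> = card (W - {w})"
    by (rule card_image, rule inj_onI, rule single_key_inject) simp
  also have "\<dots> = 2 * k + 3" using card_W wW by simp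
  finally show ?thesis using dim_hibi_cone dim i by (simp add: cone_codim_def)
qed

end

section \<open>The Hibi ring of a truncated lattice with a chain on top is toric\<close>

lemma I2_trunc_iff: "(a, b) \<in> I2_trunc (k + 4) \<longleftrightarrow> 1 \<le> a \<and> a \<le> k + 2 \<and> 3 \<le> b \<and> b \<le> k + 4 \<and> a < b"
  by (auto simp: I2_trunc_def I2_def)

text \<open>Adding a free variable to a Hibi ring amounts to adding a new top element to the lattice.\<close>

definition ext_lattice :: "nat \<Rightarrow> nat \<Rightarrow> (nat \<times> nat) set"
  where "ext_lattice k m = I2_trunc (k + 4) \<union> (\<lambda>t. (k + 5 + t, k + 5 + t)) ` {..<m}"

lemma ext_lattice_iff: "(a, b) \<in> ext_lattice k m \<longleftrightarrow>
    (1 \<le> a \<and> a \<le> k + 2 \<and> 3 \<le> b \<and> b \<le> k + 4 \<and> a < b) \<or> (k + 5 \<le> a \<and> a < k + 5 + m \<and> b = a)"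
proof -
  have "(\<exists>t<m. (a, b) = (k + 5 + t, k + 5 + t)) \<longleftrightarrow> k + 5 \<le> a \<and> a < k + 5 + m \<and> b = a"
    by (auto intro!: exI[of _ "a - (k + 5)"])
  then show ?thesis by (auto simp: ext_lattice_def I2_trunc_iff)
qed

lemma sublattice_ext: "sublattice (ext_lattice k m)"
  unfolding sublattice_def
proof (intro ballI)
  fix \<alpha> \<beta> assume "\<alpha> \<in> ext_lattice k m" "\<beta> \<in> ext_lattice k m"
  then show "sup \<alpha> \<beta> \<in> ext_lattice k m \<and> inf \<alpha> \<beta> \<in> ext_lattice k m"
    by (cases \<alpha>; cases \<beta>)
      (auto simp: ext_lattice_iff sup_prod_def inf_prod_def sup_nat_def inf_nat_def max_def min_def)
qed

lemma finite_ext: "finite (ext_lattice k m)"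
proof -
  have "I2_trunc (k + 4) \<subseteq> {..k + 4} \<times> {..k + 4}" by (auto simp: I2_trunc_iff)
  then have "finite (I2_trunc (k + 4))" by (rule finite_subset) simp
  then show ?thesis by (simp add: ext_lattice_def)
qed

section \<open>The monoid of the extended lattice as lattice points of a cone\<close>

lemma hibi_monoidE:
  assumes "e \<in> hibi_monoid L"
  obtains M where "e = expo M" "set_mset M \<subseteq> L"
  using assms unfolding hibi_monoid_def by blast

lemma filter_mset_none: "(\<And>p. p \<in># M \<Longrightarrow> \<not> P p) \<Longrightarrow> filter_mset P M = {#}"
  by (induction M) auto

lemma size_filter_mono:
  assumes "\<And>p. p \<in># M \<Longrightarrow> P p \<Longrightarrow> Q p"
  shows "size (filter_mset P M) \<le> size (filter_mset Q M)"
  using assms by (induction M) (auto simp: le_SucI)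

lemma size_filter_cong:
  assumes "\<And>p. p \<in># M \<Longrightarrow> P p \<longleftrightarrow> Q p"
  shows "size (filter_mset P M) = size (filter_mset Q M)"
  using assms by (intro antisym size_filter_mono) auto

text \<open>Tails turn a lattice element into the indicator vector of an order ideal, so that the
  monoid is described by monotonicity. The upper bounds, k + 2 here and k + 4 for the second family,
  discard the elements of the added chain.\<close>

definition tail_u :: "nat \<Rightarrow> bimon \<Rightarrow> nat \<Rightarrow> nat"
  where "tail_u k e a = size (filter_mset (\<lambda>x. a \<le> x \<and> x \<le> k + 2) (fst e))"

definition tail_v :: "nat \<Rightarrow> bimon \<Rightarrow> nat \<Rightarrow> nat"
  where "tail_v k e b = size (filter_mset (\<lambda>y. b \<le> y \<and> y \<le> k + 4) (snd e))"

lemma tail_expo: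
  "tail_u k (expo M) a = size (filter_mset (\<lambda>p. a \<le> fst p \<and> fst p \<le> k + 2) M)"
  "tail_v k (expo M) b = size (filter_mset (\<lambda>p. b \<le> snd p \<and> snd p \<le> k + 4) M)"
  "count (fst (expo M)) x = size (filter_mset (\<lambda>p. fst p = x) M)"
  "count (snd (expo M)) x = size (filter_mset (\<lambda>p. snd p = x) M)"
  by (induction M) (auto simp: tail_u_def tail_v_def)

lemma tail_add: "tail_u k (e + e') a = tail_u k e a + tail_u k e' a"
  "tail_v k (e + e') a = tail_v k e a + tail_v k e' a"
  by (simp_all add: tail_u_def tail_v_def)

lemma count_eq_tail:
  "a \<le> k + 2 \<Longrightarrow> tail_u k e a = count (fst e) a + tail_u k e (Suc a)"
  "b \<le> k + 4 \<Longrightarrow> tail_v k e b = count (snd e) b + tail_v k e (Suc b)"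
proof -
  have *: "size (filter_mset (\<lambda>x. a \<le> x \<and> x \<le> l) M) = count M a + size (filter_mset (\<lambda>x. Suc a \<le> x \<and> x \<le> l) M)"
    if "a \<le> l" for a l and M :: "nat multiset"
    using that by (induction M) auto
  show "a \<le> k + 2 \<Longrightarrow> tail_u k e a = count (fst e) a + tail_u k e (Suc a)"
    "b \<le> k + 4 \<Longrightarrow> tail_v k e b = count (snd e) b + tail_v k e (Suc b)"
    unfolding tail_u_def tail_v_def by (rule *, assumption)+
qed

lemma index_cases:
  fixes z m k :: nat
  obtains "z < m" | j where "z = m + j" "j \<le> k + 1" | j where "z = m + k + 2 + j" "j \<le> k" | "m + 2 * k + 3 \<le> z"
proof (cases "z < m")
  case False
  then have 1: "z = m + (z - m)" by simp
  show ?thesis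
  proof (cases "z \<le> m + k + 1")
    case True
    then show ?thesis using that(2)[OF 1] by simp
  next
    case False
    then have 2: "z = m + k + 2 + (z - (m + k + 2))" by simp
    show ?thesis
    proof (cases "z \<le> m + 2 * k + 2")
      case True
      then show ?thesis using that(3)[OF 2] by simp
    qed (use that(4) in simp)
  qed
qed (rule that(1))

text \<open>The first m entries are the free exponents, the next k + 2 the tails of the second
  family from 3 on, the last k + 1 those of the first family from 2 on. The first family's tail from
  1 is left out: it equals the second family's tail from 3.\<close>

definition toric_coord :: "nat \<Rightarrow> nat \<Rightarrow> bimon \<Rightarrow> nat \<Rightarrow> int"
  where "toric_coord k m e z = (if z < m then int (count (fst e) (k + 5 + z))
    else if z < m + k + 2 then int (tail_v k e (z - m + 3))
    else int (tail_u k e (z - (m + k + 2) + 2)))"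

definition toric_vec :: "nat \<Rightarrow> nat \<Rightarrow> bimon \<Rightarrow> nat \<Rightarrow>\<^sub>0 int"
  where "toric_vec k m e = (\<Sum>z<m + 2 * k + 3. single z (toric_coord k m e z))"

lemma lookup_sum_single_lessThan:
  fixes d :: nat
  shows "lookup (\<Sum>z<d. single z (f z)) z = (if z < d then f z else 0)"
proof -
  have "lookup (\<Sum>z<d. single z (f z)) z = (\<Sum>x<d. if x = z then f x else 0)"
    by (simp add: lookup_sum lookup_single when_def)
  also have "\<dots> = (if z \<in> {..<d} then f z else 0)" by (rule sum.delta) simp
  finally show ?thesis by simp
qed

lemma lookup_toric_vec: "lookup (toric_vec k m e) z = (if z < m + 2 * k + 3 then toric_coord k m e z else 0)"
  unfolding toric_vec_def by (rule lookup_sum_single_lessThan)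

lemma toric_vec_add: "toric_vec k m (e + e') = toric_vec k m e + toric_vec k m e'"
  by (rule poly_mapping_eqI) (simp add: lookup_toric_vec lookup_add toric_coord_def tail_add)

lemma toric_vec_0: "toric_vec k m 0 = 0"
  by (rule poly_mapping_eqI) (simp add: lookup_toric_vec toric_coord_def tail_u_def tail_v_def)

lemma toric_vec_lookups:
  "t < m \<Longrightarrow> lookup (toric_vec k m e) t = int (count (fst e) (k + 5 + t))"
  "j \<le> k + 1 \<Longrightarrow> lookup (toric_vec k m e) (m + j) = int (tail_v k e (j + 3))"
  "j \<le> k \<Longrightarrow> lookup (toric_vec k m e) (m + k + 2 + j) = int (tail_u k e (j + 2))"
  by (auto simp: lookup_toric_vec toric_coord_def)

text \<open>Each generator encodes an inequality: free exponents are nonnegative, tails decrease and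
  end nonnegative, and the tail from j + 2 of the first family is at most the tail from j + 3 of the
  second, because a \<ge> j + 2 and a < b give b \<ge> j + 3.\<close>

definition toric_gens :: "nat \<Rightarrow> nat \<Rightarrow> (nat \<Rightarrow>\<^sub>0 int) set"
  where "toric_gens k m = (\<lambda>t. single t 1) ` {..<m}
    \<union> (\<lambda>j. single (m + j) 1 - single (m + j + 1) 1) ` {..k} \<union> {single (m + k + 1) 1}
    \<union> (\<lambda>j. single (m + k + 2 + j) 1 - single (m + k + 2 + j + 1) 1) ` {..<k} \<union> {single (m + 2 * k + 2) 1}
    \<union> (\<lambda>j. single (m + j) 1 - single (m + k + 2 + j) 1) ` {..k}"

lemma finite_toric_gens: "finite (toric_gens k m)"
  by (simp add: toric_gens_def)

lemma keys_toric_gens: "g \<in> toric_gens k m \<Longrightarrow> keys g \<subseteq> {..<m + 2 * k + 3}"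
  by (auto simp: toric_gens_def in_keys_iff lookup_minus lookup_single when_def split: if_splits)

definition toric_cone :: "nat \<Rightarrow> nat \<Rightarrow> (nat \<Rightarrow>\<^sub>0 real) set"
  where "toric_cone k m = convex_cone hull (lattice_vec ` toric_gens k m)"

text \<open>The predicate \<open>R\<close> is left free so that one computation yields both the dual
  cone (nonnegative) and strong convexity (positive).\<close>

lemma toric_gens_pos:
  "(\<forall>g\<in>lattice_vec ` toric_gens k m. R (pairing u g)) \<longleftrightarrow>
    (\<forall>t<m. R (lookup u t)) \<and> (\<forall>j\<le>k. R (lookup u (m + j) - lookup u (m + j + 1))) \<and> R (lookup u (m + k + 1))
    \<and> (\<forall>j<k. R (lookup u (m + k + 2 + j) - lookup u (m + k + 2 + j + 1))) \<and> R (lookup u (m + 2 * k + 2))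
    \<and> (\<forall>j\<le>k. R (lookup u (m + j) - lookup u (m + k + 2 + j)))"
  unfolding toric_gens_def by (simp add: image_Un image_image ball_Un del: add_Suc_right One_nat_def) blast

lemma toric_dual_iff:
  "lattice_vec c \<in> dual_cone {..<m + 2 * k + 3} (toric_cone k m) \<longleftrightarrow> keys c \<subseteq> {..<m + 2 * k + 3} \<and>
    (\<forall>t<m. 0 \<le> lookup c t) \<and> (\<forall>j\<le>k. lookup c (m + j + 1) \<le> lookup c (m + j)) \<and> 0 \<le> lookup c (m + k + 1)
    \<and> (\<forall>j<k. lookup c (m + k + 2 + j + 1) \<le> lookup c (m + k + 2 + j)) \<and> 0 \<le> lookup c (m + 2 * k + 2)
    \<and> (\<forall>j\<le>k. lookup c (m + k + 2 + j) \<le> lookup c (m + j))"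
  unfolding toric_cone_def dual_cone_hull mem_Collect_eq toric_gens_pos[where R="\<lambda>x. 0 \<le> x"]
  by (simp del: add_Suc_right One_nat_def)

lemma strongly_convex_toric: "strongly_convex (toric_cone k m)"
proof -
  \<comment> \<open>A point in the interior of the dual cone: the entries of both families decrease
    by 1 at each step down to 1, and the second family stays one above the first.\<close>
  define h where "h z = (if z < m then 1 else if z < m + k + 2 then real (m + k + 2 - z)
    else real (m + 2 * k + 3 - z))" for z
  define u where "u = (\<Sum>z<m + 2 * k + 3. single z (h z))"
  have u: "z < m + 2 * k + 3 \<Longrightarrow> lookup u z = h z" for z
    unfolding u_def lookup_sum_single_lessThan by simp
  have "\<forall>g\<in>lattice_vec ` toric_gens k m. 0 < pairing u g"
    unfolding toric_gens_pos[where R="\<lambda>x. 0 < x"]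
    by (intro conjI allI impI) (simp_all add: u h_def of_nat_diff)
  then show ?thesis unfolding toric_cone_def by (intro strongly_convex_hull) blast
qed

text \<open>Subtracting the indicator function of the support is monotone; this peels off one lattice
  element at a time.\<close>

lemma trunc_realize:
  fixes C D :: "nat \<Rightarrow> int"
  assumes "\<And>j. j \<le> k \<Longrightarrow> C (j + 1) \<le> C j" "0 \<le> C (k + 1)" "\<And>j. j < k \<Longrightarrow> D (j + 1) \<le> D j" "0 \<le> D k"
    and "\<And>j. j \<le> k \<Longrightarrow> D j \<le> C j"
  shows "\<exists>M. set_mset M \<subseteq> I2_trunc (k + 4) \<and> (\<forall>j\<le>k + 1. C j = int (size (filter_mset (\<lambda>p. j + 3 \<le> snd p) M)))
    \<and> (\<forall>j\<le>k. D j = int (size (filter_mset (\<lambda>p. j + 2 \<le> fst p) M)))"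
  using assms
proof (induction "nat (C 0)" arbitrary: C D)
  have C_anti: "C j' \<le> C j" if "\<And>j. j \<le> k \<Longrightarrow> C (j + 1) \<le> C j" "j \<le> j'" "j' \<le> k + 1" for j j' and C :: "nat \<Rightarrow> int"
    using that(2,3)
  proof (induction j' rule: dec_induct)
    case (step l)
    then show ?case using that(1)[of l] by simp
  qed simp
  have D_anti: "D j' \<le> D j" if "\<And>j. j < k \<Longrightarrow> D (j + 1) \<le> D j" "j \<le> j'" "j' \<le> k" for j j' and D :: "nat \<Rightarrow> int"
    using that(2,3)
  proof (induction j' rule: dec_induct)
    case (step l)
    then show ?case using that(1)[of l] by simp
  qed simp
  {
    case 0
    have "C j = 0" if "j \<le> k + 1" for j
      using C_anti[of C 0 j] C_anti[of C j "k + 1"] 0 that by force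
    moreover have "D j = 0" if "j \<le> k" for j
      using D_anti[of D j k] 0(6)[of j] calculation[of j] 0 that by force
    ultimately show ?case by (intro exI[of _ "{#}"]) simp
  next
    case (Suc l)
    define f :: "int \<Rightarrow> int" where "f x = (if 1 \<le> x then x - 1 else x)" for x
    have mono: "x \<le> y \<Longrightarrow> f x \<le> f y" and pos: "0 \<le> x \<Longrightarrow> 0 \<le> f x" for x y by (auto simp: f_def)
    have C0: "1 \<le> C 0" using Suc.hyps(2) by simp
    have "l = nat (f (C 0))" using Suc.hyps(2) by (auto simp: f_def)
    then obtain M where M: "set_mset M \<subseteq> I2_trunc (k + 4)"
        "\<And>j. j \<le> k + 1 \<Longrightarrow> f (C j) = int (size (filter_mset (\<lambda>p. j + 3 \<le> snd p) M))"
        "\<And>j. j \<le> k \<Longrightarrow> f (D j) = int (size (filter_mset (\<lambda>p. j + 2 \<le> fst p) M))"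
      using Suc.hyps(1)[of "\<lambda>j. f (C j)" "\<lambda>j. f (D j)", OF _ mono[OF Suc.prems(1)] pos[OF Suc.prems(2)]
          mono[OF Suc.prems(3)] pos[OF Suc.prems(4)] mono[OF Suc.prems(5)]] by blast
    \<comment> \<open>The supports of \<open>C\<close> and \<open>D\<close> are initial segments;
      their ends give the coordinates of the element to be peeled off. If \<open>D\<close> has empty
      support, the first coordinate is 1.\<close>
    define B where "B = {j. j \<le> k + 1 \<and> 1 \<le> C j}"
    define A where "A = insert 1 ((\<lambda>j. j + 2) ` {j. j \<le> k \<and> 1 \<le> D j})"
    have finB: "finite B" and finA: "finite A" by (simp_all add: A_def B_def)
    have "B \<noteq> {}" using C0 by (auto simp: B_def intro: exI[of _ 0])
    then have MB: "Max B \<in> B" using finB by (rule Max_in[rotated])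
    have MA: "Max A \<in> A" by (rule Max_in[OF finA]) (simp add: A_def)
    have C_iff: "j \<le> Max B \<longleftrightarrow> 1 \<le> C j" if "j \<le> k + 1" for j
    proof
      assume "j \<le> Max B"
      moreover have "Max B \<le> k + 1" using MB by (simp add: B_def)
      ultimately have "C (Max B) \<le> C j" by (rule C_anti[where C=C, rotated]) (rule Suc.prems(1))
      then show "1 \<le> C j" using MB by (simp add: B_def)
    qed (use that finB in \<open>auto intro!: Max_ge simp: B_def\<close>)
    have D_iff: "j + 2 \<le> Max A \<longleftrightarrow> 1 \<le> D j" if "j \<le> k" for j
    proof
      assume j: "j + 2 \<le> Max A"
      then obtain j' where j': "Max A = j' + 2" "j' \<le> k" "1 \<le> D j'" using MA by (auto simp: A_def)
      then have "j \<le> j'" using j by simp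
      then have "D j' \<le> D j" using j'(2) by (rule D_anti[where D=D, rotated]) (rule Suc.prems(3))
      then show "1 \<le> D j" using j' by simp
    qed (use that finA in \<open>auto intro!: Max_ge simp: A_def\<close>)
    \<comment> \<open>This is where \<open>D j \<le> C j\<close> enters: it makes the new pair an
      element of the lattice.\<close>
    have lt: "Max A < Max B + 3"
    proof (cases "Max A = 1")
      case False
      then obtain j where j: "Max A = j + 2" "j \<le> k" "1 \<le> D j" using MA by (auto simp: A_def)
      then have "1 \<le> C j" using Suc.prems(5)[of j] by simp
      then show ?thesis using j C_iff[of j] by simp
    qed simp
    have "(Max A, Max B + 3) \<in> I2_trunc (k + 4)"
      using MA MB lt by (auto simp: I2_trunc_iff A_def B_def)
    moreover have "C j = int (size (filter_mset (\<lambda>p. j + 3 \<le> snd p) (add_mset (Max A, Max B + 3) M)))" if "j \<le> k + 1" for j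
      using M(2)[OF that] C_iff[OF that] by (auto simp: f_def split: if_splits)
    moreover have "D j = int (size (filter_mset (\<lambda>p. j + 2 \<le> fst p) (add_mset (Max A, Max B + 3) M)))" if "j \<le> k" for j
      using M(3)[OF that] D_iff[OF that] by (auto simp: f_def split: if_splits)
    ultimately show ?case using M(1) by (intro exI[of _ "add_mset (Max A, Max B + 3) M"]) auto
  }
qed

lemma ext_cases:
  assumes "p \<in> ext_lattice k m"
  obtains "1 \<le> fst p" "fst p \<le> k + 2" "3 \<le> snd p" "snd p \<le> k + 4" "fst p < snd p"
    | "k + 5 \<le> fst p" "fst p < k + 5 + m" "snd p = fst p"
  using assms ext_lattice_iff[of "fst p" "snd p" k m] by auto

lemma toric_vec_dual:
  assumes "e \<in> hibi_monoid (ext_lattice k m)"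
  shows "lattice_vec (toric_vec k m e) \<in> dual_cone {..<m + 2 * k + 3} (toric_cone k m)"
proof -
  obtain M where M: "e = expo M" "set_mset M \<subseteq> ext_lattice k m" using assms by (rule hibi_monoidE)
  have uv: "tail_u k e (j + 2) \<le> tail_v k e (j + 3)" for j
    unfolding M(1) tail_expo
  proof (rule size_filter_mono)
    fix p assume "p \<in># M" and p: "j + 2 \<le> fst p \<and> fst p \<le> k + 2"
    then have "p \<in> ext_lattice k m" using M(2) by blast
    then show "j + 3 \<le> snd p \<and> snd p \<le> k + 4" by (rule ext_cases) (use p in auto)
  qed
  have u: "tail_u k e (Suc j) \<le> tail_u k e j" and v: "tail_v k e (Suc j) \<le> tail_v k e j" for j
    unfolding M(1) tail_expo by (rule size_filter_mono; auto)+
  have "keys (toric_vec k m e) \<subseteq> {..<m + 2 * k + 3}"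
    by (auto simp: in_keys_iff lookup_toric_vec split: if_splits)
  moreover have "lookup (toric_vec k m e) (m + j + 1) \<le> lookup (toric_vec k m e) (m + j)" if "j \<le> k" for j
    using that v[of "j + 3"] toric_vec_lookups(2)[of j k m e] toric_vec_lookups(2)[of "j + 1" k m e] by simp
  moreover have "lookup (toric_vec k m e) (m + k + 2 + j + 1) \<le> lookup (toric_vec k m e) (m + k + 2 + j)" if "j < k" for j
    using that u[of "j + 2"] toric_vec_lookups(3)[of j k m e] toric_vec_lookups(3)[of "j + 1" k m e] by simp
  moreover have "lookup (toric_vec k m e) (m + k + 2 + j) \<le> lookup (toric_vec k m e) (m + j)" if "j \<le> k" for j
    using that uv[of j] toric_vec_lookups(3)[of j k m e] toric_vec_lookups(2)[of j k m e] by simp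
  moreover have "0 \<le> lookup (toric_vec k m e) z" for z
    by (simp add: lookup_toric_vec toric_coord_def)
  ultimately show ?thesis unfolding toric_dual_iff by blast
qed

text \<open>Counts are differences of consecutive tails. What the vector omits is determined by the
  rest: the tail from 1 by \<open>tail1\<close>, the second components on the added chain by
  \<open>chain\<close>.\<close>

lemma toric_vec_inj: "inj_on (toric_vec k m) (hibi_monoid (ext_lattice k m))"
proof (rule inj_onI)
  fix e e' assume e: "e \<in> hibi_monoid (ext_lattice k m)" and e': "e' \<in> hibi_monoid (ext_lattice k m)"
    and eq: "toric_vec k m e = toric_vec k m e'"
  have tail1: "tail_u k e 1 = tail_v k e 3" if "e \<in> hibi_monoid (ext_lattice k m)" for e
  proof -
    obtain M where M: "e = expo M" "set_mset M \<subseteq> ext_lattice k m" by (rule hibi_monoidE[OF \<open>e \<in> hibi_monoid (ext_lattice k m)\<close>])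
    show ?thesis unfolding M(1) tail_expo
    proof (rule size_filter_cong)
      fix p assume "p \<in># M"
      then have "p \<in> ext_lattice k m" using M(2) by blast
      then show "1 \<le> fst p \<and> fst p \<le> k + 2 \<longleftrightarrow> 3 \<le> snd p \<and> snd p \<le> k + 4" by (rule ext_cases) auto
    qed
  qed
  have chain: "count (snd e) x = count (fst e) x"
    if "e \<in> hibi_monoid (ext_lattice k m)" "k + 5 \<le> x" for e x
  proof -
    obtain M where M: "e = expo M" "set_mset M \<subseteq> ext_lattice k m" by (rule hibi_monoidE[OF \<open>e \<in> hibi_monoid (ext_lattice k m)\<close>])
    show ?thesis unfolding M(1) tail_expo
    proof (rule size_filter_cong)
      fix p assume "p \<in># M"
      then have "p \<in> ext_lattice k m" using M(2) by blast
      then show "snd p = x \<longleftrightarrow> fst p = x" by (rule ext_cases) (use that(2) in auto)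
    qed
  qed
  have out: "count (fst e) x = 0" if "e \<in> hibi_monoid (ext_lattice k m)" "x = 0 \<or> k + 2 < x \<and> x < k + 5 \<or> k + 5 + m \<le> x" for e x
  proof -
    obtain M where M: "e = expo M" "set_mset M \<subseteq> ext_lattice k m" by (rule hibi_monoidE[OF \<open>e \<in> hibi_monoid (ext_lattice k m)\<close>])
    have "filter_mset (\<lambda>p. fst p = x) M = {#}"
    proof (rule filter_mset_none)
      fix p assume "p \<in># M"
      then have "p \<in> ext_lattice k m" using M(2) by blast
      then show "\<not> fst p = x" by (rule ext_cases) (use that(2) in auto)
    qed
    then show ?thesis unfolding M(1) tail_expo by simp
  qed
  have out2: "count (snd e) x = 0" if "e \<in> hibi_monoid (ext_lattice k m)" "x < 3" for e x
  proof -
    obtain M where M: "e = expo M" "set_mset M \<subseteq> ext_lattice k m" by (rule hibi_monoidE[OF \<open>e \<in> hibi_monoid (ext_lattice k m)\<close>])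
    have "filter_mset (\<lambda>p. snd p = x) M = {#}"
    proof (rule filter_mset_none)
      fix p assume "p \<in># M"
      then have "p \<in> ext_lattice k m" using M(2) by blast
      then show "\<not> snd p = x" by (rule ext_cases) (use that(2) in auto)
    qed
    then show ?thesis unfolding M(1) tail_expo by simp
  qed
  have v: "tail_v k e b = tail_v k e' b" if "3 \<le> b" for b
  proof (cases "b \<le> k + 4")
    case True
    then show ?thesis
      using toric_vec_lookups(2)[of "b - 3" k m e] toric_vec_lookups(2)[of "b - 3" k m e'] that eq by simp
  next
    case False
    then have "filter_mset (\<lambda>y. b \<le> y \<and> y \<le> k + 4) M = {#}" for M :: "nat multiset"
      by (intro filter_mset_none) simp
    then show ?thesis by (simp only: tail_v_def)
  qed
  have u: "tail_u k e a = tail_u k e' a" if "1 \<le> a" for a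
  proof (cases "2 \<le> a \<and> a \<le> k + 2")
    case True
    then have a: "a = (a - 2) + 2" "a - 2 \<le> k" by arith+
    have "int (tail_u k e ((a - 2) + 2)) = int (tail_u k e' ((a - 2) + 2))"
      using toric_vec_lookups(3)[OF a(2), of m e] toric_vec_lookups(3)[OF a(2), of m e'] eq by argo
    then show ?thesis by (simp only: a(1)[symmetric] of_nat_eq_iff)
  next
    case False
    show ?thesis
    proof (cases "a = 1")
      case True
      then show ?thesis using tail1[OF e] tail1[OF e'] v[of 3] by simp
    next
      case False
      then have "filter_mset (\<lambda>y. a \<le> y \<and> y \<le> k + 2) M = {#}" for M :: "nat multiset"
        using \<open>\<not> (2 \<le> a \<and> a \<le> k + 2)\<close> that by (intro filter_mset_none) auto
      then show ?thesis by (simp only: tail_u_def)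
    qed
  qed
  have fst: "count (fst e) x = count (fst e') x" for x
  proof -
    consider "1 \<le> x" "x \<le> k + 2" | "k + 5 \<le> x" "x < k + 5 + m" | "x = 0 \<or> k + 2 < x \<and> x < k + 5 \<or> k + 5 + m \<le> x"
      by linarith
    then show ?thesis
    proof cases
      case 1
      then show ?thesis using count_eq_tail(1)[of x k e] count_eq_tail(1)[of x k e'] u[of x] u[of "Suc x"] by simp
    next
      case 2
      then show ?thesis
        using toric_vec_lookups(1)[of "x - (k + 5)" m k e] toric_vec_lookups(1)[of "x - (k + 5)" m k e'] eq by simp
    qed (use out e e' in simp)
  qed
  have "count (snd e) x = count (snd e') x" for x
  proof -
    consider "x < 3" | "3 \<le> x" "x \<le> k + 4" | "k + 5 \<le> x" by linarith
    then show ?thesis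
    proof cases
      case 2
      then show ?thesis using count_eq_tail(2)[of x k e] count_eq_tail(2)[of x k e'] v[of x] v[of "Suc x"] by simp
    qed (use out2 chain fst e e' in auto)
  qed
  then show "e = e'" using fst by (auto intro!: prod_eqI multiset_eqI)
qed

lemma toric_vec_surj:
  assumes "lattice_vec c \<in> dual_cone {..<m + 2 * k + 3} (toric_cone k m)"
  shows "c \<in> toric_vec k m ` hibi_monoid (ext_lattice k m)"
proof -
  note c = assms[unfolded toric_dual_iff]
  have "\<exists>M. set_mset M \<subseteq> I2_trunc (k + 4)
      \<and> (\<forall>j\<le>k + 1. lookup c (m + j) = int (size (filter_mset (\<lambda>p. j + 3 \<le> snd p) M)))
      \<and> (\<forall>j\<le>k. lookup c (m + k + 2 + j) = int (size (filter_mset (\<lambda>p. j + 2 \<le> fst p) M)))"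
  proof (rule trunc_realize)
    show "0 \<le> lookup c (m + (k + 1))" using c by (simp add: add.assoc)
    show "0 \<le> lookup c (m + k + 2 + k)" 
    proof -
      have "m + k + 2 + k = m + 2 * k + 2" by simp
      then show ?thesis using c by (simp only:)
    qed
  qed (use c in \<open>simp_all add: add.assoc\<close>)
  then obtain M where M: "set_mset M \<subseteq> I2_trunc (k + 4)"
      "\<And>j. j \<le> k + 1 \<Longrightarrow> lookup c (m + j) = int (size (filter_mset (\<lambda>p. j + 3 \<le> snd p) M))"
      "\<And>j. j \<le> k \<Longrightarrow> lookup c (m + k + 2 + j) = int (size (filter_mset (\<lambda>p. j + 2 \<le> fst p) M))"
    by blast
  define N where "N = (\<Sum>t<m. replicate_mset (nat (lookup c t)) (k + 5 + t, k + 5 + t))"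
  have N: "set_mset N \<subseteq> (\<lambda>t. (k + 5 + t, k + 5 + t)) ` {..<m}"
    by (auto simp: N_def set_mset_sum split: if_splits)
  define e where "e = expo (M + N)"
  have e: "e \<in> hibi_monoid (ext_lattice k m)"
    unfolding hibi_monoid_def e_def ext_lattice_def using M(1) N by (intro CollectI exI[of _ "M + N"]) auto
  have Mp: "fst p \<le> k + 2" "snd p \<le> k + 4" if "p \<in># M" for p
    using M(1) that I2_trunc_iff[of "fst p" "snd p" k] by auto
  have Np: "k + 5 \<le> fst p" "k + 5 \<le> snd p" if "p \<in># N" for p
    using N that by auto
  have v: "tail_v k e b = size (filter_mset (\<lambda>p. b \<le> snd p) M)" for b
  proof -
    have "filter_mset (\<lambda>p. b \<le> snd p \<and> snd p \<le> k + 4) N = {#}"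
      by (rule filter_mset_none) (use Np in fastforce)
    moreover have "filter_mset (\<lambda>p. b \<le> snd p \<and> snd p \<le> k + 4) M = filter_mset (\<lambda>p. b \<le> snd p) M"
      using Mp by (intro filter_mset_cong) auto
    ultimately show ?thesis by (simp add: e_def tail_expo del: expo_simps)
  qed
  have u: "tail_u k e a = size (filter_mset (\<lambda>p. a \<le> fst p) M)" for a
  proof -
    have "filter_mset (\<lambda>p. a \<le> fst p \<and> fst p \<le> k + 2) N = {#}"
      by (rule filter_mset_none) (use Np in fastforce)
    moreover have "filter_mset (\<lambda>p. a \<le> fst p \<and> fst p \<le> k + 2) M = filter_mset (\<lambda>p. a \<le> fst p) M"
      using Mp by (intro filter_mset_cong) auto
    ultimately show ?thesis by (simp add: e_def tail_expo del: expo_simps)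
  qed
  have s: "int (count (fst e) (k + 5 + t)) = lookup c t" if "t < m" for t
  proof -
    have "filter_mset (\<lambda>p. fst p = k + 5 + t) M = {#}"
      by (rule filter_mset_none) (use Mp in fastforce)
    then have "count (fst e) (k + 5 + t) = size (filter_mset (\<lambda>p. fst p = k + 5 + t) N)"
      unfolding e_def tail_expo by simp
    also have "filter_mset (\<lambda>p. fst p = k + 5 + t) N = replicate_mset (nat (lookup c t)) (k + 5 + t, k + 5 + t)"
    proof (rule multiset_eqI)
      fix p
      have "count N p = (\<Sum>t'<m. if p = (k + 5 + t', k + 5 + t') then nat (lookup c t') else 0)"
        by (simp add: N_def count_sum)
      also have "\<dots> = (\<Sum>t'<m. if t' = t then nat (lookup c t) else 0)" if "p = (k + 5 + t, k + 5 + t)"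
        using that by (intro sum.cong) auto
      finally have cnt: "p = (k + 5 + t, k + 5 + t) \<Longrightarrow> count N p = nat (lookup c t)" using \<open>t < m\<close> by simp
      have mem: "p = (k + 5 + t, k + 5 + t)" if "fst p = k + 5 + t" "p \<in># N"
        using N that by auto
      show "count (filter_mset (\<lambda>p. fst p = k + 5 + t) N) p
          = count (replicate_mset (nat (lookup c t)) (k + 5 + t, k + 5 + t)) p"
      proof (cases "p = (k + 5 + t, k + 5 + t)")
        case True
        then show ?thesis using cnt[OF True] by simp
      next
        case False
        then have "fst p \<noteq> k + 5 + t \<or> p \<notin># N" using mem by blast
        then show ?thesis using False by (auto simp: not_in_iff)
      qed
    qed
    finally show ?thesis using c that by simp
  qed
  have "toric_vec k m e = c"
  proof (rule poly_mapping_eqI)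
    fix z
    consider "z < m" | j where "z = m + j" "j \<le> k + 1" | j where "z = m + k + 2 + j" "j \<le> k" | "m + 2 * k + 3 \<le> z"
      using index_cases .
    then show "lookup (toric_vec k m e) z = lookup c z"
    proof cases
      case (3 j)
      show ?thesis unfolding 3(1) M(3)[OF 3(2)] toric_vec_lookups(3)[OF 3(2)] u ..
    next
      case 4
      then have "z \<notin> keys c" using c by auto
      then show ?thesis using 4 by (simp add: lookup_toric_vec in_keys_iff)
    qed (use M(2,3) u v s in \<open>simp_all add: toric_vec_lookups del: add_Suc_right\<close>)
  qed
  then show ?thesis using e by blast
qed

text \<open>The exponents of all elements concerned lie in \<open>S\<close>, so injectivity there
  makes coefficients match one to one.\<close>

lemma monoid_alg_iso:
  fixes \<theta> :: "'m::comm_monoid_add \<Rightarrow> 'n::comm_monoid_add"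
  assumes S: "is_submonoid S" and add: "\<And>x y. \<theta> (x + y) = \<theta> x + \<theta> y" and zero: "\<theta> 0 = 0"
    and inj: "inj_on \<theta> S"
  shows "alg_iso (monoid_alg S :: ('k::field, 'm \<Rightarrow>\<^sub>0 'k) module) (monoid_alg (\<theta> ` S)) \<noteq> {}"
proof -
  interpret scalar_hom "\<lambda>c::'k. single (0::'n) c" by (rule scalar_hom_single)
  define h where "h = mlift (single 0) (\<lambda>e. single (\<theta> e) (1::'k))"
  have keys: "keys (h p) \<subseteq> \<theta> ` keys p" for p unfolding h_def by (rule keys_mlift_single)
  have mult: "h (p * q) = h p * h q" for p q
    unfolding h_def by (rule mlift_mult) (simp add: add mult_single)
  have h_add: "h (p + q) = h p + h q" for p q unfolding h_def by (rule mlift_add)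
  have single: "h (single e c) = single (\<theta> e) c" for e c
    unfolding h_def mlift_single by (simp add: mult_single)
  have look: "lookup (h p) (\<theta> e) = lookup p e" if "keys p \<subseteq> S" "e \<in> S" for p e
  proof -
    have "{m \<in> keys p. \<theta> m = \<theta> e} = (if e \<in> keys p then {e} else {})"
      using that inj by (auto dest: inj_onD)
    then show ?thesis
      unfolding h_def lookup_mlift_single by (simp add: in_keys_iff)
  qed
  have "h \<in> ring_hom (monoid_alg S) (monoid_alg (\<theta> ` S))"
  proof (rule ring_hom_memI)
    show "h \<one>\<^bsub>monoid_alg S\<^esub> = \<one>\<^bsub>monoid_alg (\<theta> ` S)\<^esub>"
      using single[of 0 1] by (simp add: zero)
  next
    fix p :: "'m \<Rightarrow>\<^sub>0 'k" assume "p \<in> carrier (monoid_alg S)"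
    then show "h p \<in> carrier (monoid_alg (\<theta> ` S))" using keys[of p] by fastforce
  qed (simp_all add: mult h_add)
  moreover have "bij_betw h (carrier (monoid_alg S)) (carrier (monoid_alg (\<theta> ` S)))"
  proof (rule bij_betwI')
    fix p q :: "'m \<Rightarrow>\<^sub>0 'k" assume pq: "p \<in> carrier (monoid_alg S)" "q \<in> carrier (monoid_alg S)"
    show "(h p = h q) = (p = q)"
    proof
      assume eq: "h p = h q"
      show "p = q"
      proof (rule poly_mapping_eqI)
        fix e show "lookup p e = lookup q e"
        proof (cases "e \<in> S")
          case False
          then have "e \<notin> keys p" "e \<notin> keys q" using pq by auto
          then show ?thesis by (simp add: in_keys_iff)
        qed (use look[of p e] look[of q e] pq eq in simp)
      qed
    qed simp
  next
    fix p :: "'m \<Rightarrow>\<^sub>0 'k" assume "p \<in> carrier (monoid_alg S)"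
    then show "h p \<in> carrier (monoid_alg (\<theta> ` S))" using keys[of p] by fastforce
  next
    fix q :: "'n \<Rightarrow>\<^sub>0 'k" assume q: "q \<in> carrier (monoid_alg (\<theta> ` S))"
    define p where "p = (\<Sum>e\<in>keys q. single (inv_into S \<theta> e) (lookup q e))"
    have "keys p \<subseteq> (\<Union>e\<in>keys q. keys (single (inv_into S \<theta> e) (lookup q e)))"
      unfolding p_def by (rule keys_sum)
    also have "\<dots> \<subseteq> S"
    proof
      fix x assume "x \<in> (\<Union>e\<in>keys q. keys (single (inv_into S \<theta> e) (lookup q e)))"
      then obtain e where "e \<in> keys q" "x = inv_into S \<theta> e" by (auto split: if_splits)
      then show "x \<in> S" using q by (simp add: inv_into_into subset_iff)
    qed
    finally have "p \<in> carrier (monoid_alg S)" by simp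
    moreover have "h p = (\<Sum>e\<in>keys q. h (single (inv_into S \<theta> e) (lookup q e)))"
      unfolding p_def h_def by (rule mlift_sum)
    then have "h p = (\<Sum>e\<in>keys q. single e (lookup q e))"
      using q by (simp add: single f_inv_into_f subset_iff)
    then have "q = h p" by (simp flip: poly_mapping_sum_single)
    ultimately show "\<exists>p\<in>carrier (monoid_alg S). q = h p" by blast
  qed
  moreover have "h (c \<odot>\<^bsub>monoid_alg S\<^esub> p) = c \<odot>\<^bsub>monoid_alg (\<theta> ` S)\<^esub> h p" for c p
    by (simp add: mult single zero)
  ultimately have "h \<in> alg_iso (monoid_alg S) (monoid_alg (\<theta> ` S))" unfolding alg_iso_def ring_iso_def by blast
  then show ?thesis by blast
qed

lemma ext_lattice_toric:
  "\<exists>(d::nat) \<sigma>. rational_cone {..<d} \<sigma> \<and> strongly_convex \<sigma> \<and>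
    (monoid_alg (hibi_monoid (ext_lattice k m)) :: ('k::field, bimon \<Rightarrow>\<^sub>0 'k) module) \<cong>\<^sub>K toric_alg {..<d} \<sigma>"
proof -
  have "rational_cone {..<m + 2 * k + 3} (toric_cone k m)"
    unfolding rational_cone_def toric_cone_def
    by (intro exI[of _ "toric_gens k m"] conjI ballI finite_toric_gens keys_toric_gens refl)
  moreover have img: "toric_vec k m ` hibi_monoid (ext_lattice k m)
      = {c. lattice_vec c \<in> dual_cone {..<m + 2 * k + 3} (toric_cone k m)}"
    using toric_vec_dual toric_vec_surj by blast
  have "(monoid_alg (hibi_monoid (ext_lattice k m)) :: ('k, bimon \<Rightarrow>\<^sub>0 'k) module)
      \<cong>\<^sub>K toric_alg {..<m + 2 * k + 3} (toric_cone k m)"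
    unfolding alg_isomorphic_def toric_alg_def img[symmetric]
    by (rule monoid_alg_iso[OF submonoid_hibi toric_vec_add toric_vec_0 toric_vec_inj])
  ultimately show ?thesis using strongly_convex_toric by blast
qed

section \<open>Transfer along isomorphisms\<close>

text \<open>All identifications start at the semigroup algebra, so one of the two isomorphisms has
  to be inverted.\<close>

lemma alg_isomorphic_common:
  assumes B: "alg_embedding B (\<lambda>x. x) \<kappa>" and h: "h \<in> alg_iso B C" and g: "alg_iso B D \<noteq> {}"
  shows "C \<cong>\<^sub>K D"
proof -
  interpret B: alg_embedding B "\<lambda>x. x" \<kappa> by fact
  obtain g where g: "g \<in> alg_iso B D" using g by blast
  let ?k = "inv_into (carrier B) h"
  have h': "h \<in> ring_iso B C" and g': "g \<in> ring_iso B D" using h g by (simp_all add: alg_iso_def)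
  have "ring B" using B.is_cring by (simp add: cring_def)
  then have k: "?k \<in> ring_iso C B" using h' by (rule ring_iso_set_sym)
  have bij: "bij_betw h (carrier B) (carrier C)" using h' by (simp add: ring_iso_def)
  have "(g \<circ> ?k) (c \<odot>\<^bsub>C\<^esub> x) = c \<odot>\<^bsub>D\<^esub> (g \<circ> ?k) x" if x: "x \<in> carrier C" for c x
  proof -
    have kx: "?k x \<in> carrier B" "h (?k x) = x"
      using x bij by (auto simp: bij_betw_def inv_into_into f_inv_into_f)
    then have "c \<odot>\<^bsub>C\<^esub> x = h (c \<odot>\<^bsub>B\<^esub> ?k x)" using h by (auto simp: alg_iso_def)
    moreover have "?k (h (c \<odot>\<^bsub>B\<^esub> ?k x)) = c \<odot>\<^bsub>B\<^esub> ?k x"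
      using bij B.smult_in[OF kx(1)] by (simp add: bij_betw_def)
    ultimately show ?thesis using g kx(1) by (simp add: alg_iso_def)
  qed
  then have "g \<circ> ?k \<in> alg_iso C D"
    using ring_iso_set_trans[OF k g'] by (simp add: alg_iso_def)
  then show ?thesis unfolding alg_isomorphic_def by blast
qed

lemma (in tangent_model) tangent_cone_cring: "cring (tangent_cone V X P)"
proof -
  interpret B: cring "monoid_alg S :: ('k, 'm \<Rightarrow>\<^sub>0 'k) module"
    by (rule MA_cring[OF S])
  \<comment> \<open>Transport along an isomorphism provides the ring structure with the image of 0
    as its zero; \<open>G.sym_zero\<close> identifies it with the given one.\<close>
  have "cring (tangent_cone V X P \<lparr>ring.zero := \<Psi> \<zero>\<^bsub>monoid_alg S\<^esub>\<rparr>)"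
    by (rule B.ring_iso_imp_img_cring) (use sym_iso in \<open>simp add: alg_iso_def\<close>)
  moreover have "\<Psi> \<zero>\<^bsub>monoid_alg S\<^esub> = \<zero>\<^bsub>tangent_cone V X P\<^esub>"
    using G.sym_zero by (simp add: hseries_zero tangent_cone_def)
  ultimately show ?thesis by simp
qed

section \<open>The Hilbert function as a count of exponents\<close>

lemma constants_subfield:
  assumes S: "is_submonoid S"
  shows "subfield (Set.range (single 0)) (monoid_alg S :: ('k::field, 'm::comm_monoid_add \<Rightarrow>\<^sub>0 'k) module)"
proof -
  let ?B = "monoid_alg S :: ('k, 'm \<Rightarrow>\<^sub>0 'k) module" and ?K = "Set.range (single 0) :: ('m \<Rightarrow>\<^sub>0 'k) set"
  interpret E: alg_embedding ?B "\<lambda>x. x" "single 0" by (rule alg_embedding_monoid_alg[OF S])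
  interpret B: cring ?B by (rule E.is_cring)
  have carr: "?K \<subseteq> carrier ?B" using S by (auto simp: is_submonoid_def split: if_splits)
  have "subring ?K ?B"
  proof (rule B.subringI[OF carr])
    show "\<one>\<^bsub>?B\<^esub> \<in> ?K" using single_one[where 'a='m and 'b='k] by (metis monoid_alg_sel(3) rangeI)
    show "\<ominus>\<^bsub>?B\<^esub> h \<in> ?K" if "h \<in> ?K" for h
    proof -
      obtain c where c: "h = single 0 c" using \<open>h \<in> ?K\<close> by blast
      have "h \<in> carrier ?B" using \<open>h \<in> ?K\<close> carr by blast
      then have "\<ominus>\<^bsub>?B\<^esub> h = single 0 (- c)" using E.h_a_inv[of h] c by (simp add: single_uminus)
      then show ?thesis by blast
    qed
    show "h \<otimes>\<^bsub>?B\<^esub> h' \<in> ?K" if "h \<in> ?K" "h' \<in> ?K" for h h'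
      using that by (auto simp: mult_single)
    show "h \<oplus>\<^bsub>?B\<^esub> h' \<in> ?K" if "h \<in> ?K" "h' \<in> ?K" for h h'
      using that by (auto simp flip: single_add)
  qed
  then have "subcring ?K ?B" by (rule B.subcringI')
  moreover have "Units (?B \<lparr>carrier := ?K\<rparr>) = ?K - {\<zero>\<^bsub>?B\<^esub>}"
  proof (intro equalityI subsetI)
    fix x assume "x \<in> Units (?B \<lparr>carrier := ?K\<rparr>)"
    then show "x \<in> ?K - {\<zero>\<^bsub>?B\<^esub>}" by (auto simp: Units_def)
  next
    fix x assume "x \<in> ?K - {\<zero>\<^bsub>?B\<^esub>}"
    then obtain c where c: "x = single 0 c" "c \<noteq> 0" by (metis Diff_iff monoid_alg_sel(4) imageE insertI1 single_zero)
    then have "single 0 (inverse c) * x = 1" by (simp add: mult_single)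
    then show "x \<in> Units (?B \<lparr>carrier := ?K\<rparr>)"
      using c unfolding Units_def by (auto simp: mult.commute intro!: bexI[of _ "single 0 (inverse c)"])
  qed
  ultimately show ?thesis by (rule B.subfieldI)
qed

lemma monoid_alg_dimension:
  assumes S: "is_submonoid S" and "finite T" "T \<subseteq> S"
  shows "ring.dimension (monoid_alg S :: ('k::field, 'm::comm_monoid_add \<Rightarrow>\<^sub>0 'k) module)
    (card T) (Set.range (single 0)) {b. keys b \<subseteq> T}"
proof -
  let ?B = "monoid_alg S :: ('k, 'm \<Rightarrow>\<^sub>0 'k) module" and ?K = "Set.range (single 0) :: ('m \<Rightarrow>\<^sub>0 'k) set"
  interpret B: cring ?B by (rule MA_cring[OF S])
  show ?thesis using assms(2,3)
  proof (induction T rule: finite_induct)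
    case empty
    have "{b :: 'm \<Rightarrow>\<^sub>0 'k. keys b \<subseteq> {}} = {\<zero>\<^bsub>?B\<^esub>}" by auto
    then show ?case using B.zero_dim by simp
  next
    case (insert e T)
    have "B.dimension (Suc (card T)) ?K (B.line_extension ?K (single e 1) {b. keys b \<subseteq> T})"
      by (rule B.Suc_dim) (use insert in auto)
    moreover have "B.line_extension ?K (single e 1) {b. keys b \<subseteq> T} = {b. keys b \<subseteq> insert e T}"
    proof (intro equalityI subsetI)
      fix u assume "u \<in> B.line_extension ?K (single e 1) {b. keys b \<subseteq> T}"
      then obtain c v where "u = single 0 c * single e 1 + v" "keys v \<subseteq> T"
        unfolding B.line_extension_mem_iff by auto
      then show "u \<in> {b. keys b \<subseteq> insert e T}"
        using Poly_Mapping.keys_add[of "single e c" v] by (auto simp: mult_single split: if_splits)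
    next
      fix u :: "'m \<Rightarrow>\<^sub>0 'k" assume u: "u \<in> {b. keys b \<subseteq> insert e T}"
      have "keys (u - single e (lookup u e)) \<subseteq> T"
      proof
        fix x assume "x \<in> keys (u - single e (lookup u e))"
        then have "x \<noteq> e" "x \<in> keys u" by (auto simp: in_keys_iff lookup_minus lookup_single when_def split: if_splits)
        then show "x \<in> T" using u by auto
      qed
      moreover have "u = single 0 (lookup u e) * single e 1 + (u - single e (lookup u e))"
        by (simp add: mult_single)
      ultimately show "u \<in> B.line_extension ?K (single e 1) {b. keys b \<subseteq> T}"
        unfolding B.line_extension_mem_iff monoid_alg_sel by blast
    qed
    ultimately show ?case using insert by simp
  qed
qed

text \<open>The dimension is transported along \<Psi>, which maps the constants of the monoid
  algebra onto the image of K in \<open>G\<close>.\<close>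

lemma hilbert_fun_eq_card:
  fixes \<Psi> :: "('m::comm_monoid_add \<Rightarrow>\<^sub>0 'k::field) \<Rightarrow> 'a"
  assumes S: "is_submonoid S" and \<Psi>: "\<Psi> \<in> alg_iso (monoid_alg S) G" and G: "cring G"
    and T: "finite T" "T \<subseteq> S" "\<Psi> ` {b. keys b \<subseteq> T} = c q"
  shows "hilbert_fun G c q = card T"
proof -
  let ?B = "monoid_alg S :: ('k, 'm \<Rightarrow>\<^sub>0 'k) module" and ?K = "Set.range (single 0) :: ('m \<Rightarrow>\<^sub>0 'k) set"
  interpret E: alg_embedding ?B "\<lambda>x. x" "single 0" by (rule alg_embedding_monoid_alg[OF S])
  interpret B: cring ?B by (rule E.is_cring)
  interpret G: cring G by fact
  have iso: "\<Psi> \<in> ring_iso ?B G" and lin: "\<And>c x. x \<in> carrier ?B \<Longrightarrow> \<Psi> (c \<odot>\<^bsub>?B\<^esub> x) = c \<odot>\<^bsub>G\<^esub> \<Psi> x"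
    using \<Psi> by (auto simp: alg_iso_def)
  interpret h: ring_hom_ring ?B G \<Psi>
    using iso by (intro ring_hom_ringI2 B.ring_axioms G.ring_axioms) (simp add: ring_iso_def)
  have inj: "inj_on \<Psi> (carrier ?B)" using iso by (simp add: ring_iso_def bij_betw_def)
  have sub: "subfield ?K ?B" by (rule constants_subfield[OF S])
  have nz: "\<one>\<^bsub>G\<^esub> \<noteq> \<zero>\<^bsub>G\<^esub>"
  proof
    assume "\<one>\<^bsub>G\<^esub> = \<zero>\<^bsub>G\<^esub>"
    then have "\<Psi> \<one>\<^bsub>?B\<^esub> = \<Psi> \<zero>\<^bsub>?B\<^esub>" by (simp only: h.hom_one h.hom_zero)
    from inj_onD[OF inj this B.one_closed B.zero_closed] have "\<one>\<^bsub>?B\<^esub> = \<zero>\<^bsub>?B\<^esub>" .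
    then show False by simp
  qed
  have "G.dimension (card T) (\<Psi> ` ?K) (\<Psi> ` {b. keys b \<subseteq> T})"
  proof (rule h.inj_hom_dimension[OF sub nz])
    show "inj_on \<Psi> {b. keys b \<subseteq> T}" by (rule inj_on_subset[OF inj]) (use T in auto)
  qed (rule monoid_alg_dimension[OF S T(1,2)])
  moreover have "\<Psi> ` ?K = Set.range (\<lambda>x. x \<odot>\<^bsub>G\<^esub> \<one>\<^bsub>G\<^esub>)"
  proof -
    have "\<Psi> (single 0 x) = x \<odot>\<^bsub>G\<^esub> \<one>\<^bsub>G\<^esub>" for x
      using lin[OF B.one_closed, of x] by (simp flip: h.hom_one)
    then show ?thesis by (simp add: image_image)
  qed
  ultimately have "G.dimension (card T) (Set.range (\<lambda>x. x \<odot>\<^bsub>G\<^esub> \<one>\<^bsub>G\<^esub>)) (c q)" by (simp add: T(3))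
  moreover have "subfield (Set.range (\<lambda>x. x \<odot>\<^bsub>G\<^esub> \<one>\<^bsub>G\<^esub>)) G"
    using h.img_is_subfield(2)[OF sub nz] \<open>\<Psi> ` ?K = _\<close> by simp
  ultimately show ?thesis
    unfolding hilbert_fun_def using G.dimI by (simp add: over_def)
qed

section \<open>Catalan numbers\<close>

text \<open>Ballot numbers in the form given by the reflection principle: paths with p steps of one
  kind and q of the other, never having more of the second. The case q = 0 is separate because q - 1
  would be truncated to 0.\<close>

definition ballot :: "nat \<Rightarrow> nat \<Rightarrow> rat"
  where "ballot p q = of_nat ((p + q) choose q) - (if q = 0 then 0 else of_nat ((p + q) choose (q - 1)))"

lemma ballot_Suc: "ballot (Suc p) (Suc q) = ballot (Suc p) q + ballot p (Suc q)"
proof (cases q)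
  case (Suc r)
  have "(Suc p + Suc q) choose (Suc q) = ((Suc p + q) choose q) + ((p + Suc q) choose (Suc q))"
    by simp
  moreover have "(Suc p + Suc q) choose q = ((Suc p + q) choose r) + ((p + Suc q) choose q)"
    by (simp add: Suc)
  ultimately show ?thesis by (simp add: ballot_def Suc del: binomial_Suc_Suc)
qed (simp add: ballot_def)

lemma ballot_0: "ballot p 0 = 1"
  by (simp add: ballot_def)

text \<open>The boundary value just beyond the diagonal: in the recursion it stands for a missing
  predecessor.\<close>

lemma ballot_diag: "ballot p (Suc p) = 0"
  using binomial_symmetric[of "Suc p" "p + Suc p"] by (simp add: ballot_def del: binomial_Suc_Suc)

text \<open>A path that ends one step before the diagonal has a forced continuation, hence the
  Catalan number of the next index. In the computation both sides become 2/(p + 2) times the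
  binomial coefficient of 2p + 1 over p.\<close>

lemma ballot_catalan: "ballot (Suc p) p = catalan (Suc p)"
proof -
  define N where "N = p + Suc p"
  have "Suc N choose Suc p = (N choose p) + (N choose Suc p)" by (rule binomial_Suc_Suc)
  also have "N choose Suc p = N choose p"
    using binomial_symmetric[of "Suc p" N] by (simp add: N_def)
  finally have "Suc N choose Suc p = 2 * (N choose p)" by simp
  moreover have "2 * Suc p = Suc N" by (simp add: N_def)
  ultimately have cat: "catalan (Suc p) = 2 * of_nat (N choose p) / of_nat (p + 2)"
    unfolding catalan_def by (simp del: binomial_Suc_Suc)
  show ?thesis
  proof (cases p)
    case (Suc r)
    have "Suc r * (N choose Suc r) = (N - r) * (N choose r)"
    proof -
      have "Suc r * (N choose Suc r) = N * (N - 1 choose r)"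
        using Suc_times_binomial[of r "N - 1"] by (simp add: N_def)
      also have "\<dots> = (N - r) * (N choose r)"
        using binomial_absorb_comp[of N r] by simp
      finally show ?thesis .
    qed
    moreover have "N - r = p + 2" by (simp add: N_def Suc)
    ultimately have "of_nat p * of_nat (N choose p) = (of_nat (p + 2) * of_nat (N choose r) :: rat)"
      unfolding of_nat_mult[symmetric] using Suc by simp
    then have *: "of_nat (N choose r) = of_nat p * (of_nat (N choose p) :: rat) / of_nat (p + 2)"
      by (simp add: field_simps del: of_nat_add)
    have "ballot (Suc p) p = of_nat (N choose p) - of_nat (N choose r)"
      using Suc by (simp add: ballot_def N_def add.commute)
    also have "\<dots> = 2 * of_nat (N choose p) / of_nat (p + 2)"
      unfolding * by (simp add: field_simps)
    finally show ?thesis using cat by simp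
  qed (simp add: ballot_def catalan_def)
qed

section \<open>Rank function and maximal chains of the extended lattice\<close>

definition ext_rank :: "nat \<Rightarrow> nat \<times> nat \<Rightarrow> nat"
  where "ext_rank k = (\<lambda>(a, b). if k + 5 \<le> a then 2 * k + 3 + (a - (k + 5)) else a + b - 4)"

text \<open>The number of maximal chains below an element. A chain from (1, 3) to (a, b) is a ballot
  path from (1, 0) to (b - 2, a - 1), where a < b becomes a - 1 \<le> b - 2; along the added chain
  the number stays constant.\<close>

definition ext_chains :: "nat \<Rightarrow> nat \<times> nat \<Rightarrow> rat"
  where "ext_chains k = (\<lambda>(a, b). if k + 5 \<le> a then ballot (k + 2) (k + 1) else ballot (b - 2) (a - 1))"

lemma ext_rank_mono:
  assumes "\<alpha> \<in> ext_lattice k m" "\<beta> \<in> ext_lattice k m" "\<beta> < \<alpha>"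
  shows "ext_rank k \<beta> < ext_rank k \<alpha>"
  using assms by (cases \<alpha>; cases \<beta>)
    (auto simp: ext_lattice_iff ext_rank_def less_le_not_le less_eq_prod_def)

lemma ext_chains_0: "\<alpha> \<in> ext_lattice k m \<Longrightarrow> ext_rank k \<alpha> = 0 \<Longrightarrow> ext_chains k \<alpha> = 1"
  by (cases \<alpha>) (auto simp: ext_lattice_iff ext_rank_def ext_chains_def ballot_0)

lemma ext_chains_rec:
  assumes \<alpha>: "\<alpha> \<in> ext_lattice k m" and r: "0 < ext_rank k \<alpha>"
  shows "ext_chains k \<alpha> = (\<Sum>\<beta>\<in>{\<beta> \<in> ext_lattice k m. \<beta> < \<alpha> \<and> Suc (ext_rank k \<beta>) = ext_rank k \<alpha>}. ext_chains k \<beta>)"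
proof -
  obtain a b where ab: "\<alpha> = (a, b)" by (cases \<alpha>)
  let ?S = "{\<beta> \<in> ext_lattice k m. \<beta> < \<alpha> \<and> Suc (ext_rank k \<beta>) = ext_rank k \<alpha>}"
  have mem: "(x, y) \<in> ?S \<longleftrightarrow> (x, y) \<in> ext_lattice k m \<and> x \<le> a \<and> y \<le> b \<and> \<not> (a \<le> x \<and> b \<le> y)
      \<and> Suc (ext_rank k (x, y)) = ext_rank k (a, b)" for x y
    by (auto simp: ab less_le_not_le less_eq_prod_def)
  show ?thesis
  proof (cases "k + 5 \<le> a")
    case True
    then have b: "b = a" "a < k + 5 + m" using \<alpha> by (auto simp: ab ext_lattice_iff)
    show ?thesis
    proof (cases "a = k + 5")
      case True
      \<comment> \<open>The first added element has only one predecessor, the largest element of the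
        truncated lattice.\<close>
      have "(x, y) \<in> ?S \<longleftrightarrow> x = k + 2 \<and> y = k + 4" for x y
        unfolding mem unfolding ext_lattice_iff ext_rank_def using b True by (cases "k + 5 \<le> x") (simp_all, arith)
      then have "?S = {(k + 2, k + 4)}" by fast
      then show ?thesis using True by (simp add: ab ext_chains_def)
    next
      case False
      then have "(x, y) \<in> ?S \<longleftrightarrow> x = a - 1 \<and> y = a - 1" for x y
        unfolding mem unfolding ext_lattice_iff ext_rank_def using b True by (cases "k + 5 \<le> x") (simp_all, arith+)
      then have "?S = {(a - 1, a - 1)}" by fast
      moreover have "k + 5 \<le> a - 1" using \<open>k + 5 \<le> a\<close> False by arith
      ultimately show ?thesis using \<open>k + 5 \<le> a\<close> by (simp add: ab ext_chains_def)
    qed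
  next
    case False
    then have c: "1 \<le> a" "a \<le> k + 2" "3 \<le> b" "b \<le> k + 4" "a < b" "4 < a + b"
      using \<alpha> r by (auto simp: ab ext_lattice_iff ext_rank_def)
    have S: "?S = {\<beta>. (\<beta> = (a - 1, b) \<and> 2 \<le> a) \<or> (\<beta> = (a, b - 1) \<and> 4 \<le> b \<and> a < b - 1)}"
    proof (intro equalityI subsetI)
      fix \<beta> assume \<beta>: "\<beta> \<in> ?S"
      obtain x y where xy: "\<beta> = (x, y)" by (cases \<beta>)
      have "x \<le> a" "y \<le> b" "x + y + 1 = a + b" "1 \<le> x" "3 \<le> y" "x < y"
        using \<beta> c by (auto simp: xy ab ext_lattice_iff ext_rank_def less_le_not_le less_eq_prod_def split: if_splits)
      then have "(x = a - 1 \<and> y = b \<and> 2 \<le> a) \<or> (x = a \<and> y = b - 1 \<and> 4 \<le> b \<and> a < b - 1)" by arith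
      then show "\<beta> \<in> {\<beta>. (\<beta> = (a - 1, b) \<and> 2 \<le> a) \<or> (\<beta> = (a, b - 1) \<and> 4 \<le> b \<and> a < b - 1)}"
        by (auto simp: xy)
    next
      fix \<beta> assume "\<beta> \<in> {\<beta>. (\<beta> = (a - 1, b) \<and> 2 \<le> a) \<or> (\<beta> = (a, b - 1) \<and> 4 \<le> b \<and> a < b - 1)}"
      then show "\<beta> \<in> ?S"
        using c by (auto simp: ab ext_lattice_iff ext_rank_def less_le_not_le less_eq_prod_def)
    qed
    have "\<not> k + 5 \<le> a" "\<not> k + 5 \<le> a - 1" using c by arith+
    then have val: "ext_chains k (a, b) = ballot (b - 2) (a - 1)" "ext_chains k (a, b - 1) = ballot (b - 1 - 2) (a - 1)"
      "ext_chains k (a - 1, b) = ballot (b - 2) (a - 1 - 1)"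
      by (simp_all add: ext_chains_def)
    show ?thesis
    proof (cases "2 \<le> a")
      case False
      then have "a = 1" "4 \<le> b" using c by auto
      then have "?S = {(a, b - 1)}" unfolding S by auto
      then show ?thesis using val \<open>a = 1\<close> by (simp add: ab ballot_0)
    next
      case True
      obtain q where q: "a = q + 2" using True by (metis add.commute le_Suc_ex)
      obtain p where p: "b = p + 3" using c(3) by (metis add.commute le_Suc_ex)
      have rec: "ext_chains k (a, b) = ballot (b - 2) (a - 1 - 1) + ballot p (Suc q)"
        using val(1) ballot_Suc[of p q] by (simp add: p q)
      show ?thesis
      proof (cases "a < b - 1")
        case True
        then have "?S = {(a - 1, b), (a, b - 1)}" unfolding S using \<open>2 \<le> a\<close> by auto
        moreover have "(a - 1, b) \<noteq> (a, b - 1)" using \<open>2 \<le> a\<close> by simp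
        moreover have "ext_chains k (a, b - 1) = ballot p (Suc q)" using val(2) by (simp add: p q)
        ultimately show ?thesis using rec val(3) by (simp add: ab)
      next
        case False
        then have "b = a + 1" using c by simp
        \<comment> \<open>For b = a + 1 the predecessor (a, b - 1) is absent, and its term in the
          ballot recursion is 0.\<close>
        then have "ballot p (Suc q) = 0" using ballot_diag[of p] by (simp add: p q)
        moreover have "?S = {(a - 1, b)}" unfolding S using \<open>2 \<le> a\<close> False by auto
        ultimately show ?thesis using rec val(3) by (simp add: ab)
      qed
    qed
  qed
qed

lemma ext_lattice_invariants:
  assumes m: "1 \<le> m"
  shows "krull_dim (monoid_alg (hibi_monoid (ext_lattice k m)) :: ('k::field, bimon \<Rightarrow>\<^sub>0 'k) module) = enat (2 * k + 3 + m)"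
    and "\<exists>p. (\<forall>j. of_nat (card (layer (ext_lattice k m) j)) = Polynomial.poly p (of_nat j))
      \<and> Polynomial.degree p \<le> 2 * k + 2 + m \<and> Polynomial.coeff p (2 * k + 2 + m) = catalan (k + 2) / fact (2 * k + 2 + m)"
    and "finite (layer (ext_lattice k m) j)"
proof -
  let ?L = "ext_lattice k m"
  define top where "top = (k + 5 + (m - 1), k + 5 + (m - 1))"
  have top: "top \<in> ?L" "?L \<subseteq> {..top}" "?L \<inter> {..top} = ?L"
    using m by (auto simp: top_def ext_lattice_iff less_eq_prod_def)
  have rtop: "ext_rank k top = 2 * k + 2 + m" using m by (simp add: top_def ext_rank_def)
  have etop: "ext_chains k top = catalan (k + 2)"
    using ballot_catalan[of "k + 1"] by (simp add: top_def ext_chains_def)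
  have "\<exists>c. binom_expansion (\<lambda>j. card (layer (?L \<inter> {..top}) j)) (ext_rank k top) c
      \<and> c (ext_rank k top) = ext_chains k top"
    by (rule layer_binom_expansion[OF sublattice_ext finite_ext])
      (assumption | rule ext_rank_mono ext_chains_0 ext_chains_rec top(1))+
  then obtain c where c: "binom_expansion (\<lambda>j. card (layer ?L j)) (2 * k + 2 + m) c" "c (2 * k + 2 + m) = catalan (k + 2)"
    unfolding rtop etop top(3) by blast
  show "\<exists>p. (\<forall>j. of_nat (card (layer ?L j)) = Polynomial.poly p (of_nat j))
      \<and> Polynomial.degree p \<le> 2 * k + 2 + m \<and> Polynomial.coeff p (2 * k + 2 + m) = catalan (k + 2) / fact (2 * k + 2 + m)"
    using binom_expansion_poly[OF c(1)] c(2) by metis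
  show "finite (layer ?L j)" using finite_layer_below[OF sublattice_ext finite_ext, of k m top j] top(3) by simp
  \<comment> \<open>A maximal chain: the second coordinate grows from 3 to k + 4, then the first one
    from 1 to k + 2, then the added elements follow.\<close>
  define \<gamma> where "\<gamma> t = (if t \<le> k + 1 then (1, 3 + t) else if t \<le> 2 * k + 2 then (t - k, k + 4)
    else (k + 5 + (t - (2 * k + 3)), k + 5 + (t - (2 * k + 3))))" for t
  have "krull_dim (monoid_alg (hibi_monoid ?L) :: ('k, bimon \<Rightarrow>\<^sub>0 'k) module) = enat (Suc (2 * k + 2 + m))"
  proof (rule krull_dim_hibi[OF sublattice_ext finite_ext top(1,2) c(1)])
    show "\<gamma> t \<in> ?L" if "t \<le> 2 * k + 2 + m" for t
      using that by (auto simp: \<gamma>_def ext_lattice_iff)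
    show "\<gamma> s < \<gamma> t" if "s < t" "t \<le> 2 * k + 2 + m" for s t
      using that by (auto simp: \<gamma>_def less_le_not_le less_eq_prod_def)
  qed
  then show "krull_dim (monoid_alg (hibi_monoid ?L) :: ('k, bimon \<Rightarrow>\<^sub>0 'k) module) = enat (2 * k + 3 + m)"
    by (simp add: numeral_eq_Suc)
qed

section \<open>The local structure of the Grassmannian of lines along a face\<close>

lemma poly_eval_cong:
  assumes "f \<in> carrier (poly_alg V)" "\<And>v. v \<in> V \<Longrightarrow> x v = y v"
  shows "poly_eval x f = poly_eval y f"
  unfolding poly_eval_def
proof (rule sum.cong)
  fix m assume "m \<in> keys f"
  then have "keys m \<subseteq> V" using assms(1) by (simp add: poly_carrier)
  then have "(\<Prod>v\<in>keys m. x v ^ lookup m v) = (\<Prod>v\<in>keys m. y v ^ lookup m v)"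
    using assms(2) by (intro prod.cong) auto
  then show "lookup f m * (\<Prod>v\<in>keys m. x v ^ lookup m v) = lookup f m * (\<Prod>v\<in>keys m. y v ^ lookup m v)"
    by simp
qed simp

section \<open>The product with an affine space as a planar Hibi variety\<close>

lemma mem_hibi_variety:
  "x \<in> hibi_variety L \<longleftrightarrow> x \<in> affine_space L \<and> (\<forall>\<alpha>\<in>L. \<forall>\<beta>\<in>L. x \<alpha> * x \<beta> = x (sup \<alpha> \<beta>) * x (inf \<alpha> \<beta>))"
proof -
  have "(\<forall>f\<in>hibi_binomials L. poly_eval x f = 0) \<longleftrightarrow> (\<forall>\<alpha>\<in>L. \<forall>\<beta>\<in>L. poly_eval x
      (poly_var \<alpha> * poly_var \<beta> - poly_var (sup \<alpha> \<beta>) * poly_var (inf \<alpha> \<beta>)) = 0)"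
    unfolding hibi_binomials_def by blast
  then show ?thesis by (simp add: hibi_variety_def zero_locus_def poly_eval_simps)
qed

lemma planar_hibi_variety:
  assumes L: "sublattice L"
  shows "planar_hibi L (\<lambda>\<alpha>. \<alpha>) (hibi_variety L :: (nat \<times> nat \<Rightarrow> 'k::alg_closed_field) set)"
proof
  show "sublattice ((\<lambda>\<alpha>. \<alpha>) ` L)" using L by simp
  show "hibi_variety L = {x :: nat \<times> nat \<Rightarrow> 'k. x \<in> affine_space L \<and> (\<forall>a\<in>L. \<forall>b\<in>L. \<forall>c\<in>L. \<forall>d\<in>L.
      c = sup a b \<longrightarrow> d = inf a b \<longrightarrow> x a * x b = x c * x d)}" (is "_ = ?R")
  proof (intro equalityI subsetI)
    fix x :: "nat \<times> nat \<Rightarrow> 'k" assume "x \<in> hibi_variety L"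
    then show "x \<in> ?R" unfolding mem_hibi_variety by blast
  next
    fix x :: "nat \<times> nat \<Rightarrow> 'k" assume x: "x \<in> ?R"
    have "x \<alpha> * x \<beta> = x (sup \<alpha> \<beta>) * x (inf \<alpha> \<beta>)" if "\<alpha> \<in> L" "\<beta> \<in> L" for \<alpha> \<beta>
    proof -
      have "sup \<alpha> \<beta> \<in> L" "inf \<alpha> \<beta> \<in> L" using L that by (simp_all add: sublattice_def)
      then show ?thesis using x that by blast
    qed
    then show "x \<in> hibi_variety L" using x unfolding mem_hibi_variety by blast
  qed
qed simp

lemma sublattice_I2: "sublattice (I2 n)"
  unfolding sublattice_def
proof (intro ballI)
  fix \<alpha> \<beta> assume "\<alpha> \<in> I2 n" "\<beta> \<in> I2 n"
  then show "sup \<alpha> \<beta> \<in> I2 n \<and> inf \<alpha> \<beta> \<in> I2 n"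
    by (cases \<alpha>; cases \<beta>)
      (auto simp: I2_def sup_prod_def inf_prod_def sup_nat_def inf_nat_def max_def min_def)
qed

lemma sublattice_I2_trunc: "sublattice (I2_trunc (k + 4))"
  unfolding sublattice_def
proof (intro ballI)
  fix \<alpha> \<beta> assume "\<alpha> \<in> I2_trunc (k + 4)" "\<beta> \<in> I2_trunc (k + 4)"
  then show "sup \<alpha> \<beta> \<in> I2_trunc (k + 4) \<and> inf \<alpha> \<beta> \<in> I2_trunc (k + 4)"
    by (cases \<alpha>; cases \<beta>)
      (auto simp: I2_trunc_iff sup_prod_def inf_prod_def sup_nat_def inf_nat_def max_def min_def)
qed

definition sum_index :: "nat \<Rightarrow> nat \<times> nat + nat \<Rightarrow> nat \<times> nat"
  where "sum_index k v = (case v of Inl \<alpha> \<Rightarrow> \<alpha> | Inr t \<Rightarrow> (k + 5 + t, k + 5 + t))"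

lemma sum_index_image: "sum_index k ` Sum_Type.Plus (I2_trunc (k + 4)) {..<m} = ext_lattice k m"
  by (force simp: sum_index_def ext_lattice_def Plus_def image_Un image_image)

lemma sum_index_inj: "inj_on (sum_index k) (Sum_Type.Plus (I2_trunc (k + 4)) {..<m})"
  by (auto simp: inj_on_def sum_index_def I2_trunc_iff Plus_def)

text \<open>A Hibi relation between comparable elements is trivial, so no relation restricts the
  variables of the added elements.\<close>

lemma ext_comparable:
  assumes "\<alpha> \<in> ext_lattice k m" "\<beta> \<in> ext_lattice k m" "\<alpha> \<notin> I2_trunc (k + 4)"
  shows "\<alpha> \<le> \<beta> \<or> \<beta> \<le> \<alpha>"
  using assms by (cases \<alpha>; cases \<beta>) (auto simp: ext_lattice_iff I2_trunc_iff less_eq_prod_def)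

lemma planar_product:
  "planar_hibi (Sum_Type.Plus (I2_trunc (k + 4)) {..<m}) (sum_index k)
    (product_variety (I2_trunc (k + 4)) {..<m} (hibi_variety (I2_trunc (k + 4))) (affine_space {..<m})
      :: (nat \<times> nat + nat \<Rightarrow> 'k::alg_closed_field) set)"
proof
  let ?T = "I2_trunc (k + 4)" and ?V = "Sum_Type.Plus (I2_trunc (k + 4)) {..<m}" and ?\<nu> = "sum_index k"
  show inj: "inj_on ?\<nu> ?V" by (rule sum_index_inj)
  show "sublattice (?\<nu> ` ?V)" unfolding sum_index_image by (rule sublattice_ext)
  have ext: "?\<nu> a \<in> ext_lattice k m" if "a \<in> ?V" for a using that sum_index_image by blast
  have Inl: "a = Inl (?\<nu> a)" if "a \<in> ?V" "?\<nu> a \<in> ?T" for a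
  proof -
    have "Inl (?\<nu> a) \<in> ?V" "?\<nu> (Inl (?\<nu> a)) = ?\<nu> a" using that by (auto simp: sum_index_def)
    then show ?thesis using inj that(1) by (metis inj_onD)
  qed
  show "product_variety ?T {..<m} (hibi_variety ?T) (affine_space {..<m})
    = {x :: nat \<times> nat + nat \<Rightarrow> 'k. x \<in> affine_space ?V \<and> (\<forall>a\<in>?V. \<forall>b\<in>?V. \<forall>c\<in>?V. \<forall>d\<in>?V.
      ?\<nu> c = sup (?\<nu> a) (?\<nu> b) \<longrightarrow> ?\<nu> d = inf (?\<nu> a) (?\<nu> b) \<longrightarrow> x a * x b = x c * x d)}" (is "?L = ?R")
  proof (intro equalityI subsetI)
    fix x :: "nat \<times> nat + nat \<Rightarrow> 'k" assume x: "x \<in> ?L"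
    have "x a * x b = x c * x d"
      if V: "a \<in> ?V" "b \<in> ?V" "c \<in> ?V" "d \<in> ?V" and s: "?\<nu> c = sup (?\<nu> a) (?\<nu> b)" "?\<nu> d = inf (?\<nu> a) (?\<nu> b)" for a b c d
    proof (cases "?\<nu> a \<le> ?\<nu> b \<or> ?\<nu> b \<le> ?\<nu> a")
      case True
      then consider "?\<nu> c = ?\<nu> b" "?\<nu> d = ?\<nu> a" | "?\<nu> c = ?\<nu> a" "?\<nu> d = ?\<nu> b"
        using s by (auto simp: sup_absorb1 sup_absorb2 inf_absorb1 inf_absorb2)
      then show ?thesis
      proof cases
        case 1
        then have "c = b" "d = a" using inj V by (auto dest: inj_onD)
        then show ?thesis by (simp add: mult.commute)
      next
        case 2
        then have "c = a" "d = b" using inj V by (auto dest: inj_onD)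
        then show ?thesis by simp
      qed
    next
      case False
      have "sup (?\<nu> a) (?\<nu> b) = sup (?\<nu> b) (?\<nu> a)" by (rule sup_commute)
      have T: "?\<nu> a \<in> ?T" "?\<nu> b \<in> ?T"
        using ext_comparable[OF ext[OF V(1)] ext[OF V(2)]] ext_comparable[OF ext[OF V(2)] ext[OF V(1)]] False by auto
      then have T2: "?\<nu> c \<in> ?T" "?\<nu> d \<in> ?T" using s sublattice_I2_trunc[of k] by (auto simp: sublattice_def)
      define y where "y = (\<lambda>v\<in>?T. x (Inl v))"
      have "y \<in> hibi_variety ?T" using x by (simp add: product_variety_def y_def)
      then have "y (?\<nu> a) * y (?\<nu> b) = y (?\<nu> c) * y (?\<nu> d)" using T s unfolding mem_hibi_variety by simp
      moreover have "y (?\<nu> v) = x v" if "v \<in> ?V" "?\<nu> v \<in> ?T" for v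
        using Inl[OF that] that(2) by (simp add: y_def)
      ultimately show ?thesis using V T T2 by simp
    qed
    then show "x \<in> ?R" using x by (simp add: product_variety_def)
  next
    fix x :: "nat \<times> nat + nat \<Rightarrow> 'k" assume x: "x \<in> ?R"
    have rel: "x a * x b = x c * x d"
      if "a \<in> ?V" "b \<in> ?V" "c \<in> ?V" "d \<in> ?V" "?\<nu> c = sup (?\<nu> a) (?\<nu> b)" "?\<nu> d = inf (?\<nu> a) (?\<nu> b)" for a b c d
      using x that by simp
    have "x (Inl \<alpha>) * x (Inl \<beta>) = x (Inl (sup \<alpha> \<beta>)) * x (Inl (inf \<alpha> \<beta>))" if "\<alpha> \<in> ?T" "\<beta> \<in> ?T" for \<alpha> \<beta>
    proof (rule rel)
      show "Inl (sup \<alpha> \<beta>) \<in> ?V" "Inl (inf \<alpha> \<beta>) \<in> ?V"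
        using that sublattice_I2_trunc[of k] by (auto simp: sublattice_def)
    qed (use that in \<open>auto simp: sum_index_def\<close>)
    note eq = this
    have "(\<lambda>v\<in>?T. x (Inl v)) \<in> hibi_variety ?T"
      unfolding mem_hibi_variety
    proof (intro conjI ballI)
      fix \<alpha> \<beta> assume T: "\<alpha> \<in> ?T" "\<beta> \<in> ?T"
      then have "sup \<alpha> \<beta> \<in> ?T" "inf \<alpha> \<beta> \<in> ?T" using sublattice_I2_trunc[of k] by (simp_all add: sublattice_def)
      then show "(\<lambda>v\<in>?T. x (Inl v)) \<alpha> * (\<lambda>v\<in>?T. x (Inl v)) \<beta>
          = (\<lambda>v\<in>?T. x (Inl v)) (sup \<alpha> \<beta>) * (\<lambda>v\<in>?T. x (Inl v)) (inf \<alpha> \<beta>)"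
        using T eq[OF T] by simp
    qed (simp add: affine_space_def)
    then show "x \<in> ?L" using x by (simp add: product_variety_def affine_space_def)
  qed
qed

text \<open>Coordinates adapted to the face with blocks \<open>[(1,2), (i,i+1)]\<close> and \<open>[(i+k+2,i+k+3), (n-1,n)]\<close>:
  \<open>x\<^sub>a\<^sub>b = u\<^sub>a v\<^sub>b\<close> is a product of units \<open>1 + s\<^sub>t\<close>, one for each \<open>u\<close> and \<open>v\<close> that occurs in a
  block (except for the two that are normalised to 1), with a coordinate of \<open>Z\<close> off the two blocks.\<close>

context
  fixes n i k m :: nat
  assumes i: "1 \<le> i" and n: "i + k + 3 \<le> n" and m: "m = 2 * (n - k) - 6"
begin

definition sv :: "nat \<Rightarrow> bimon \<Rightarrow>\<^sub>0 'k::field"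
  where "sv t = single ({#k + 5 + t#}, {#k + 5 + t#}) 1"

text \<open>The m deviations are numbered in four ranges: u_2 to u_i from 0 on, v_2 to v_(i+1) from
  i - 1 on, u_(i+k+2) to u_(n-1) from 2i - 1 on, and v_(i+k+3) to v_(n-1) from n + i - k - 3 on. The
  normalised ones are u_1 and v_n.\<close>

definition unit_u :: "nat \<Rightarrow> bimon \<Rightarrow>\<^sub>0 'k::field"
  where "unit_u a = (if 2 \<le> a \<and> a \<le> i then 1 + sv (a - 2)
    else if i + k + 2 \<le> a then 1 + sv (2 * i - 1 + (a - (i + k + 2))) else 1)"

definition unit_v :: "nat \<Rightarrow> bimon \<Rightarrow>\<^sub>0 'k::field"
  where "unit_v b = (if b \<le> i + 1 then 1 + sv (i - 1 + (b - 2))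
    else if i + k + 3 \<le> b \<and> b < n then 1 + sv (n + i - (k + 3) + (b - (i + k + 3))) else 1)"

text \<open>Off the blocks, coordinates with first index at most i differ only by units, and so do
  those with second index at least i + k + 3; collapsing each group to a single index leaves the
  lattice of Z.\<close>

definition col :: "nat \<Rightarrow> nat" where "col a = (if a \<le> i then 1 else a - i + 1)"
definition row :: "nat \<Rightarrow> nat" where "row b = (if b \<le> i + k + 2 then b - i + 1 else k + 4)"

definition zvar :: "nat \<Rightarrow> nat \<Rightarrow> bimon \<Rightarrow>\<^sub>0 'k::field"
  where "zvar a b = (if b \<le> i + 1 \<or> i + k + 2 \<le> a then 1 else single ({#col a#}, {#row b#}) 1)"

definition gen :: "nat \<times> nat \<Rightarrow> bimon \<Rightarrow>\<^sub>0 'k::field"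
  where "gen = (\<lambda>(a, b). unit_u a * unit_v b * zvar a b)"

definition loc :: "((nat \<times> nat \<Rightarrow>\<^sub>0 nat) \<Rightarrow>\<^sub>0 'k) \<Rightarrow> bimon \<Rightarrow>\<^sub>0 'k::field"
  where "loc = mlift (single 0) (\<lambda>e. \<Prod>v\<in>keys e. gen v ^ lookup e v)"

abbreviation (input) "S \<equiv> hibi_monoid (ext_lattice k m)"

lemma loc_simps:
  fixes f f' :: "(nat \<times> nat \<Rightarrow>\<^sub>0 nat) \<Rightarrow>\<^sub>0 'k::field"
  shows "loc (f + f') = loc f + loc f'" "loc (f - f') = loc f - loc f'" "loc (f * f') = loc f * loc f'"
    "loc (single 0 (c::'k)) = single 0 c" "loc (1 :: (nat \<times> nat \<Rightarrow>\<^sub>0 nat) \<Rightarrow>\<^sub>0 'k) = 1"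
    "loc (poly_var v :: (nat \<times> nat \<Rightarrow>\<^sub>0 nat) \<Rightarrow>\<^sub>0 'k) = gen v"
proof -
  interpret scalar_hom "\<lambda>c::'k. single (0::bimon) c" by (rule scalar_hom_single)
  show "loc (f + f') = loc f + loc f'" unfolding loc_def by (rule mlift_add)
  show "loc (f - f') = loc f - loc f'" unfolding loc_def by (rule mlift_diff)
  show "loc (f * f') = loc f * loc f'" unfolding loc_def by (rule mlift_mult) (rule prod_keys_add)
  show "loc (single 0 c) = single 0 c" unfolding loc_def mlift_single by simp
  show "loc (1 :: (nat \<times> nat \<Rightarrow>\<^sub>0 nat) \<Rightarrow>\<^sub>0 'k) = 1" unfolding loc_def by (rule mlift_one) simp
  show "loc (poly_var v :: (nat \<times> nat \<Rightarrow>\<^sub>0 nat) \<Rightarrow>\<^sub>0 'k) = gen v"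
    unfolding loc_def poly_var_def mlift_single by simp
qed

lemma bieval_loc: "bieval u w (loc f) = poly_eval (\<lambda>v. bieval u w (gen v)) (f :: (nat \<times> nat \<Rightarrow>\<^sub>0 nat) \<Rightarrow>\<^sub>0 'k::field)"
proof -
  have pow: "bieval u w (p ^ r) = bieval u w p ^ r" for p :: "bimon \<Rightarrow>\<^sub>0 'k" and r
    by (induction r) (simp_all add: bieval_simps)
  have prod: "bieval u w (\<Prod>v\<in>A. h v) = (\<Prod>v\<in>A. bieval u w (h v))" for A and h :: "nat \<times> nat \<Rightarrow> bimon \<Rightarrow>\<^sub>0 'k"
    by (induction A rule: infinite_finite_induct) (simp_all add: bieval_simps)
  have sum: "bieval u w (\<Sum>v\<in>A. h v) = (\<Sum>v\<in>A. bieval u w (h v))" for A and h :: "(nat \<times> nat \<Rightarrow>\<^sub>0 nat) \<Rightarrow> bimon \<Rightarrow>\<^sub>0 'k"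
    by (induction A rule: infinite_finite_induct) (simp_all add: bieval_simps)
  show ?thesis
    by (simp add: loc_def mlift_def sum bieval_simps prod pow poly_eval_def)
qed

lemma s_in: "t < m \<Longrightarrow> keys (1 + sv t :: bimon \<Rightarrow>\<^sub>0 'k::field) \<subseteq> S"
proof -
  assume "t < m"
  then have "(k + 5 + t, k + 5 + t) \<in> ext_lattice k m" by (simp add: ext_lattice_iff)
  then have "keys (sv t :: bimon \<Rightarrow>\<^sub>0 'k) \<subseteq> S" using hibi_monoid_single by (simp add: sv_def)
  then show ?thesis using MA_closed(1,4)[OF submonoid_hibi] by blast
qed

lemma gen_in: "v \<in> I2 n \<Longrightarrow> keys (gen v :: bimon \<Rightarrow>\<^sub>0 'k::field) \<subseteq> S"
proof -
  assume "v \<in> I2 n"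
  then obtain a b where v: "v = (a, b)" "1 \<le> a" "a < b" "b \<le> n" by (auto simp: I2_def)
  note one = MA_closed(4)[OF submonoid_hibi, where 'k='k]
  have "keys (unit_u a :: bimon \<Rightarrow>\<^sub>0 'k) \<subseteq> S"
  proof -
    consider "2 \<le> a" "a \<le> i" "a - 2 < m" | "\<not> a \<le> i" "i + k + 2 \<le> a" "2 * i - 1 + (a - (i + k + 2)) < m"
      | "unit_u a = (1 :: bimon \<Rightarrow>\<^sub>0 'k)"
    proof (cases "2 \<le> a \<and> a \<le> i"; cases "i + k + 2 \<le> a")
    qed (use v i n m in \<open>auto simp: unit_u_def\<close>)
    then show ?thesis
      by cases (use s_in[where 'k='k] one in \<open>simp_all add: unit_u_def\<close>)
  qed
  moreover have "keys (unit_v b :: bimon \<Rightarrow>\<^sub>0 'k) \<subseteq> S"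
  proof -
    consider "b \<le> i + 1" "i - 1 + (b - 2) < m" | "\<not> b \<le> i + 1" "i + k + 3 \<le> b" "b < n" "n + i - (k + 3) + (b - (i + k + 3)) < m"
      | "unit_v b = (1 :: bimon \<Rightarrow>\<^sub>0 'k)"
    proof (cases "b \<le> i + 1"; cases "i + k + 3 \<le> b \<and> b < n")
    qed (use v i n m in \<open>auto simp: unit_v_def\<close>)
    then show ?thesis
      by cases (use s_in[where 'k='k] one in \<open>simp_all add: unit_v_def\<close>)
  qed
  moreover have "keys (zvar a b :: bimon \<Rightarrow>\<^sub>0 'k) \<subseteq> S"
  proof (cases "b \<le> i + 1 \<or> i + k + 2 \<le> a")
    case False
    then have "(col a, row b) \<in> ext_lattice k m"
      using v i n by (auto simp: ext_lattice_iff col_def row_def)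
    then show ?thesis using False hibi_monoid_single by (auto simp: zvar_def)
  qed (use one in \<open>simp add: zvar_def\<close>)
  ultimately show ?thesis unfolding v gen_def by (simp add: MA_closed(2)[OF submonoid_hibi])
qed

lemma loc_in: "f \<in> carrier (poly_alg (I2 n)) \<Longrightarrow> keys (loc f :: bimon \<Rightarrow>\<^sub>0 'k::field) \<subseteq> S"
proof -
  assume f: "f \<in> carrier (poly_alg (I2 n))"
  have "keys (\<Prod>v\<in>A. gen v ^ r v :: bimon \<Rightarrow>\<^sub>0 'k) \<subseteq> S" if "A \<subseteq> I2 n" for A r
    using that
  proof (induction A rule: infinite_finite_induct)
    case (insert v A)
    then show ?case
      unfolding prod.insert[OF insert(1,2)]
      by (intro MA_closed(2)[OF submonoid_hibi] MA_power_closed[OF submonoid_hibi gen_in]) simp_all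
  next
    case (infinite A)
    show ?case unfolding prod.infinite[OF infinite(1)] by (rule MA_closed(4)[OF submonoid_hibi])
  next
    case empty
    show ?case unfolding prod.empty by (rule MA_closed(4)[OF submonoid_hibi])
  qed
  then show ?thesis
    unfolding loc_def mlift_def using f
    by (intro MA_sum_closed[OF submonoid_hibi] MA_closed(2)[OF submonoid_hibi] MA_closed(3)[OF submonoid_hibi])
      (simp add: poly_carrier)
qed

lemma bieval_sv: "bieval u w (sv t) = u (k + 5 + t) * w (k + 5 + t)"
  by (simp add: sv_def bieval_simps bival_def)

lemma bieval_zvar: "bieval u w (zvar a b) = (if b \<le> i + 1 \<or> i + k + 2 \<le> a then 1 else u (col a) * w (row b))"
  by (simp add: zvar_def bieval_simps bival_def)

lemma bieval_gen: "bieval u w (gen (a, b)) = bieval u w (unit_u a) * bieval u w (unit_v b) * bieval u w (zvar a b)"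
  by (simp add: gen_def bieval_simps)

text \<open>Where \<open>u\<^sub>1\<close> and \<open>v\<^sub>k\<^sub>+\<^sub>4\<close> do not vanish, the adapted coordinates define torus points of the
  variety: the block coordinates are scaled by \<open>1 / v\<^sub>k\<^sub>+\<^sub>4\<close> and \<open>1 / u\<^sub>1\<close>.\<close>

lemma bieval_gen_torus:
  assumes "u 1 \<noteq> (0::'k::field)" "w (k + 4) \<noteq> 0" and v: "v \<in> I2 n"
  shows "bieval u w (gen v) = (bieval u w (unit_u (fst v)) * (if i + k + 2 \<le> fst v then 1 / w (k + 4) else u (col (fst v))))
    * (bieval u w (unit_v (snd v)) * (if snd v \<le> i + 1 then 1 / u 1 else w (row (snd v))))"
proof -
  obtain a b where ab: "v = (a, b)" "1 \<le> a" "a < b" "b \<le> n" using v by (auto simp: I2_def)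
  have "bieval u w (zvar a b) = (if i + k + 2 \<le> a then 1 / w (k + 4) else u (col a)) * (if b \<le> i + 1 then 1 / u 1 else w (row b))"
    unfolding bieval_zvar using assms ab by (auto simp: col_def row_def)
  then show ?thesis unfolding ab bieval_gen by (simp add: ac_simps)
qed

text \<open>Both kernels are compared on tori. Adapted coordinates give torus points of the variety
  by \<open>bieval_gen_torus\<close>; conversely the substitution can be solved for the adapted
  coordinates at every torus point, which suffices by \<open>bieval_zero_iff\<close>.\<close>

lemma loc_ker:
  assumes f: "f \<in> carrier (poly_alg (I2 n))"
  shows "f \<in> vanishing_ideal (I2 n) (hibi_variety (I2 n)) \<longleftrightarrow> loc f = (0 :: bimon \<Rightarrow>\<^sub>0 'k::alg_closed_field)"
proof -
  interpret planar_hibi "I2 n" "\<lambda>\<alpha>. \<alpha>" "hibi_variety (I2 n) :: (nat \<times> nat \<Rightarrow> 'k) set"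
    by (rule planar_hibi_variety[OF sublattice_I2])
  show ?thesis
  proof
    assume van: "f \<in> vanishing_ideal (I2 n) (hibi_variety (I2 n))"
    show "loc f = 0"
    proof (rule bieval_zero_iff)
      fix u w :: "nat \<Rightarrow> 'k" assume nz: "\<And>a. u a \<noteq> 0" "\<And>a. w a \<noteq> 0"
      define u' where "u' a = bieval u w (unit_u a) * (if i + k + 2 \<le> a then 1 / w (k + 4) else u (col a))" for a
      define w' where "w' b = bieval u w (unit_v b) * (if b \<le> i + 1 then 1 / u 1 else w (row b))" for b
      have "bieval u w (loc f) = poly_eval (\<lambda>a\<in>I2 n. u' (fst a) * w' (snd a)) f"
        unfolding bieval_loc
        by (rule poly_eval_cong[OF f]) (simp add: bieval_gen_torus[of u w, OF nz] u'_def w'_def)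
      then show "bieval u w (loc f) = 0"
        using van torus_point[of u' w'] by (simp add: vanishing_ideal_def)
    qed
  next
    assume 0: "loc f = 0"
    have "hibi_hom (\<lambda>\<alpha>. \<alpha>) f = 0"
    proof (rule bieval_zero_iff)
      fix u w :: "nat \<Rightarrow> 'k" assume nz: "\<And>a. u a \<noteq> 0" "\<And>a. w a \<noteq> 0"
      \<comment> \<open>Chosen such that 1 + \<sigma> t is u_a / u_1, w_b * u_1, u_a * w_n or w_b /
        w_n in the four ranges. On both blocks the product of units is then u_a * w_b, and off the
        blocks the denominators u_1 and w_n cancel against the collapsed coordinates.\<close>
      define \<sigma> where "\<sigma> t = (if t < i - 1 then u (t + 2) / u 1 - 1
        else if t < 2 * i - 1 then w (t - (i - 1) + 2) * u 1 - 1
        else if t < n + i - (k + 3) then u (t - (2 * i - 1) + (i + k + 2)) * w n - 1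
        else w (t - (n + i - (k + 3)) + (i + k + 3)) / w n - 1)" for t
      \<comment> \<open>Indices up to k + 4 carry the coordinates of Z, those above carry the
        deviations, for which \<open>w2\<close> is 1.\<close>
      define u2 where "u2 x = (if x = 1 then u 1 else if x \<le> k + 4 then u (x + i - 1) else \<sigma> (x - (k + 5)))" for x
      define w2 where "w2 y = (if y \<le> k + 3 then w (y + i - 1) else if y = k + 4 then w n else 1)" for y
      have sv: "bieval u2 w2 (sv t) = \<sigma> t" for t by (simp add: bieval_sv u2_def w2_def)
      have U: "bieval u2 w2 (unit_u a) = (if a \<le> i then u a / u 1 else if i + k + 2 \<le> a then u a * w n else 1)"
        if "1 \<le> a" "a < n" for a
      proof -
        have "a = 1 \<or> 2 \<le> a" using that by linarith
        then consider "a = 1" | "2 \<le> a" "a \<le> i" | "i < a" "a < i + k + 2" | "i + k + 2 \<le> a" by linarith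
        then show ?thesis
        proof cases
          case 1
          then show ?thesis using i nz by (simp add: unit_u_def bieval_simps)
        next
          case 2
          then have "a - 2 < i - 1" "a - 2 + 2 = a" by arith+
          then have "\<sigma> (a - 2) = u a / u 1 - 1" unfolding \<sigma>_def by presburger
          then show ?thesis using 2 by (simp add: unit_u_def bieval_simps sv)
        next
          case 3
          then show ?thesis by (simp add: unit_u_def bieval_simps)
        next
          case 4
          have "\<not> 2 * i - 1 + (a - (i + k + 2)) < i - 1" "\<not> 2 * i - 1 + (a - (i + k + 2)) < 2 * i - 1"
            "2 * i - 1 + (a - (i + k + 2)) < n + i - (k + 3)"
            "2 * i - 1 + (a - (i + k + 2)) - (2 * i - 1) + (i + k + 2) = a"
            using 4 that i n by arith+
          then have "\<sigma> (2 * i - 1 + (a - (i + k + 2))) = u a * w n - 1" unfolding \<sigma>_def by presburger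
          then show ?thesis using 4 by (simp add: unit_u_def bieval_simps sv)
        qed
      qed
      have W: "bieval u2 w2 (unit_v b) = (if b \<le> i + 1 then w b * u 1 else if i + k + 3 \<le> b then w b / w n else 1)"
        if "2 \<le> b" "b \<le> n" for b
      proof -
        have "b < n \<or> b = n" using that by linarith
        then consider "b \<le> i + 1" | "i + 1 < b" "b < i + k + 3" | "i + k + 3 \<le> b" "b < n" | "b = n" "i + k + 3 \<le> b"
          by linarith
        then show ?thesis
        proof cases
          case 1
          have "\<not> i - 1 + (b - 2) < i - 1" "i - 1 + (b - 2) < 2 * i - 1" "i - 1 + (b - 2) - (i - 1) + 2 = b"
            using 1 that i by arith+
          then have "\<sigma> (i - 1 + (b - 2)) = w b * u 1 - 1" unfolding \<sigma>_def by presburger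
          then show ?thesis using 1 by (simp add: unit_v_def bieval_simps sv)
        next
          case 2
          then show ?thesis by (simp add: unit_v_def bieval_simps)
        next
          case 3
          have "\<not> n + i - (k + 3) + (b - (i + k + 3)) < i - 1" "\<not> n + i - (k + 3) + (b - (i + k + 3)) < 2 * i - 1"
            "\<not> n + i - (k + 3) + (b - (i + k + 3)) < n + i - (k + 3)"
            "n + i - (k + 3) + (b - (i + k + 3)) - (n + i - (k + 3)) + (i + k + 3) = b"
            using 3 that i n by arith+
          then have "\<sigma> (n + i - (k + 3) + (b - (i + k + 3))) = w b / w n - 1" unfolding \<sigma>_def by presburger
          then show ?thesis using 3 by (simp add: unit_v_def bieval_simps sv)
        next
          case 4
          then show ?thesis using nz by (simp add: unit_v_def bieval_simps)
        qed
      qed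
      have gen: "u (fst v) * w (snd v) = bieval u2 w2 (gen v)" if v: "v \<in> I2 n" for v
      proof -
        obtain a b where ab: "v = (a, b)" "1 \<le> a" "a < b" "b \<le> n" using v by (auto simp: I2_def)
        have a: "u2 (col a) = (if a \<le> i then u 1 else u a)" if "a < i + k + 2"
          using that by (auto simp: u2_def col_def)
        have b: "w2 (row b) = (if i + k + 3 \<le> b then w n else w b)" if "i + 1 < b"
          using that by (auto simp: w2_def row_def)
        show ?thesis
          unfolding ab bieval_gen bieval_zvar using U[of a] W[of b] ab a b nz i n by auto
      qed
      have "bieval u w (hibi_hom (\<lambda>\<alpha>. \<alpha>) f) = poly_eval (\<lambda>v. bieval u2 w2 (gen v)) f"
        by (rule bieval_hibi_hom[OF f]) (simp add: gen)
      then show "bieval u w (hibi_hom (\<lambda>\<alpha>. \<alpha>) f) = 0"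
        using 0 bieval_loc[of u2 w2 f] by (simp add: bieval_simps)
    qed
    then show "f \<in> vanishing_ideal (I2 n) (hibi_variety (I2 n))" using vanishing_iff[OF f] by simp
  qed
qed

text \<open>With all variables set to 0 only the exponent 0 contributes.\<close>

lemma lookup_0_bieval: "lookup b 0 = bieval (\<lambda>_. 0) (\<lambda>_. 0) (b :: bimon \<Rightarrow>\<^sub>0 'k::field)"
proof -
  have "bival (\<lambda>_. 0::'k) (\<lambda>_. 0) e = (if e = 0 then 1 else 0)" for e
    by (cases "fst e = {#}"; cases "snd e = {#}") (auto simp: bival_def prod_eq_iff nonempty_has_size[symmetric])
  then have "bieval (\<lambda>_. 0) (\<lambda>_. 0) b = (\<Sum>e\<in>keys b. if e = 0 then lookup b 0 else 0)"
    unfolding bieval_def mlift_def by (intro sum.cong) auto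
  then show ?thesis by (simp add: in_keys_iff)
qed

lemma var_in: "v \<in> I2 n \<Longrightarrow> poly_var v \<in> carrier (poly_alg (I2 n) :: ('k::field, _) module)"
  by (simp add: poly_carrier poly_var_def)

lemma diff_in:
  fixes f g :: "(nat \<times> nat \<Rightarrow>\<^sub>0 nat) \<Rightarrow>\<^sub>0 'k::field"
  assumes "f \<in> carrier (poly_alg V)" "g \<in> carrier (poly_alg V)"
  shows "f - g \<in> carrier (poly_alg V)"
proof -
  have "e \<in> keys f \<or> e \<in> keys g" if "e \<in> keys (f - g)" for e
    using subsetD[OF keys_diff that] by (rule UnE) (rule disjI1, assumption, rule disjI2, assumption)
  then show ?thesis using assms unfolding poly_carrier by blast
qed

section \<open>Comparison at the point of the face\<close>

context
  fixes P :: "nat \<times> nat \<Rightarrow> 'k::alg_closed_field"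
  assumes P: "\<And>a b. (a, b) \<in> I2 n \<Longrightarrow> P (a, b) = (if b \<le> i + 1 \<or> i + k + 2 \<le> a then 1 else 0)"
begin

lemma lookup_loc:
  assumes "f \<in> carrier (poly_alg (I2 n))"
  shows "lookup (loc f) 0 = poly_eval P f"
proof -
  have "bieval (\<lambda>_. 0) (\<lambda>_. 0) (gen v) = P v" if "v \<in> I2 n" for v
  proof -
    obtain a b where v: "v = (a, b)" by (cases v)
    have "bieval (\<lambda>_. 0::'k) (\<lambda>_. 0) (unit_u a) = 1" "bieval (\<lambda>_. 0::'k) (\<lambda>_. 0) (unit_v b) = 1"
      by (simp_all add: unit_u_def unit_v_def bieval_simps bieval_sv)
    then show ?thesis using that by (simp add: v bieval_gen bieval_zvar P)
  qed
  then show ?thesis unfolding lookup_0_bieval bieval_loc by (intro poly_eval_cong[OF assms])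
qed

text \<open>A coordinate of Z is a variable both of whose unit factors are 1. A deviation s_t is x -
  1 if x = 1 + s_t for some variable x, and otherwise (x - x') / x', where x' arises from x by
  passing to the normalised index.\<close>

lemma loc_lift:
  assumes g: "g \<in> S" "biwt g = 1"
  shows "\<exists>a\<in>carrier (poly_alg (I2 n)). \<exists>t\<in>carrier (poly_alg (I2 n)).
    poly_eval P a = 0 \<and> poly_eval P t \<noteq> 0 \<and> loc a = loc t * single g 1"
proof -
  obtain x y where xy: "(x, y) \<in> ext_lattice k m" "g = ({#x#}, {#y#})"
    using hibi_monoid_wt_1[OF g] by blast
  \<comment> \<open>That a vanishes at P is automatic: \<open>loc a\<close> is a multiple of a
    monomial of degree 1, so it has no constant term.\<close>
  have reduce: ?thesis
    if "a \<in> carrier (poly_alg (I2 n))" "t \<in> carrier (poly_alg (I2 n))" "poly_eval P t \<noteq> 0" "loc a = loc t * single g 1"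
    for a t
  proof -
    have "poly_eval P a = lookup (loc a) 0" by (rule lookup_loc[OF that(1), symmetric])
    also have "\<dots> = 0" unfolding that(4) lookup_0_bieval by (simp add: bieval_simps xy bival_def)
    finally show ?thesis using that by blast
  qed
  have one: "1 \<in> carrier (poly_alg (I2 n) :: ('k, _) module)" "poly_eval P 1 = 1"
    by (simp_all add: poly_carrier poly_eval_simps)
  have var: "poly_eval P (poly_var v) = P v" for v by (simp add: poly_eval_simps)
  show ?thesis
  proof (cases "k + 5 \<le> x")
    case False
    then have c: "1 \<le> x" "x \<le> k + 2" "3 \<le> y" "y \<le> k + 4" "x < y"
      using xy(1) by (auto simp: ext_lattice_iff)
    \<comment> \<open>Preimages under \<open>col\<close> and \<open>row\<close>; from the collapsed
      groups the normalised indices 1 and n are taken.\<close>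
    define a where "a = (if x = 1 then 1 else x + i - 1)"
    define b where "b = (if y = k + 4 then n else y + i - 1)"
    have ab: "(a, b) \<in> I2 n" "\<not> (b \<le> i + 1 \<or> i + k + 2 \<le> a)"
      using c i n by (auto simp: a_def b_def I2_def)
    have "unit_u a = (1 :: bimon \<Rightarrow>\<^sub>0 'k)" "unit_v b = (1 :: bimon \<Rightarrow>\<^sub>0 'k)" "col a = x" "row b = y"
      using c i n by (auto simp: a_def b_def unit_u_def unit_v_def col_def row_def)
    then have "gen (a, b) = (single g 1 :: bimon \<Rightarrow>\<^sub>0 'k)"
      using ab(2) by (simp add: gen_def zvar_def xy)
    then show ?thesis
      by (intro reduce[OF var_in[OF ab(1)] one(1)]) (simp_all add: one loc_simps)
  next
    case True
    define t where "t = x - (k + 5)"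
    have xt: "x = k + 5 + t" using True by (simp add: t_def)
    then have t: "t < m" and sv: "(single g 1 :: bimon \<Rightarrow>\<^sub>0 'k) = sv t"
      using xy by (simp_all add: ext_lattice_iff sv_def)
    consider "t < i - 1" | "i - 1 \<le> t" "t < 2 * i - 1" | "2 * i - 1 \<le> t" "t < n + i - (k + 3)"
      | "n + i - (k + 3) \<le> t" by linarith
    then show ?thesis
    proof cases
      case 1
      have v: "(t + 2, i + 1) \<in> I2 n" "(1, i + 1) \<in> I2 n" using 1 i n by (auto simp: I2_def)
      have "gen (t + 2, i + 1) = gen (1, i + 1) * (1 + sv t :: bimon \<Rightarrow>\<^sub>0 'k)"
      proof -
        have "unit_u (t + 2) = (1 + sv t :: bimon \<Rightarrow>\<^sub>0 'k)" "unit_u 1 = (1 :: bimon \<Rightarrow>\<^sub>0 'k)"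
          using 1 i by (auto simp: unit_u_def)
        then show ?thesis by (simp add: gen_def zvar_def mult.commute)
      qed
      then show ?thesis
        by (intro reduce[OF diff_in[OF var_in[OF v(1)] var_in[OF v(2)]] var_in[OF v(2)]])
          (use v P in \<open>simp_all add: var loc_simps sv algebra_simps\<close>)
    next
      case 2
      define b where "b = t - (i - 1) + 2"
      have b: "2 \<le> b" "b \<le> i + 1" "i - 1 + (b - 2) = t" using 2 by (auto simp: b_def)
      have v: "(1, b) \<in> I2 n" using b i n by (auto simp: I2_def)
      have "gen (1, b) = (1 + sv t :: bimon \<Rightarrow>\<^sub>0 'k)"
        using b i by (simp add: gen_def unit_u_def unit_v_def zvar_def)
      then show ?thesis
        by (intro reduce[OF diff_in[OF var_in[OF v] one(1)] one(1)]) (simp_all add: one loc_simps sv)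
    next
      case 3
      define a where "a = t - (2 * i - 1) + (i + k + 2)"
      have a: "i + k + 2 \<le> a" "a < n" "2 * i - 1 + (a - (i + k + 2)) = t" using 3 i n by (auto simp: a_def)
      have v: "(a, n) \<in> I2 n" using a by (auto simp: I2_def)
      have "unit_u a = (1 + sv t :: bimon \<Rightarrow>\<^sub>0 'k)" "unit_v n = (1 :: bimon \<Rightarrow>\<^sub>0 'k)"
        using a n by (simp_all add: unit_u_def unit_v_def)
      then have "gen (a, n) = (1 + sv t :: bimon \<Rightarrow>\<^sub>0 'k)"
        using a by (simp add: gen_def zvar_def)
      then show ?thesis
        by (intro reduce[OF diff_in[OF var_in[OF v] one(1)] one(1)]) (simp_all add: one loc_simps sv)
    next
      case 4
      define b where "b = t - (n + i - (k + 3)) + (i + k + 3)"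
      have b: "i + k + 3 \<le> b" "b < n" "n + i - (k + 3) + (b - (i + k + 3)) = t"
        using 4 t m i n by (auto simp: b_def)
      have v: "(i + k + 2, b) \<in> I2 n" "(i + k + 2, n) \<in> I2 n" using b n by (auto simp: I2_def)
      have "unit_v b = (1 + sv t :: bimon \<Rightarrow>\<^sub>0 'k)" "unit_v n = (1 :: bimon \<Rightarrow>\<^sub>0 'k)"
        using b n by (simp_all add: unit_v_def)
      then have "gen (i + k + 2, b) = gen (i + k + 2, n) * (1 + sv t :: bimon \<Rightarrow>\<^sub>0 'k)"
        by (simp add: gen_def zvar_def)
      then show ?thesis
        by (intro reduce[OF diff_in[OF var_in[OF v(1)] var_in[OF v(2)]] var_in[OF v(2)]])
          (use v P in \<open>simp_all add: var loc_simps sv algebra_simps\<close>)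
    qed
  qed
qed

lemma local_model:
  "tangent_model (I2 n) (hibi_variety (I2 n)) P S biwt (loc :: ((nat \<times> nat \<Rightarrow>\<^sub>0 nat) \<Rightarrow>\<^sub>0 'k) \<Rightarrow> _)"
proof (rule tangent_model.intro)
  show "is_submonoid S" by (rule submonoid_hibi)
  show "biwt (e + e') = biwt e + biwt e'" for e e' by simp
qed (rule hibi_monoid_wt_0 hibi_monoid_gen loc_in loc_ker lookup_loc loc_lift loc_simps | assumption)+

end

end

theorem theorem7p11:
  fixes n i k m :: nat
    and \<tau> :: "(nat \<times> nat \<Rightarrow>\<^sub>0 real) set"
    and X :: "(nat \<times> nat \<Rightarrow> 'k::alg_closed_field) set"
    and Z :: "(nat \<times> nat \<Rightarrow> 'k) set"
    and P :: "nat \<times> nat \<Rightarrow> 'k"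
  assumes "1 \<le> i" and "i \<le> n - 3" and "k \<le> n - i - 3"
    and "X = hibi_variety (I2 n)"
    and "Z = hibi_variety (I2_trunc (k + 4))"
    and "cone_face (join_irreducibles (I2 n)) (hibi_cone (I2 n)) \<tau>"
    and "P = face_point (I2 n) \<tau>"
    and "{\<alpha> \<in> I2 n. P \<alpha> \<noteq> 0} =
           I2 n \<inter> {(1, 2)..(i, i + 1)} \<union> I2 n \<inter> {(i + k + 2, i + k + 3)..(n - 1, n)}"
    and "m = cone_codim (hibi_cone (I2 n)) \<tau>"
  shows "m = 2 * (n - k) - 6 \<and>
         tangent_cone (I2 n) X P \<cong>\<^sub>K
           coord_alg (Sum_Type.Plus (I2_trunc (k + 4)) {..<m})
             (product_variety (I2_trunc (k + 4)) {..<m} Z (affine_space {..<m})) \<and>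
         is_affine_toric (tangent_cone (I2 n) X P) \<and>
         mult_at (I2 n) X P = catalan (k + 2) \<and>
         catalan (k + 2) = 1 / of_nat (k + 3) * of_nat ((2 * k + 4) choose (k + 2))"
proof -
  \<comment> \<open>Since 1 \<le> i \<le> n - 3, none of the truncated differences in the hypotheses
    is cut off.\<close>
  have n: "i + k + 3 \<le> n" "4 \<le> n" using assms(1-3) by arith+
  have D: "P \<alpha> \<noteq> 0 \<longleftrightarrow> \<alpha> \<le> (i, i + 1) \<or> (i + k + 2, i + k + 3) \<le> \<alpha>" if "\<alpha> \<in> I2 n" for \<alpha>
  proof -
    have "(1, 2) \<le> \<alpha>" "\<alpha> \<le> (n - 1, n)" using that by (auto simp: I2_def less_eq_prod_def)
    moreover have "P \<alpha> \<noteq> 0 \<longleftrightarrow> \<alpha> \<in> {\<alpha> \<in> I2 n. P \<alpha> \<noteq> 0}" using that by simp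
    ultimately show ?thesis unfolding assms(8) using that by simp
  qed
  have m: "m = 2 * (n - k) - 6"
    unfolding assms(9) by (rule codim_face[OF n(2) assms(6,7,1) n(1) D])
  have P: "P (a, b) = (if b \<le> i + 1 \<or> i + k + 2 \<le> a then 1 else 0)" if "(a, b) \<in> I2 n" for a b
  proof -
    have "P (a, b) = 0 \<or> P (a, b) = 1" using that by (simp add: assms(7) face_point_def)
    \<comment> \<open>As a < b, a single coordinate decides the membership in each block.\<close>
    moreover have "(a, b) \<le> (i, i + 1) \<or> (i + k + 2, i + k + 3) \<le> (a, b) \<longleftrightarrow> b \<le> i + 1 \<or> i + k + 2 \<le> a"
      using that by (auto simp: I2_def less_eq_prod_def)
    ultimately show ?thesis using D[OF that] by auto
  qed
  let ?S = "hibi_monoid (ext_lattice k m)" and ?B = "monoid_alg (hibi_monoid (ext_lattice k m)) :: ('k, bimon \<Rightarrow>\<^sub>0 'k) module"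
  let ?C = "tangent_cone (I2 n) X P" and ?c = "graded_piece (local_alg (I2 n) X P) (local_max_ideal (I2 n) X P)"
  interpret tangent_model "I2 n" X P ?S biwt "loc n i k :: ((nat \<times> nat \<Rightarrow>\<^sub>0 nat) \<Rightarrow>\<^sub>0 'k) \<Rightarrow> _"
    unfolding assms(4) by (rule local_model[OF assms(1) n(1) m P])
  have emb: "alg_embedding ?B (\<lambda>p. p) (single 0)" by (rule alg_embedding_monoid_alg[OF submonoid_hibi])
  have "alg_iso ?B (coord_alg (Sum_Type.Plus (I2_trunc (k + 4)) {..<m})
      (product_variety (I2_trunc (k + 4)) {..<m} Z (affine_space {..<m}))) \<noteq> {}"
    using planar_hibi.coord_alg_iso[OF planar_product[of k m]] unfolding sum_index_image assms(5) .
  then have iso: "?C \<cong>\<^sub>K coord_alg (Sum_Type.Plus (I2_trunc (k + 4)) {..<m})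
      (product_variety (I2_trunc (k + 4)) {..<m} Z (affine_space {..<m}))"
    by (rule alg_isomorphic_common[OF emb sym_iso])
  obtain d :: nat and \<sigma> where \<sigma>: "rational_cone {..<d} \<sigma>" "strongly_convex \<sigma>" "?B \<cong>\<^sub>K toric_alg {..<d} \<sigma>"
    using ext_lattice_toric by blast
  have "?C \<cong>\<^sub>K toric_alg {..<d} \<sigma>"
    by (rule alg_isomorphic_common[OF emb sym_iso \<sigma>(3)[unfolded alg_isomorphic_def]])
  then have toric: "is_affine_toric ?C" unfolding is_affine_toric_def using \<sigma>(1,2) by blast
  \<comment> \<open>In fact m \<ge> 2i; so there is an added element, and the last one is the top of
    the extended lattice.\<close>
  have "1 \<le> m" using m n(1) assms(1) by arith
  note inv = ext_lattice_invariants[OF this, of k]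
  obtain p where p: "\<And>j. of_nat (card (layer (ext_lattice k m) j)) = Polynomial.poly p (of_nat j)"
    "Polynomial.degree p \<le> 2 * k + 2 + m" "Polynomial.coeff p (2 * k + 2 + m) = catalan (k + 2) / fact (2 * k + 2 + m)"
    using inv(2) by blast
  have "hilbert_fun ?C ?c q = card (layer (ext_lattice k m) q)" for q
    by (rule hilbert_fun_eq_card[OF submonoid_hibi sym_iso tangent_cone_cring inv(3)])
      (use sym_piece[of q] in \<open>simp_all add: layer_def\<close>)
  then have hp: "hilbert_poly ?C ?c = p" by (intro hilbert_poly_eqI) (simp add: p(1))
  \<comment> \<open>The Catalan number is nonzero, so the coefficient that was computed is indeed
    the leading one.\<close>
  have "0 < (2 * (k + 2)) choose (k + 2)" by (rule zero_less_binomial) simp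
  then have "catalan (k + 2) \<noteq> 0" unfolding catalan_def by (simp only: mult_eq_0_iff divide_eq_0_iff of_nat_eq_0_iff) simp
  then have "Polynomial.degree p = 2 * k + 2 + m"
    using p(2,3) le_degree[of p "2 * k + 2 + m"] by (intro antisym) simp_all
  then have lead: "Polynomial.lead_coeff p = catalan (k + 2) / fact (2 * k + 2 + m)" using p(3) by simp
  have "\<Psi> \<in> ring_iso ?B ?C" using sym_iso by (simp add: alg_iso_def)
  then have "krull_dim ?C = krull_dim ?B"
    by (rule krull_dim_iso[OF _ MA_cring[OF submonoid_hibi] tangent_cone_cring])
  also have "\<dots> = enat (2 * k + 3 + m)" by (rule inv(1))
  finally have "krull_dim ?C = enat (2 * k + 3 + m)" .
  \<comment> \<open>The dimension exceeds the degree of the Hilbert polynomial by one, so the two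
    factorials cancel.\<close>
  then have "mult_at (I2 n) X P = fact (2 * k + 3 + m - 1) * (catalan (k + 2) / fact (2 * k + 2 + m))"
    by (simp add: mult_at_def graded_degree_def hp lead)
  also have "2 * k + 3 + m - 1 = 2 * k + 2 + m" by simp
  finally have "mult_at (I2 n) X P = catalan (k + 2)" by simp
  moreover have "catalan (k + 2) = 1 / of_nat (k + 3) * of_nat ((2 * k + 4) choose (k + 2))"
  proof -
    have "k + 2 + 1 = k + 3" "2 * (k + 2) = 2 * k + 4" by simp_all
    then show ?thesis unfolding catalan_def by (simp only:)
  qed
  ultimately show ?thesis using m iso toric by blast
qed

end
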